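(* Let $M$ be a closed connected smooth Riemannian manifold and let $G:T^*M\to\mathbb{R}$ be continuous, convex in $p$, and superlinear in $p$ ($G(x,p)/\|p\|_x\to+\infty$ as $\|p\|_x\to\infty$). Let $\sigma:M\to(0,+\infty)$ be a continuous function. If $u_1$ and $u_2$ are viscosity solutions of $G(x,d_xu)=c(G)$ in $M$ and $$\int_M\sigma(y)u_1(y)\,d\mu(y)\le\int_M\sigma(y)u_2(y)\,d\mu(y)$$ for all projected Mather measures $\mu$ of $L_G$, then $u_1\le u_2$ on $M$.
   Context: The critical value of $G$ is $c(G)=\inf_{f\in C^1(M)}\max_{x\in M}G(x,d_xf)$; it is the only constant $c$ for which $G(x,d_xu)=c$ admits viscosity solutions on $M$. The Lagrangian is $L_G(x,v)=\sup_{p\in T_x^*M}(p(v)-G(x,p))$ on $TM$. A Borel probability measure $\tilde\mu$ on $TM$ is closed if $\int_{TM}\|v\|_x\,d\tilde\mu<\infty$ and $\int_{TM}d_x\varphi(v)\,d\tilde\mu(x,v)=0$ for all $\varphi\in C^1(M)$. A Mather measure of $L_G$ is a closed probability measure $\tilde\mu$ with $\int_{TM}L_G\,d\tilde\mu=-c(G)$. A projected Mather measure is $\mu=\pi_\#\tilde\mu$ with $\tilde\mu$ a Mather measure and $\pi:TM\to M$ the canonical projection. *)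

theory Defs
  imports "HOL-Probability.Probability"
begin

section \<open>Smooth manifolds\<close>

text \<open>On an open subset of a Euclidean space this is the usual class \<open>C\<^sup>k\<close>: all directional
  derivatives of a differentiable map are required to be of class \<open>C\<^sup>k\<^sup>-\<^sup>1\<close>.\<close>

primrec Ck_on :: "nat \<Rightarrow> 'b::euclidean_space set \<Rightarrow> ('b \<Rightarrow> 'c::real_normed_vector) \<Rightarrow> bool" where
  "Ck_on 0 S f \<longleftrightarrow> continuous_on S f"
| "Ck_on (Suc k) S f \<longleftrightarrow> (\<forall>x\<in>S. f differentiable (at x)) \<and>
     (\<forall>v. Ck_on k S (\<lambda>x. frechet_derivative f (at x) v))"

definition smooth_on :: "'b::euclidean_space set \<Rightarrow> ('b \<Rightarrow> 'c::real_normed_vector) \<Rightarrow> bool" where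
  "smooth_on S f \<longleftrightarrow> (\<forall>k. Ck_on k S f)"

text \<open>The manifold \<open>M\<close> is the whole type \<open>'a\<close>, modelled on \<open>'b\<close>. A chart is a pair \<open>(U, \<phi>)\<close>
  of a domain and a map whose values outside \<open>U\<close> are irrelevant.\<close>

type_synonym ('a, 'b) chart = "'a set \<times> ('a \<Rightarrow> 'b)"

abbreviation chart_image :: "('a, 'b) chart \<Rightarrow> 'b set" where
  "chart_image c \<equiv> snd c ` fst c"

definition chart_inv :: "('a, 'b) chart \<Rightarrow> 'b \<Rightarrow> 'a" where
  "chart_inv c = inv_into (fst c) (snd c)"

definition transition :: "('a, 'b) chart \<Rightarrow> ('a, 'b) chart \<Rightarrow> 'b \<Rightarrow> 'b" where
  "transition c d = snd d \<circ> chart_inv c"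

definition charts_at :: "('a, 'b) chart set \<Rightarrow> 'a \<Rightarrow> ('a, 'b) chart set" where
  "charts_at A x = {c \<in> A. x \<in> fst c}"

definition smooth_atlas ::
  "('a::{t2_space, second_countable_topology}, 'b::euclidean_space) chart set \<Rightarrow> bool" where
  "smooth_atlas A \<longleftrightarrow>
     (\<forall>c\<in>A. open (fst c) \<and> open (chart_image c) \<and>
        homeomorphism (fst c) (chart_image c) (snd c) (chart_inv c)) \<and>
     (\<Union>c\<in>A. fst c) = UNIV \<and>
     (\<forall>c\<in>A. \<forall>d\<in>A. smooth_on (snd c ` (fst c \<inter> fst d)) (transition c d))"

definition C1_functions ::
  "('a::{t2_space, second_countable_topology}, 'b::euclidean_space) chart set \<Rightarrow> ('a \<Rightarrow> real) set" where
  "C1_functions A = {f. \<forall>c\<in>A. Ck_on 1 (chart_image c) (f \<circ> chart_inv c)}"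

section \<open>Tangent and cotangent bundle\<close>

text \<open>A tangent vector at \<open>x\<close> is the family of its coordinate vectors in all charts around \<open>x\<close>,
  related by the derivatives of the transition maps (and \<open>0\<close> for the other charts, so that equal
  vectors are equal functions). A covector at \<open>x\<close> is a linear functional on the tangent space
  at \<open>x\<close>, extended by \<open>0\<close>.\<close>

type_synonym ('a, 'b) tvector = "('a, 'b) chart \<Rightarrow> 'b"
type_synonym ('a, 'b) covector = "('a, 'b) tvector \<Rightarrow> real"

definition tangent_space ::
  "('a, 'b::euclidean_space) chart set \<Rightarrow> 'a \<Rightarrow> ('a, 'b) tvector set" where
  "tangent_space A x =
     {v. (\<forall>c. c \<notin> charts_at A x \<longrightarrow> v c = 0) \<and>
         (\<forall>c\<in>charts_at A x. \<forall>d\<in>charts_at A x.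
            v d = frechet_derivative (transition c d) (at (snd c x)) (v c))}"

definition cotangent_space ::
  "('a, 'b::euclidean_space) chart set \<Rightarrow> 'a \<Rightarrow> ('a, 'b) covector set" where
  "cotangent_space A x =
     {p. (\<forall>v\<in>tangent_space A x. \<forall>w\<in>tangent_space A x. p (\<lambda>c. v c + w c) = p v + p w) \<and>
         (\<forall>r. \<forall>v\<in>tangent_space A x. p (\<lambda>c. r *\<^sub>R v c) = r * p v) \<and>
         (\<forall>v. v \<notin> tangent_space A x \<longrightarrow> p v = 0)}"

definition tangent_bundle ::
  "('a, 'b::euclidean_space) chart set \<Rightarrow> ('a \<times> ('a, 'b) tvector) set" where
  "tangent_bundle A = Sigma UNIV (tangent_space A)"

definition cotangent_bundle ::
  "('a, 'b::euclidean_space) chart set \<Rightarrow> ('a \<times> ('a, 'b) covector) set" where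
  "cotangent_bundle A = Sigma UNIV (cotangent_space A)"

text \<open>The tangent vector \<open>\<Sum>\<^sub>i a\<^sub>i \<partial>\<^sub>i\<close> and the covector \<open>\<Sum>\<^sub>i \<xi>\<^sub>i dx\<^sub>i\<close> at \<open>x\<close> in the coordinates
  of the chart \<open>c\<close>.\<close>

definition tvector_of ::
  "('a, 'b::euclidean_space) chart set \<Rightarrow> ('a, 'b) chart \<Rightarrow> 'a \<Rightarrow> 'b \<Rightarrow> ('a, 'b) tvector" where
  "tvector_of A c x a =
     (\<lambda>d. if d \<in> charts_at A x then frechet_derivative (transition c d) (at (snd c x)) a else 0)"

definition covector_of ::
  "('a, 'b::euclidean_space) chart set \<Rightarrow> ('a, 'b) chart \<Rightarrow> 'a \<Rightarrow> 'b \<Rightarrow> ('a, 'b) covector" where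
  "covector_of A c x \<xi> = (\<lambda>v. if v \<in> tangent_space A x then \<xi> \<bullet> v c else 0)"

text \<open>The manifold topologies of \<open>TM\<close> and \<open>T\<^sup>*M\<close>: a set is open iff it is open in all the bundle
  charts \<open>\<phi>(U) \<times> 'b\<close>.\<close>

definition tangent_topology ::
  "('a, 'b::euclidean_space) chart set \<Rightarrow> ('a \<times> ('a, 'b) tvector) topology" where
  "tangent_topology A = topology (\<lambda>W. W \<subseteq> tangent_bundle A \<and>
     (\<forall>c\<in>A. open {(y, a). y \<in> chart_image c \<and>
        (chart_inv c y, tvector_of A c (chart_inv c y) a) \<in> W}))"

definition cotangent_topology ::
  "('a, 'b::euclidean_space) chart set \<Rightarrow> ('a \<times> ('a, 'b) covector) topology" where
  "cotangent_topology A = topology (\<lambda>W. W \<subseteq> cotangent_bundle A \<and>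
     (\<forall>c\<in>A. open {(y, \<xi>). y \<in> chart_image c \<and>
        (chart_inv c y, covector_of A c (chart_inv c y) \<xi>) \<in> W}))"

lemma istopology_preimages:
  fixes h :: "'i \<Rightarrow> 'c::topological_space \<Rightarrow> 'd"
  shows "istopology (\<lambda>W. W \<subseteq> B \<and> (\<forall>i\<in>I. open {z. P i z \<and> h i z \<in> W}))"
  unfolding istopology_def
proof (intro conjI allI impI)
  fix S T assume *: "S \<subseteq> B \<and> (\<forall>i\<in>I. open {z. P i z \<and> h i z \<in> S})"
    "T \<subseteq> B \<and> (\<forall>i\<in>I. open {z. P i z \<and> h i z \<in> T})"
  show "S \<inter> T \<subseteq> B" using * by blast
  show "\<forall>i\<in>I. open {z. P i z \<and> h i z \<in> S \<inter> T}"
  proof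
    fix i assume "i \<in> I"
    have "{z. P i z \<and> h i z \<in> S \<inter> T} = {z. P i z \<and> h i z \<in> S} \<inter> {z. P i z \<and> h i z \<in> T}" by blast
    then show "open {z. P i z \<and> h i z \<in> S \<inter> T}" using * \<open>i \<in> I\<close> by (simp only: open_Int)
  qed
next
  fix K assume *: "\<forall>S\<in>K. S \<subseteq> B \<and> (\<forall>i\<in>I. open {z. P i z \<and> h i z \<in> S})"
  show "\<Union>K \<subseteq> B" using * by blast
  show "\<forall>i\<in>I. open {z. P i z \<and> h i z \<in> \<Union>K}"
  proof
    fix i assume "i \<in> I"
    have "{z. P i z \<and> h i z \<in> \<Union>K} = (\<Union>S\<in>K. {z. P i z \<and> h i z \<in> S})" by blast
    then show "open {z. P i z \<and> h i z \<in> \<Union>K}" using * \<open>i \<in> I\<close> by (simp only:) (rule open_UN, blast)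
  qed
qed

lemma openin_tangent_topology:
  "openin (tangent_topology A) W \<longleftrightarrow> W \<subseteq> tangent_bundle A \<and>
     (\<forall>c\<in>A. open {(y, a). y \<in> chart_image c \<and>
        (chart_inv c y, tvector_of A c (chart_inv c y) a) \<in> W})"
  using istopology_preimages[of "tangent_bundle A" A "\<lambda>c z. fst z \<in> chart_image c"
      "\<lambda>c z. (chart_inv c (fst z), tvector_of A c (chart_inv c (fst z)) (snd z))"]
  unfolding tangent_topology_def case_prod_unfold by (simp only: topology_inverse')

lemma openin_cotangent_topology:
  "openin (cotangent_topology A) W \<longleftrightarrow> W \<subseteq> cotangent_bundle A \<and>
     (\<forall>c\<in>A. open {(y, \<xi>). y \<in> chart_image c \<and>
        (chart_inv c y, covector_of A c (chart_inv c y) \<xi>) \<in> W})"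
  using istopology_preimages[of "cotangent_bundle A" A "\<lambda>c z. fst z \<in> chart_image c"
      "\<lambda>c z. (chart_inv c (fst z), covector_of A c (chart_inv c (fst z)) (snd z))"]
  unfolding cotangent_topology_def case_prod_unfold by (simp only: topology_inverse')

definition tangent_borel ::
  "('a, 'b::euclidean_space) chart set \<Rightarrow> ('a \<times> ('a, 'b) tvector) measure" where
  "tangent_borel A = sigma (tangent_bundle A) {W. openin (tangent_topology A) W}"

text \<open>By the chain rule \<open>d\<^sub>xf\<close> does not depend on the chosen chart, see \<open>differential_chart\<close> below.\<close>

definition differential ::
  "('a, 'b::euclidean_space) chart set \<Rightarrow> ('a \<Rightarrow> real) \<Rightarrow> 'a \<Rightarrow> ('a, 'b) covector" where
  "differential A f x =
     (let c = (SOME c. c \<in> charts_at A x) in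
      (\<lambda>v. if v \<in> tangent_space A x
            then frechet_derivative (f \<circ> chart_inv c) (at (snd c x)) (v c) else 0))"

lemma differential_chart:
  assumes A: "smooth_atlas A" and f: "f \<in> C1_functions A"
    and c: "c \<in> charts_at A x" and v: "v \<in> tangent_space A x"
  shows "differential A f x v = frechet_derivative (f \<circ> chart_inv c) (at (snd c x)) (v c)"
proof -
  define d where "d = (SOME c. c \<in> charts_at A x)"
  have d: "d \<in> charts_at A x" unfolding d_def using c by (rule someI)
  have inA: "c \<in> A" "d \<in> A" and xc: "x \<in> fst c" "x \<in> fst d"
    using c d by (auto simp: charts_at_def)
  have opn: "open (fst c)" "open (fst d)" "open (chart_image c)"
    and hom: "homeomorphism (fst c) (chart_image c) (snd c) (chart_inv c)"
      "homeomorphism (fst d) (chart_image d) (snd d) (chart_inv d)"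
    using A inA unfolding smooth_atlas_def by blast+
  have inv: "chart_inv c (snd c z) = z" if "z \<in> fst c" for z
    using hom(1) that unfolding homeomorphism_def by blast
  have invd: "chart_inv d (snd d z) = z" if "z \<in> fst d" for z
    using hom(2) that unfolding homeomorphism_def by blast
  define S where "S = snd c ` (fst c \<inter> fst d)"
  have "S = chart_image c \<inter> chart_inv c -` (fst d)"
    unfolding S_def using inv by auto
  moreover have "continuous_on (chart_image c) (chart_inv c)"
    using hom(1) unfolding homeomorphism_def by blast
  ultimately have "open S"
    using continuous_open_preimage opn by blast
  have xS: "snd c x \<in> S" using xc by (auto simp: S_def)
  have "smooth_on S (transition c d)" using A inA unfolding smooth_atlas_def S_def by blast
  then have "Ck_on (Suc 0) S (transition c d)" unfolding smooth_on_def by blast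
  then have 1: "(transition c d has_derivative frechet_derivative (transition c d) (at (snd c x)))
      (at (snd c x))"
    using xS frechet_derivative_works by auto
  have td: "transition c d (snd c x) = snd d x" by (simp add: transition_def inv xc)
  have "Ck_on (Suc 0) (chart_image d) (f \<circ> chart_inv d)"
    using f inA unfolding C1_functions_def One_nat_def by blast
  then have 2: "((f \<circ> chart_inv d) has_derivative
      frechet_derivative (f \<circ> chart_inv d) (at (snd d x))) (at (snd d x))"
    using xc frechet_derivative_works by auto
  have "(((f \<circ> chart_inv d) \<circ> transition c d) has_derivative
      (frechet_derivative (f \<circ> chart_inv d) (at (snd d x)) \<circ>
       frechet_derivative (transition c d) (at (snd c x)))) (at (snd c x))"
    using diff_chain_at[OF 1] 2 td by simp
  then have "((f \<circ> chart_inv c) has_derivative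
      (frechet_derivative (f \<circ> chart_inv d) (at (snd d x)) \<circ>
       frechet_derivative (transition c d) (at (snd c x)))) (at (snd c x))"
    by (rule has_derivative_transform_within_open[OF _ \<open>open S\<close> xS])
      (auto simp: S_def transition_def inv invd)
  then have "frechet_derivative (f \<circ> chart_inv c) (at (snd c x)) =
      frechet_derivative (f \<circ> chart_inv d) (at (snd d x)) \<circ>
       frechet_derivative (transition c d) (at (snd c x))"
    by (rule frechet_derivative_at[symmetric])
  moreover have "v d = frechet_derivative (transition c d) (at (snd c x)) (v c)"
    using v c d unfolding tangent_space_def by blast
  ultimately show ?thesis
    using v unfolding differential_def d_def[symmetric] Let_def by (simp only: comp_apply if_True)
qed

section \<open>Riemannian metrics\<close>

definition riemannian_metric ::
  "('a::{t2_space, second_countable_topology}, 'b::euclidean_space) chart set \<Rightarrow>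
   ('a \<Rightarrow> ('a, 'b) tvector \<Rightarrow> ('a, 'b) tvector \<Rightarrow> real) \<Rightarrow> bool" where
  "riemannian_metric A g \<longleftrightarrow>
     (\<forall>x. \<forall>u\<in>tangent_space A x. \<forall>v\<in>tangent_space A x. \<forall>w\<in>tangent_space A x. \<forall>r.
        g x v w = g x w v \<and>
        g x (\<lambda>c. u c + v c) w = g x u w + g x v w \<and>
        g x (\<lambda>c. r *\<^sub>R v c) w = r * g x v w \<and>
        (v \<noteq> (\<lambda>c. 0) \<longrightarrow> g x v v > 0)) \<and>
     (\<forall>c\<in>A. \<forall>a b. smooth_on (chart_image c)
        (\<lambda>y. g (chart_inv c y) (tvector_of A c (chart_inv c y) a) (tvector_of A c (chart_inv c y) b)))"

definition closed_connected_riemannian_manifold ::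
  "('a::{t2_space, second_countable_topology}, 'b::euclidean_space) chart set \<Rightarrow>
   ('a \<Rightarrow> ('a, 'b) tvector \<Rightarrow> ('a, 'b) tvector \<Rightarrow> real) \<Rightarrow> bool" where
  "closed_connected_riemannian_manifold A g \<longleftrightarrow>
     compact (UNIV :: 'a set) \<and> connected (UNIV :: 'a set) \<and>
     smooth_atlas A \<and> riemannian_metric A g"

definition tnorm ::
  "('a \<Rightarrow> ('a, 'b) tvector \<Rightarrow> ('a, 'b) tvector \<Rightarrow> real) \<Rightarrow> 'a \<Rightarrow> ('a, 'b) tvector \<Rightarrow> real" where
  "tnorm g x v = sqrt (g x v v)"

definition conorm ::
  "('a, 'b::euclidean_space) chart set \<Rightarrow>
   ('a \<Rightarrow> ('a, 'b) tvector \<Rightarrow> ('a, 'b) tvector \<Rightarrow> real) \<Rightarrow> 'a \<Rightarrow> ('a, 'b) covector \<Rightarrow> real" where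
  "conorm A g x p = (SUP v\<in>{v \<in> tangent_space A x. tnorm g x v \<le> 1}. \<bar>p v\<bar>)"

section \<open>Hamiltonians, viscosity solutions and Mather measures\<close>

definition convex_in_p ::
  "('a, 'b::euclidean_space) chart set \<Rightarrow> ('a \<times> ('a, 'b) covector \<Rightarrow> real) \<Rightarrow> bool" where
  "convex_in_p A G \<longleftrightarrow>
     (\<forall>x. \<forall>p\<in>cotangent_space A x. \<forall>q\<in>cotangent_space A x. \<forall>t\<in>{0..1}.
        G (x, \<lambda>v. (1 - t) * p v + t * q v) \<le> (1 - t) * G (x, p) + t * G (x, q))"

definition superlinear_in_p ::
  "('a, 'b::euclidean_space) chart set \<Rightarrow>
   ('a \<Rightarrow> ('a, 'b) tvector \<Rightarrow> ('a, 'b) tvector \<Rightarrow> real) \<Rightarrow>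
   ('a \<times> ('a, 'b) covector \<Rightarrow> real) \<Rightarrow> bool" where
  "superlinear_in_p A g G \<longleftrightarrow>
     (\<forall>x. filterlim (\<lambda>p. G (x, p) / conorm A g x p) at_top
        (inf (filtercomap (conorm A g x) at_top) (principal (cotangent_space A x))))"

text \<open>For a continuous \<open>G\<close> on a compact manifold the supremum over \<open>x\<close> is a maximum; under
  superlinearity the infimum below and the supremum defining \<open>L\<^sub>G\<close> are finite, so that the
  operators on \<^typ>\<open>real\<close> have their intended values.\<close>

definition critical_value ::
  "('a::{t2_space, second_countable_topology}, 'b::euclidean_space) chart set \<Rightarrow>
   ('a \<times> ('a, 'b) covector \<Rightarrow> real) \<Rightarrow> real" where
  "critical_value A G = (INF f\<in>C1_functions A. SUP x. G (x, differential A f x))"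

definition Lagrangian ::
  "('a, 'b::euclidean_space) chart set \<Rightarrow> ('a \<times> ('a, 'b) covector \<Rightarrow> real) \<Rightarrow>
   'a \<times> ('a, 'b) tvector \<Rightarrow> real" where
  "Lagrangian A G = (\<lambda>(x, v). SUP p\<in>cotangent_space A x. p v - G (x, p))"

definition viscosity_subsolution ::
  "('a::{t2_space, second_countable_topology}, 'b::euclidean_space) chart set \<Rightarrow>
   ('a \<times> ('a, 'b) covector \<Rightarrow> real) \<Rightarrow> real \<Rightarrow> ('a \<Rightarrow> real) \<Rightarrow> bool" where
  "viscosity_subsolution A G c u \<longleftrightarrow> continuous_on UNIV u \<and>
     (\<forall>\<phi>\<in>C1_functions A. \<forall>x. (\<forall>\<^sub>F y in nhds x. u y - \<phi> y \<le> u x - \<phi> x) \<longrightarrow>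
        G (x, differential A \<phi> x) \<le> c)"

definition viscosity_supersolution ::
  "('a::{t2_space, second_countable_topology}, 'b::euclidean_space) chart set \<Rightarrow>
   ('a \<times> ('a, 'b) covector \<Rightarrow> real) \<Rightarrow> real \<Rightarrow> ('a \<Rightarrow> real) \<Rightarrow> bool" where
  "viscosity_supersolution A G c u \<longleftrightarrow> continuous_on UNIV u \<and>
     (\<forall>\<phi>\<in>C1_functions A. \<forall>x. (\<forall>\<^sub>F y in nhds x. u y - \<phi> y \<ge> u x - \<phi> x) \<longrightarrow>
        G (x, differential A \<phi> x) \<ge> c)"

definition viscosity_solution ::
  "('a::{t2_space, second_countable_topology}, 'b::euclidean_space) chart set \<Rightarrow>
   ('a \<times> ('a, 'b) covector \<Rightarrow> real) \<Rightarrow> real \<Rightarrow> ('a \<Rightarrow> real) \<Rightarrow> bool" where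
  "viscosity_solution A G c u \<longleftrightarrow> viscosity_subsolution A G c u \<and> viscosity_supersolution A G c u"

definition closed_measure ::
  "('a::{t2_space, second_countable_topology}, 'b::euclidean_space) chart set \<Rightarrow>
   ('a \<Rightarrow> ('a, 'b) tvector \<Rightarrow> ('a, 'b) tvector \<Rightarrow> real) \<Rightarrow>
   ('a \<times> ('a, 'b) tvector) measure \<Rightarrow> bool" where
  "closed_measure A g \<mu> \<longleftrightarrow>
     prob_space \<mu> \<and> sets \<mu> = sets (tangent_borel A) \<and>
     integrable \<mu> (\<lambda>(x, v). tnorm g x v) \<and>
     (\<forall>\<phi>\<in>C1_functions A. (\<integral>(x, v). differential A \<phi> x v \<partial>\<mu>) = 0)"

text \<open>Integrability of \<open>L\<^sub>G\<close> must be explicit, as the Bochner integral of a non-integrable function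
  is \<open>0\<close>; since \<open>L\<^sub>G\<close> is bounded below, it just says that its integral is not \<open>+\<infinity>\<close>.\<close>

definition Mather_measure ::
  "('a::{t2_space, second_countable_topology}, 'b::euclidean_space) chart set \<Rightarrow>
   ('a \<Rightarrow> ('a, 'b) tvector \<Rightarrow> ('a, 'b) tvector \<Rightarrow> real) \<Rightarrow>
   ('a \<times> ('a, 'b) covector \<Rightarrow> real) \<Rightarrow> ('a \<times> ('a, 'b) tvector) measure \<Rightarrow> bool" where
  "Mather_measure A g G \<mu> \<longleftrightarrow> closed_measure A g \<mu> \<and>
     integrable \<mu> (Lagrangian A G) \<and> (\<integral>z. Lagrangian A G z \<partial>\<mu>) = - critical_value A G"

definition projected_Mather_measure ::
  "('a::{t2_space, second_countable_topology}, 'b::euclidean_space) chart set \<Rightarrow>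
   ('a \<Rightarrow> ('a, 'b) tvector \<Rightarrow> ('a, 'b) tvector \<Rightarrow> real) \<Rightarrow>
   ('a \<times> ('a, 'b) covector \<Rightarrow> real) \<Rightarrow> 'a measure \<Rightarrow> bool" where
  "projected_Mather_measure A g G \<mu> \<longleftrightarrow>
     (\<exists>\<nu>. Mather_measure A g G \<nu> \<and> \<mu> = distr \<nu> borel fst)"

end

theory Submission
  imports Defs
begin

text \<open>Let \<open>K\<close> be the set where \<open>u\<^sub>1 - u\<^sub>2\<close> attains its maximum, assumed positive. If \<open>y\<close> maximises
  \<open>(1 - s) u\<^sub>1 + s \<phi> - u\<^sub>2\<close> with \<open>\<phi>\<close> of class \<open>C\<^sup>1\<close>, doubling of variables and convexity give
  \<open>G (y, d\<^sub>y\<phi>) \<ge> c(G)\<close>; as \<open>s\<close> tends to \<open>0\<close> such points accumulate at \<open>K\<close>, so no \<open>C\<^sup>1\<close> function is a strict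
  subsolution along \<open>K\<close>. By duality there is then a closed probability measure over \<open>K\<close> with
  \<open>\<integral> L\<^sub>G \<le> - c(G)\<close>, which is a Mather measure. It satisfies \<open>\<integral> \<sigma> (u\<^sub>1 - u\<^sub>2) > 0\<close>, a contradiction.

  The measure is a weak limit of finitely supported ones. Weak compactness is reduced to Helly's
  theorem on the real line, every compact subset of a Euclidean space being a continuous image of
  a compact set of real numbers. Velocities stay bounded because only subgradients of \<open>G\<close> at covectors
  of bounded size are needed.\<close>

text \<open>As \<open>G\<close> is merely continuous and convex, there is no Hamiltonian flow and
  velocities are only subgradients; the argument therefore uses test functions and duality alone. At
  a maximum of \<open>u\<^sub>1 - u\<^sub>2\<close> itself, doubling yields just a covector
  \<open>p\<close> with \<open>G p = c\<close>, which says nothing about \<open>\<phi>\<close>. The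
  weight \<open>s\<close> brings \<open>d\<phi>\<close> in: \<open>c \<le> G ((1 - s) p + s d\<phi>)
  \<le> (1 - s) c + s G (d\<phi>)\<close>, and \<open>s\<close> cancels. Duality needs, for each
  \<open>\<phi>\<close>, a velocity \<open>v\<close> over \<open>K\<close> with
  \<open>L v + c \<le> d\<phi> v\<close>. A point with \<open>G (d\<phi>) \<ge> c\<close> supplies
  one, by the equality case of Fenchel-Young at a subgradient. From its definition as a supremum,
  \<open>L\<close> is evidently only lower semicontinuous, so weak limits are taken on triples of
  point, velocity and covector \<open>\<xi>\<close> in subgradient relation. There
  \<open>L = \<xi> v - G \<xi>\<close> is visibly continuous, and a limit of integrals of
  \<open>L\<close> is an integral of \<open>L\<close>. The reverse bound
  \<open>\<integral> L \<ge> - c\<close> holds for closed measures, by Fenchel-Young against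
  \<open>C\<^sup>1\<close> functions that nearly attain \<open>c\<close>. On \<open>K\<close> the
  difference is a positive constant, which is why any positive weight \<open>\<sigma>\<close> is
  allowed.\<close>

section \<open>Weak compactness and a moment problem\<close>

text \<open>Each partial sum depends on finitely many bits, and the Weierstrass test makes the
  convergence uniform. Through \<open>\<pi>\<close> a series reads only selected bits, so that one
  sequence can store several real numbers.\<close>

lemma continuous_on_bit_series:
  fixes a :: "nat \<Rightarrow> real" and \<pi> :: "nat \<Rightarrow> nat"
  assumes "summable a" "\<And>n. 0 \<le> a n"
  shows "continuous_on UNIV (\<lambda>b :: nat \<Rightarrow> bool. \<Sum>n. of_bool (b (\<pi> n)) * a n)"
proof (rule uniform_limit_theorem)
  show "uniform_limit UNIV (\<lambda>n b. \<Sum>i<n. of_bool (b (\<pi> i)) * a i)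
     (\<lambda>b. \<Sum>n. of_bool (b (\<pi> n)) * a n) sequentially"
    using assms by (intro Weierstrass_m_test) auto
  have "continuous_on UNIV (\<lambda>b :: nat \<Rightarrow> bool. of_bool (b (\<pi> i)) :: real)" for i
    by (rule continuous_on_compose2[of UNIV "of_bool :: bool \<Rightarrow> real" _ "\<lambda>b. b (\<pi> i)"])
      (auto intro: continuous_on_product_coordinates)
  then show "\<forall>\<^sub>F n in sequentially. continuous_on UNIV (\<lambda>b :: nat \<Rightarrow> bool. \<Sum>i<n. of_bool (b (\<pi> i)) * a i)"
    by (intro always_eventually allI continuous_intros)
qed simp

lemma compact_bit_sequences: "compact (UNIV :: (nat \<Rightarrow> bool) set)"
proof -
  have "compact_space (product_topology (\<lambda>_::nat. euclidean :: bool topology) UNIV)"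
    unfolding compact_space_product_topology
    by (intro disjI2 ballI) (simp add: compact_space_def finite_imp_compact)
  then show ?thesis
    by (simp add: compact_space_def euclidean_product_topology)
qed

text \<open>The digits are the parities of the floors of \<open>2 ^ Suc n * x\<close>, and the
  partial sums telescope to \<open>\<lfloor>2 ^ n * x\<rfloor> / 2 ^ n\<close>. The point 1 is
  treated apart, as this rule would give it only zero digits.\<close>

lemma binary_expansion_exists:
  fixes x :: real
  assumes "0 \<le> x" "x \<le> 1"
  obtains b :: "nat \<Rightarrow> bool" where "(\<Sum>n. of_bool (b n) * (1/2) ^ Suc n) = x"
proof (cases "x = 1")
  case True
  have "(\<Sum>n. of_bool True * (1/2) ^ Suc n) = (1 :: real)"
    using power_half_series sums_unique by force
  then show ?thesis using that[of "\<lambda>_. True"] True by simp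
next
  case False
  define b where "b n = odd \<lfloor>2 ^ Suc n * x\<rfloor>" for n
  have step: "\<lfloor>2 ^ Suc n * x\<rfloor> = 2 * \<lfloor>2 ^ n * x\<rfloor> + of_bool (b n)" for n
  proof -
    have "\<lfloor>2 ^ Suc n * x\<rfloor> div 2 = \<lfloor>2 ^ n * x\<rfloor>"
      using floor_divide_real_eq_div[of 2 "2 ^ Suc n * x"] by (simp add: mult.assoc)
    then show ?thesis unfolding b_def
      by (metis mult.commute div_mult_mod_eq parity_cases mod_2_eq_odd)
  qed
  have part: "(\<Sum>i<n. of_bool (b i) * (1/2 :: real) ^ Suc i) = of_int \<lfloor>2 ^ n * x\<rfloor> / 2 ^ n" for n
  proof (induction n)
    case 0
    have "\<lfloor>x\<rfloor> = 0" using assms False by (simp add: floor_eq_iff)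
    then show ?case by simp
  next
    case (Suc n)
    show ?case unfolding sum.lessThan_Suc Suc.IH step
      by (simp add: field_simps)
  qed
  have "(\<lambda>n. of_int \<lfloor>2 ^ n * x\<rfloor> / 2 ^ n) \<longlonglongrightarrow> x"
  proof (rule tendsto_sandwich)
    show "\<forall>\<^sub>F n in sequentially. x - (1/2) ^ n \<le> of_int \<lfloor>2 ^ n * x\<rfloor> / 2 ^ n"
    proof (intro always_eventually allI)
      fix n :: nat
      have "2 ^ n * x - 1 \<le> of_int \<lfloor>2 ^ n * x\<rfloor>" by linarith
      then have "(2 ^ n * x - 1) / 2 ^ n \<le> of_int \<lfloor>2 ^ n * x\<rfloor> / 2 ^ n"
        by (intro divide_right_mono) auto
      then show "x - (1/2) ^ n \<le> of_int \<lfloor>2 ^ n * x\<rfloor> / 2 ^ n"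
        by (simp add: diff_divide_distrib power_divide)
    qed
    show "\<forall>\<^sub>F n in sequentially. of_int \<lfloor>2 ^ n * x\<rfloor> / 2 ^ n \<le> x"
      by (intro always_eventually allI) (simp add: field_simps)
    have "(\<lambda>n. x - (1/2) ^ n) \<longlonglongrightarrow> x - 0"
      by (intro tendsto_intros LIMSEQ_power_zero) auto
    then show "(\<lambda>n. x - (1/2) ^ n) \<longlonglongrightarrow> x" by simp
  qed auto
  then have "(\<lambda>n. of_bool (b n) * (1/2) ^ Suc n) sums x"
    unfolding sums_def part .
  then show ?thesis using that[of b] sums_unique by metis
qed

text \<open>Base 3 removes the ambiguity of base 2: all digits after position \<open>m\<close>
  contribute at most half of \<open>(1/3) ^ m\<close>, so the first differing digit decides the
  order. The image is a Cantor set.\<close>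

lemma inj_ternary_series:
  "inj (\<lambda>b :: nat \<Rightarrow> bool. \<Sum>n. of_bool (b n) * (1/3 :: real) ^ n)"
proof (rule injI, rule ccontr)
  fix b d :: "nat \<Rightarrow> bool"
  have less: "(\<Sum>n. of_bool (b n) * (1/3 :: real) ^ n) < (\<Sum>n. of_bool (d n) * (1/3) ^ n)"
    if bd: "\<forall>i<m. b i = d i" "\<not> b m" "d m" for b d :: "nat \<Rightarrow> bool" and m
  proof -
    have sm: "summable (\<lambda>n. of_bool (b n) * (1/3 :: real) ^ n)" for b :: "nat \<Rightarrow> bool"
      by (rule summable_comparison_test'[of "\<lambda>n. (1/3) ^ n"]) (auto intro: summable_geometric)
    define s where "s = (\<Sum>n<m. of_bool (b n) * (1/3 :: real) ^ n)"
    have "(\<Sum>n. of_bool (b n) * (1/3 :: real) ^ n)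
        = (\<Sum>n. of_bool (b (n + Suc m)) * (1/3 :: real) ^ (n + Suc m)) + s"
      using suminf_split_initial_segment[OF sm[of b], of "Suc m"] bd by (simp add: s_def)
    also have "\<dots> \<le> (\<Sum>n. (1/3 :: real) ^ n * (1/3) ^ Suc m) + s"
      using summable_ignore_initial_segment[OF sm[of b], of "Suc m"]
      by (intro add_mono suminf_le summable_mult2) (auto simp: power_add intro: summable_geometric)
    also have "\<dots> = (1/2) * (1/3) ^ m + s"
      by (subst suminf_mult2[symmetric]) (auto simp: suminf_geometric intro: summable_geometric)
    also have "\<dots> < (1/3) ^ m + s" by simp
    also have "\<dots> = (\<Sum>n<Suc m. of_bool (d n) * (1/3 :: real) ^ n)"
      using bd by (simp add: s_def)
    also have "\<dots> \<le> (\<Sum>n. of_bool (d n) * (1/3) ^ n)"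
      by (rule sum_le_suminf[OF sm]) auto
    finally show ?thesis .
  qed
  assume eq: "(\<Sum>n. of_bool (b n) * (1/3 :: real) ^ n) = (\<Sum>n. of_bool (d n) * (1/3) ^ n)"
    and "b \<noteq> d"
  then have "\<exists>m. b m \<noteq> d m" by auto
  define m where "m = (LEAST m. b m \<noteq> d m)"
  have "b m \<noteq> d m" "\<forall>i<m. b i = d i"
    unfolding m_def using \<open>\<exists>m. _ m\<close> by (rule LeastI_ex) (use not_less_Least in blast)
  then show False using less[of m b d] less[of m d b] eq by (cases "b m") auto
qed

text \<open>A case of the Hausdorff-Alexandroff theorem. Binary digits map the bit sequences onto
  the cube of half-width \<open>B\<close>, ternary digits embed them into the line. The preimage
  \<open>S\<close> of \<open>X\<close> is compact, and on its ternary image the embedding can be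
  inverted continuously.\<close>

lemma compact_continuous_image_of_real_compact:
  fixes X :: "'e::euclidean_space set"
  assumes "compact X"
  obtains C :: "real set" and q where "compact C" "continuous_on C q" "q ` C = X"
proof -
  obtain B where B: "B > 0" "\<And>x. x \<in> X \<Longrightarrow> norm x \<le> B"
    using compact_imp_bounded[OF assms] bounded_pos by metis
  define idx :: "'e \<Rightarrow> nat" where "idx = to_nat_on Basis"
  have idx: "inj_on idx Basis" unfolding idx_def by (rule inj_on_to_nat_on) (simp add: countable_finite)
  \<comment> \<open>Interleaving: the \<open>n\<close>-th binary digit of coordinate
    \<open>i\<close> sits at position \<open>prod_encode (n, idx i)\<close>.\<close>
  define val where "val i b = (\<Sum>n. of_bool (b (prod_encode (n, idx i))) * (1/2 :: real) ^ Suc n)"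
    for i and b :: "nat \<Rightarrow> bool"
  define r where "r b = (\<Sum>i\<in>Basis. (2 * B * val i b - B) *\<^sub>R i)" for b
  have "continuous_on UNIV (val i)" for i
    unfolding val_def using power_half_series sums_summable
    by (intro continuous_on_bit_series) auto
  then have r: "continuous_on UNIV r" unfolding r_def by (intro continuous_intros)
  have onto: "x \<in> range r" if "x \<in> X" for x
  proof -
    have "\<exists>b :: nat \<Rightarrow> bool. (\<Sum>n. of_bool (b n) * (1/2) ^ Suc n) = (x \<bullet> i + B) / (2 * B)"
      if i: "i \<in> Basis" for i
    proof -
      have "\<bar>x \<bullet> i\<bar> \<le> B" using B(2)[OF \<open>x \<in> X\<close>] Basis_le_norm[OF i, of x] by linarith
      then have "0 \<le> (x \<bullet> i + B) / (2 * B)" "(x \<bullet> i + B) / (2 * B) \<le> 1"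
        using B(1) by (auto simp: field_simps)
      then show ?thesis using binary_expansion_exists by blast
    qed
    then obtain bits :: "'e \<Rightarrow> nat \<Rightarrow> bool" where bits:
      "\<And>i. i \<in> Basis \<Longrightarrow> (\<Sum>n. of_bool (bits i n) * (1/2) ^ Suc n) = (x \<bullet> i + B) / (2 * B)"
      by metis
    define b where "b k = bits (inv_into Basis idx (snd (prod_decode k))) (fst (prod_decode k))" for k
    have "val i b = (x \<bullet> i + B) / (2 * B)" if "i \<in> Basis" for i
      unfolding val_def b_def using that by (simp add: inv_into_f_f[OF idx] bits[symmetric])
    then have "r b = (\<Sum>i\<in>Basis. (x \<bullet> i) *\<^sub>R i)"
      unfolding r_def using B(1) by (intro sum.cong) (auto simp: field_simps)
    then show ?thesis by (metis euclidean_representation rangeI)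
  qed
  define \<kappa> where "\<kappa> b = (\<Sum>n. of_bool (b n) * (1/3 :: real) ^ n)" for b :: "nat \<Rightarrow> bool"
  have \<kappa>: "continuous_on UNIV \<kappa>"
    unfolding \<kappa>_def using continuous_on_bit_series[of "\<lambda>n. (1/3) ^ n" "\<lambda>n. n"]
    by (simp add: summable_geometric)
  have inj: "inj \<kappa>" using inj_ternary_series unfolding \<kappa>_def .
  define S where "S = r -` X"
  have "closed S" unfolding S_def
    using closed_vimage[OF compact_imp_closed[OF assms] r] .
  then have "compact S" using compact_bit_sequences closed_Int_compact[of S UNIV] by simp
  have inv: "continuous_on (\<kappa> ` S) (inv \<kappa>)"
    by (rule continuous_on_inv) (use \<kappa> inj \<open>compact S\<close> in \<open>auto intro: continuous_on_subset\<close>)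
  show ?thesis
  proof
    show "compact (\<kappa> ` S)" using \<kappa> \<open>compact S\<close> by (intro compact_continuous_image) (auto intro: continuous_on_subset)
    show "continuous_on (\<kappa> ` S) (r \<circ> inv \<kappa>)"
      by (rule continuous_on_compose[OF inv]) (use r continuous_on_subset in blast)
    have "(r \<circ> inv \<kappa>) ` \<kappa> ` S = r ` S" using inj by (simp add: image_image)
    also have "\<dots> = X" unfolding S_def using onto by blast
    finally show "(r \<circ> inv \<kappa>) ` \<kappa> ` S = X" .
  qed
qed

text \<open>The measures are lifted to the line along a section \<open>s\<close> of
  \<open>q\<close>, where tightness gives a weak limit \<open>M\<close>, and \<open>M\<close> is
  pushed back by \<open>q\<close>. Since \<open>q (s x) = x\<close>, integrals of \<open>h\<close>
  become integrals of \<open>h \<circ> q\<close>.\<close>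

lemma pmf_weakly_convergent_subsequence:
  fixes X :: "'e::euclidean_space set" and p :: "nat \<Rightarrow> 'e pmf"
  assumes X: "compact X" and p: "\<And>n. set_pmf (p n) \<subseteq> X"
  obtains P and r :: "nat \<Rightarrow> nat"
  where "prob_space P" "sets P = sets (restrict_space borel X)" "strict_mono r"
    "\<And>h :: 'e \<Rightarrow> real. continuous_on X h \<Longrightarrow>
       (\<lambda>n. measure_pmf.expectation (p (r n)) h) \<longlonglongrightarrow> (\<integral>z. h z \<partial>P)"
proof -
  obtain C :: "real set" and q where C: "compact C" and q: "continuous_on C q" "q ` C = X"
    using compact_continuous_image_of_real_compact[OF X] .
  define s where "s = inv_into C q"
  have s: "s x \<in> C" "q (s x) = x" if "x \<in> X" for x
    using that q(2) unfolding s_def by (auto intro: inv_into_into f_inv_into_f)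
  have "X \<noteq> {}" using p[of 0] set_pmf_not_empty[of "p 0"] by blast
  then have "C \<noteq> {}" using q(2) by auto
  \<comment> \<open>The section \<open>s\<close> is an arbitrary choice; it is measurable because
    every set is measurable for a \<open>pmf\<close>.\<close>
  define \<mu> where "\<mu> n = distr (measure_pmf (p n)) borel s" for n
  have \<mu>: "real_distribution (\<mu> n)" for n
    unfolding \<mu>_def by (intro real_distribution.intro real_distribution_axioms.intro
        measure_pmf.prob_space_distr) auto
  have int_\<mu>: "(\<integral>t. H t \<partial>\<mu> n) = measure_pmf.expectation (p n) (\<lambda>x. H (s x))"
    if "H \<in> borel_measurable borel" for H :: "real \<Rightarrow> real" and n
    unfolding \<mu>_def using that by (intro integral_distr) auto
  obtain B where B: "\<And>t. t \<in> C \<Longrightarrow> \<bar>t\<bar> \<le> B" "B > 0"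
    using compact_imp_bounded[OF C] bounded_pos[of C] by (metis real_norm_def)
  \<comment> \<open>The interval is open on the left, hence the extra 1 that keeps the point
    \<open>-B\<close> inside.\<close>
  have "measure (\<mu> n) {-B - 1<..B} = 1" for n
  proof -
    have "measure (\<mu> n) {-B - 1<..B} = measure (measure_pmf (p n)) (s -` {-B - 1<..B} \<inter> UNIV)"
      unfolding \<mu>_def by (subst measure_distr) auto
    also have "\<dots> = 1"
    proof (subst measure_pmf.prob_eq_1, simp, rule AE_pmfI)
      fix x assume "x \<in> set_pmf (p n)"
      then have "s x \<in> C" using p s by blast
      then show "x \<in> s -` {-B - 1<..B} \<inter> UNIV" using B(1)[of "s x"] by auto
    qed
    finally show ?thesis .
  qed
  then have "tight \<mu>" unfolding tight_def using \<mu> B(2)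
    by (intro conjI allI impI exI[of _ "-B - 1"] exI[of _ B]) auto
  then obtain r M where r: "strict_mono r" and M: "real_distribution M"
    and conv: "weak_conv_m (\<mu> \<circ> id \<circ> r) M"
    using tight_imp_convergent_subsubsequence[of \<mu> id] strict_mono_id by blast
  interpret M: real_distribution M by fact
  have lim: "(\<lambda>n. measure_pmf.expectation (p (r n)) (\<lambda>x. H (s x))) \<longlonglongrightarrow> (\<integral>t. H t \<partial>M)"
    if H: "continuous_on UNIV H" "\<And>t. norm (H t) \<le> b" for H :: "real \<Rightarrow> real" and b
  proof -
    have "(\<lambda>n. integral\<^sup>L ((\<mu> \<circ> id \<circ> r) n) H) \<longlonglongrightarrow> integral\<^sup>L M H"
      using H \<mu> M conv
      by (intro weak_conv_imp_integral_bdd_continuous_conv[where B=b])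
        (auto simp: continuous_on_eq_continuous_at o_def)
    then show ?thesis
      using int_\<mu>[OF borel_measurable_continuous_onI[OF H(1)]] by simp
  qed
  \<comment> \<open>A bounded continuous function vanishing exactly on \<open>C\<close>. Its
    integrals are 0 along the sequence, hence 0 for \<open>M\<close>, so \<open>M\<close> is
    concentrated on \<open>C\<close>.\<close>
  define d where "d t = min 1 (infdist t C)" for t
  have d: "continuous_on UNIV d" "norm (d t) \<le> 1" "0 \<le> d t" for t
    unfolding d_def by (auto intro!: continuous_intros simp: infdist_nonneg)
  have "measure_pmf.expectation (p n) (\<lambda>x. d (s x)) = 0" for n
  proof -
    have "AE x in p n. d (s x) = 0"
      using p s by (auto simp: AE_measure_pmf_iff d_def subset_iff)
    then show ?thesis by (rule integral_eq_zero_AE)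
  qed
  then have "(\<integral>t. d t \<partial>M) = 0" using lim[OF d(1,2)] by (simp add: LIMSEQ_const_iff)
  moreover have "integrable M d"
    using d borel_measurable_continuous_onI[OF d(1)]
    by (intro M.integrable_const_bound[where B=1]) (auto simp: measurable_cong_sets[OF M.events_eq_borel refl])
  ultimately have "AE t in M. d t = 0"
    using integral_nonneg_eq_0_iff_AE[of M d] d(3) by auto
  moreover have "t \<in> C" if "d t = 0" for t
    using that in_closed_iff_infdist_zero[OF compact_imp_closed[OF C] \<open>C \<noteq> {}\<close>]
    by (auto simp: d_def min_def split: if_splits)
  ultimately have AE_C: "AE t in M. t \<in> C" by auto
  have C_sets[measurable]: "C \<in> sets borel" using compact_imp_closed[OF C] by auto
  have "emeasure M C = 1"
    using AE_C M.emeasure_eq_1_AE[of C] by auto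
  define P where "P = distr (restrict_space M C) (restrict_space borel X) q"
  have sets_eq: "sets (restrict_space M C) = sets (restrict_space borel C)"
    by (rule sets_restrict_space_cong) simp
  have q_meas: "q \<in> measurable (restrict_space M C) (restrict_space borel X)"
    using borel_measurable_continuous_on_restrict[OF q(1)] q(2)
    by (intro measurable_restrict_space2)
      (auto simp: space_restrict_space measurable_cong_sets[OF sets_eq refl])
  show ?thesis
  proof (rule that[of P r])
    show "prob_space P" unfolding P_def
      using prob_space_restrict_space[of C M] \<open>emeasure M C = 1\<close> q_meas
      by (intro prob_space.prob_space_distr) auto
    show "sets P = sets (restrict_space borel X)" by (simp add: P_def)
    fix h :: "'e \<Rightarrow> real" assume h: "continuous_on X h"
    have hq: "continuous_on C (h \<circ> q)" using continuous_on_compose[OF q(1)] h q(2) by blast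
    have "compact ((h \<circ> q) ` C)" using compact_continuous_image[OF hq C] .
    then obtain b where b: "b > 0" "\<And>t. t \<in> C \<Longrightarrow> norm ((h \<circ> q) t) \<le> b"
      using compact_imp_bounded bounded_pos[of "(h \<circ> q) ` C"] by (metis imageI)
    \<comment> \<open>Weak convergence tests functions on the whole line, whereas
      \<open>h \<circ> q\<close> matters only on \<open>C\<close>; Tietze extends it with the same
      bound.\<close>
    obtain K where K: "continuous_on UNIV K" "\<And>t. t \<in> C \<Longrightarrow> K t = (h \<circ> q) t" "\<And>t. norm (K t) \<le> b"
      using Tietze[of C "h \<circ> q" UNIV b] hq b compact_imp_closed[OF C] by auto
    have "measure_pmf.expectation (p n) (\<lambda>x. K (s x)) = measure_pmf.expectation (p n) h" for n
      using p s K(2) by (intro integral_cong_AE) (auto simp: AE_measure_pmf_iff subset_iff)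
    moreover have "(\<integral>t. K t \<partial>M) = (\<integral>z. h z \<partial>P)"
    proof -
      have "(\<integral>z. h z \<partial>P) = (\<integral>t. h (q t) \<partial>restrict_space M C)"
        unfolding P_def using q_meas borel_measurable_continuous_on_restrict[OF h]
        by (intro integral_distr) auto
      also have "\<dots> = (\<integral>t. indicator C t *\<^sub>R h (q t) \<partial>M)"
        by (subst integral_restrict_space) auto
      also have "\<dots> = (\<integral>t. indicator C t *\<^sub>R K t \<partial>M)"
        using K(2) by (intro Bochner_Integration.integral_cong) (auto simp: indicator_def)
      also have "\<dots> = (\<integral>t. K t \<partial>M)"
        using AE_C borel_measurable_continuous_onI[OF K(1)]
        by (intro integral_cong_AE) (auto simp: indicator_def)
      finally show ?thesis by simp
    qed
    ultimately show "(\<lambda>n. measure_pmf.expectation (p (r n)) h) \<longlonglongrightarrow> (\<integral>z. h z \<partial>P)"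
      using lim[OF K(1,3)] by simp
  qed (fact r)
qed

text \<open>A finite table of basic open sets with rational values describes a function up to
  \<open>1 / Suc n\<close>. There are countably many tables, and one member of \<open>F\<close> is
  picked for each table that fits some member. Two functions with a common table differ by less than
  \<open>2 / Suc n\<close>. Picking inside \<open>F\<close> keeps \<open>D\<close> within the given
  family.\<close>

lemma uniformly_dense_countable_subset:
  fixes X :: "'a::second_countable_topology set" and F :: "('a \<Rightarrow> real) set"
  assumes X: "compact X" and F: "\<And>f. f \<in> F \<Longrightarrow> continuous_on X f"
  obtains D where "countable D" "D \<subseteq> F"
    "\<And>f e. f \<in> F \<Longrightarrow> e > 0 \<Longrightarrow> \<exists>d\<in>D. \<forall>x\<in>X. \<bar>f x - d x\<bar> < e"
proof -
  obtain \<BB> :: "'a set set" where \<BB>: "countable \<BB>" "topological_basis \<BB>"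
    using ex_countable_basis by blast
  define fits where "fits T n f \<longleftrightarrow> X \<subseteq> (\<Union>(U, r)\<in>T. U) \<and>
    (\<forall>(U, r)\<in>T. \<forall>x\<in>U \<inter> X. \<bar>f x - r\<bar> < 1 / real (Suc n))"
    for T :: "('a set \<times> real) set" and n f
  define \<Theta> where "\<Theta> = {T. finite T \<and> T \<subseteq> \<BB> \<times> (\<rat> :: real set)} \<times> (UNIV :: nat set)"
  define pick where "pick = (\<lambda>(T, n). SOME f. f \<in> F \<and> fits T n f)"
  define D where "D = pick ` {(T, n) \<in> \<Theta>. \<exists>f\<in>F. fits T n f}"
  have pick: "pick (T, n) \<in> F \<and> fits T n (pick (T, n))" if "\<exists>f\<in>F. fits T n f" for T n
    using someI_ex[of "\<lambda>f. f \<in> F \<and> fits T n f"] that unfolding pick_def prod.case by blast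
  show ?thesis
  proof
    have "countable \<Theta>" unfolding \<Theta>_def
      using \<BB>(1) countable_rat by (intro countable_SIGMA countable_Collect_finite_subset) auto
    then show "countable D" unfolding D_def
      by (intro countable_image) (rule countable_subset[rotated], auto)
    show "D \<subseteq> F" unfolding D_def using pick by auto
    fix f and e :: real assume f: "f \<in> F" and "e > 0"
    obtain n where n: "1 / real (Suc n) < e / 2"
      using \<open>e > 0\<close> nat_approx_posE[of "e/2"] by auto
    have "\<exists>U r. U \<in> \<BB> \<and> r \<in> \<rat> \<and> x \<in> U \<and> (\<forall>y\<in>U \<inter> X. \<bar>f y - r\<bar> < 1 / real (Suc n))"
      if x: "x \<in> X" for x
    proof -
      obtain r where r: "r \<in> \<rat>" "f x < r" "r < f x + 1 / real (Suc n)"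
        using Rats_dense_in_real[of "f x" "f x + 1 / real (Suc n)"] by auto
      then have "f x \<in> ball r (1 / real (Suc n))" by (auto simp: dist_real_def)
      then obtain V where V: "open V" "x \<in> V" "\<forall>y\<in>X. y \<in> V \<longrightarrow> f y \<in> ball r (1 / real (Suc n))"
        using F[OF f] x open_ball unfolding continuous_on_topological by metis
      obtain U where "U \<in> \<BB>" "x \<in> U" "U \<subseteq> V" using topological_basisE[OF \<BB>(2) V(1,2)] .
      then show ?thesis using V(3) r(1) by (fastforce simp: dist_real_def abs_minus_commute)
    qed
    then obtain U r where Ur: "\<And>x. x \<in> X \<Longrightarrow> U x \<in> \<BB>" "\<And>x. x \<in> X \<Longrightarrow> r x \<in> \<rat>"
      "\<And>x. x \<in> X \<Longrightarrow> x \<in> U x" "\<And>x y. x \<in> X \<Longrightarrow> y \<in> U x \<inter> X \<Longrightarrow> \<bar>f y - r x\<bar> < 1 / real (Suc n)"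
      by metis
    obtain Y where Y: "Y \<subseteq> X" "finite Y" "X \<subseteq> (\<Union>x\<in>Y. U x)"
      using compactE_image[OF X, of X U] Ur(1,3) topological_basis_open[OF \<BB>(2)] by blast
    define T where "T = (\<lambda>x. (U x, r x)) ` Y"
    have "(T, n) \<in> \<Theta>" unfolding \<Theta>_def T_def using Y Ur by auto
    have fT: "fits T n f" unfolding fits_def T_def using Y Ur(4) by fastforce
    define g where "g = pick (T, n)"
    have g: "fits T n g" "g \<in> D"
      using pick[of T n] f fT \<open>(T, n) \<in> \<Theta>\<close> unfolding g_def D_def by auto
    have "\<bar>f x - g x\<bar> < e" if x: "x \<in> X" for x
    proof -
      obtain V s where "(V, s) \<in> T" "x \<in> V" using fT x unfolding fits_def by blast
      then have "\<bar>f x - s\<bar> < 1 / real (Suc n)" "\<bar>g x - s\<bar> < 1 / real (Suc n)"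
        using fT g(1) x unfolding fits_def by auto
      then show ?thesis using n by linarith
    qed
    then show "\<exists>d\<in>D. \<forall>x\<in>X. \<bar>f x - d x\<bar> < e" using g(2) by blast
  qed
qed


section \<open>Descent on finitely supported measures and the moment problem\<close>

lemma expectation_mix_return_pmf:
  fixes f :: "'a \<Rightarrow> real" and p :: "'a pmf" and t :: real and z :: 'a
  assumes "finite (set_pmf p)" "0 \<le> t" "t \<le> 1"
  defines "p' \<equiv> bernoulli_pmf t \<bind> (\<lambda>b. if b then return_pmf z else p)"
  shows "measure_pmf.expectation p' f = (1 - t) * measure_pmf.expectation p f + t * f z"
    and "finite (set_pmf p')" and "set_pmf p' \<subseteq> insert z (set_pmf p)"
proof -
  show sub: "set_pmf p' \<subseteq> insert z (set_pmf p)"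
    unfolding p'_def by (auto split: if_splits)
  then show "finite (set_pmf p')" using assms(1) finite_subset by blast
  define S where "S = insert z (set_pmf p)"
  have fin: "finite S" using assms(1) by (simp add: S_def)
  have pmf: "pmf p' a = (1 - t) * pmf p a + t * of_bool (a = z)" for a
    unfolding p'_def pmf_bind using assms(2,3) by (simp add: indicator_def)
  have "measure_pmf.expectation p' f = (\<Sum>a\<in>S. f a * pmf p' a)"
    using sub fin by (intro integral_measure_pmf_real) (auto simp: S_def)
  also have "\<dots> = (1 - t) * (\<Sum>a\<in>S. f a * pmf p a) + t * (\<Sum>a\<in>S. if a = z then f a else 0)"
    unfolding pmf sum_distrib_left sum.distrib[symmetric]
    by (intro sum.cong) (auto simp: algebra_simps)
  also have "(\<Sum>a\<in>S. f a * pmf p a) = measure_pmf.expectation p f"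
    using fin by (intro integral_measure_pmf_real[symmetric]) (auto simp: S_def)
  also have "(\<Sum>a\<in>S. if a = z then f a else 0) = f z"
    using fin by (simp add: S_def)
  finally show "measure_pmf.expectation p' f = (1 - t) * measure_pmf.expectation p f + t * f z" .
qed

text \<open>The derivative \<open>2 * max 0 x\<close> is 2-Lipschitz, which gives the Taylor bound
  with remainder \<open>s\<^sup>2\<close>, the same remainder as for an ordinary square.\<close>

lemma pos_part_square_add_le:
  fixes x s :: real
  shows "(max 0 (x + s))\<^sup>2 \<le> (max 0 x)\<^sup>2 + 2 * max 0 x * s + s\<^sup>2"
proof (cases "x \<ge> 0")
  case True
  have "(max 0 (x + s))\<^sup>2 \<le> (x + s)\<^sup>2" by (auto simp: max_def)
  then show ?thesis using True by (simp add: power2_eq_square algebra_simps)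
next
  case False
  then have "max 0 (x + s) \<le> \<bar>s\<bar>" by (auto simp: max_def)
  then have "(max 0 (x + s))\<^sup>2 \<le> \<bar>s\<bar>\<^sup>2" by (intro power_mono) auto
  then show ?thesis using False by (simp add: max_def)
qed

text \<open>The gradient of the defect \<open>J p = \<Sum> (E f\<^sub>k)\<^sup>2 + (max 0 (E l))\<^sup>2\<close> is, up to a factor, the function
  \<open>\<Sum> (E f\<^sub>k) f\<^sub>k + max 0 (E l) l\<close>, which is nearly nonpositive at some \<open>z\<close>. Moving mass to \<open>z\<close> lowers
  \<open>J\<close> by a definite amount as long as \<open>J\<close> is bounded away from \<open>0\<close>, hence its infimum is \<open>0\<close>.\<close>

lemma approximate_moment_pmf:
  fixes X :: "'e::topological_space set" and F :: "('e \<Rightarrow> real) set" and f :: "nat \<Rightarrow> 'e \<Rightarrow> real"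
  assumes X: "compact X" "X \<noteq> {}"
    and F: "\<And>f. f \<in> F \<Longrightarrow> continuous_on X f" "(\<lambda>_. 0) \<in> F"
      "\<And>f g. f \<in> F \<Longrightarrow> g \<in> F \<Longrightarrow> (\<lambda>z. f z + g z) \<in> F" "\<And>f r. f \<in> F \<Longrightarrow> (\<lambda>z. r * f z) \<in> F"
    and l: "continuous_on X l" and above: "\<And>f. f \<in> F \<Longrightarrow> \<exists>z\<in>X. l z \<le> f z"
    and f: "\<And>k. f k \<in> F" and "e > 0"
  shows "\<exists>p. set_pmf p \<subseteq> X \<and> (\<forall>k<n. \<bar>measure_pmf.expectation p (f k)\<bar> < e) \<and>
    measure_pmf.expectation p l < e"
proof -
  have bnd: "\<exists>b. \<forall>x\<in>X. \<bar>h x\<bar> \<le> b" if "continuous_on X h" for h :: "'e \<Rightarrow> real"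
    using compact_imp_bounded[OF compact_continuous_image[OF that X(1)]]
    unfolding bounded_iff by auto
  obtain bl where bl: "\<And>x. x \<in> X \<Longrightarrow> \<bar>l x\<bar> \<le> bl" using bnd[OF l] by blast
  obtain bf where bf: "\<And>k x. x \<in> X \<Longrightarrow> \<bar>f k x\<bar> \<le> bf k" using bnd[OF F(1)[OF f]] by metis
  \<comment> \<open>For \<open>c > 0\<close> the multiple \<open>-1/c\<close> of \<open>g\<close> in
    \<open>above\<close> gives the bound even with 0. For \<open>c = 0\<close> a large multiple
    \<open>N\<close> makes the bounded function \<open>l\<close> negligible, which costs the slack
    \<open>\<eta>\<close>.\<close>
  have point: "\<exists>z\<in>X. g z + c * l z \<le> \<eta>" if g: "g \<in> F" and "0 \<le> c" "0 < \<eta>" for g c \<eta>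
  proof (cases "c = 0")
    case False
    then obtain z where "z \<in> X" "l z \<le> (-1/c) * g z" using above[OF F(4)[OF g, of "-1/c"]] by blast
    then have "c * l z \<le> c * ((-1/c) * g z)" using \<open>0 \<le> c\<close> by (intro mult_left_mono)
    then have "g z + c * l z \<le> 0" using False by simp
    then show ?thesis using \<open>z \<in> X\<close> \<open>0 < \<eta>\<close> by (intro bexI[of _ z]) auto
  next
    case True
    define N where "N = (\<bar>bl\<bar> + 1) / \<eta>"
    have "N > 0" unfolding N_def using \<open>0 < \<eta>\<close> by simp
    obtain z where z: "z \<in> X" "l z \<le> (-N) * g z" using above[OF F(4)[OF g, of "-N"]] by blast
    then have "N * g z \<le> N * \<eta>" using bl[OF z(1)] \<open>0 < \<eta>\<close> by (simp add: N_def)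
    then have "g z \<le> \<eta>" using \<open>N > 0\<close> by simp
    then show ?thesis using z(1) True by auto
  qed
  define \<P> where "\<P> = {p. finite (set_pmf p) \<and> set_pmf p \<subseteq> X}"
  define E where "E p h = measure_pmf.expectation p h" for p :: "'e pmf" and h :: "'e \<Rightarrow> real"
  define J where "J p = (\<Sum>k<n. (E p (f k))\<^sup>2) + (max 0 (E p l))\<^sup>2" for p
  have J0: "0 \<le> J p" for p unfolding J_def by (intro add_nonneg_nonneg sum_nonneg) auto
  obtain x0 where "x0 \<in> X" using X(2) by blast
  then have "return_pmf x0 \<in> \<P>" by (simp add: \<P>_def)
  then have ne: "J ` \<P> \<noteq> {}" by blast
  define j where "j = Inf (J ` \<P>)"
  have jle: "j \<le> J p" if "p \<in> \<P>" for p
    unfolding j_def using that J0 by (intro cInf_lower) (auto intro!: bdd_belowI[of _ 0])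
  have "j \<ge> 0" unfolding j_def using ne J0 by (intro cInf_greatest) auto
  have "j \<le> 0"
  proof (rule ccontr)
    assume "\<not> j \<le> 0"
    then have "j > 0" by simp
    \<comment> \<open>Bounds the second-order term of \<open>J\<close> along any move of mass; the
      summand 1 makes it positive.\<close>
    define Q where "Q = (\<Sum>k<n. (2 * bf k)\<^sup>2) + (2 * bl)\<^sup>2 + 1"
    have "Q > 0" unfolding Q_def by (intro add_nonneg_pos add_nonneg_nonneg sum_nonneg) auto
    \<comment> \<open>With \<open>t * Q \<le> j / 2\<close> a move changes \<open>J p\<close> by at
      most \<open>- t * j + t * j / 2\<close>. Starting from \<open>p\<close> within
      \<open>t * j / 2\<close> of the infimum thus ends strictly below it.\<close>
    define t where "t = min 1 (j / (2 * Q))"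
    have t: "0 < t" "t \<le> 1" "t * Q \<le> j / 2"
      using \<open>j > 0\<close> \<open>Q > 0\<close> by (auto simp: t_def min_def field_simps)
    have "Inf (J ` \<P>) < j + t * j / 2" using t(1) \<open>j > 0\<close> by (simp add: j_def)
    then obtain p where p: "p \<in> \<P>" "J p < j + t * j / 2" using cInf_lessD[OF ne] by blast
    have Eb: "\<bar>E p h\<bar> \<le> b" if "\<And>x. x \<in> X \<Longrightarrow> \<bar>h x\<bar> \<le> b" for h b
    proof -
      have int: "integrable p h" "integrable p (\<lambda>x. \<bar>h x\<bar>)"
        using p(1) by (auto simp: \<P>_def intro: integrable_measure_pmf_finite)
      have "\<bar>E p h\<bar> \<le> measure_pmf.expectation p (\<lambda>x. \<bar>h x\<bar>)"
        unfolding E_def by (rule integral_abs_bound)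
      also have "\<dots> \<le> b"
        using int that p(1) by (intro measure_pmf.integral_le_const) (auto simp: AE_measure_pmf_iff \<P>_def)
      finally show ?thesis .
    qed
    define c where "c = max 0 (E p l)"
    define g where "g z = (\<Sum>k<n. E p (f k) * f k z)" for z
    have "g \<in> F"
    proof -
      have "(\<lambda>z. \<Sum>k<m. E p (f k) * f k z) \<in> F" for m
      proof (induction m)
        case (Suc m)
        show ?case using F(3)[OF Suc F(4)[OF f]] by simp
      qed (simp add: F(2))
      then show ?thesis unfolding g_def[abs_def] .
    qed
    then obtain z where z: "z \<in> X" "g z + c * l z \<le> j / 2"
      using point[of g c "j/2"] \<open>j > 0\<close> by (auto simp: c_def)
    define p' where "p' = bernoulli_pmf t \<bind> (\<lambda>b. if b then return_pmf z else p)"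
    have mix: "E p' h = E p h + t * (h z - E p h)" for h
      using expectation_mix_return_pmf(1)[of p t z h] p(1) t
      by (simp add: E_def p'_def \<P>_def algebra_simps)
    have p': "p' \<in> \<P>" using expectation_mix_return_pmf(2,3)[of p t z] p(1) t z(1)
      by (auto simp: \<P>_def p'_def)
    have sq: "(h z - E p h)\<^sup>2 \<le> (2 * b)\<^sup>2" if "\<And>x. x \<in> X \<Longrightarrow> \<bar>h x\<bar> \<le> b" for h b
    proof -
      have "\<bar>h z - E p h\<bar> \<le> 2 * b" using that[OF z(1)] Eb[of h b, OF that] by auto
      then have "\<bar>h z - E p h\<bar>\<^sup>2 \<le> (2 * b)\<^sup>2" by (intro power_mono) auto
      then show ?thesis by simp
    qed
    have "J p' \<le> (\<Sum>k<n. (E p (f k) + t * (f k z - E p (f k)))\<^sup>2) +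
        (c\<^sup>2 + 2 * c * (t * (l z - E p l)) + (t * (l z - E p l))\<^sup>2)"
      unfolding J_def mix c_def by (intro add_mono order_refl pos_part_square_add_le)
    also have "\<dots> = J p + 2 * t * ((\<Sum>k<n. E p (f k) * (f k z - E p (f k))) + c * (l z - E p l)) +
        t\<^sup>2 * ((\<Sum>k<n. (f k z - E p (f k))\<^sup>2) + (l z - E p l)\<^sup>2)"
    proof -
      have "(a + t * (b - a))\<^sup>2 = a\<^sup>2 + 2 * t * (a * (b - a)) + t\<^sup>2 * (b - a)\<^sup>2" for a b :: real
        by algebra
      then have "(\<Sum>k<n. (E p (f k) + t * (f k z - E p (f k)))\<^sup>2) = (\<Sum>k<n. (E p (f k))\<^sup>2)
          + 2 * t * (\<Sum>k<n. E p (f k) * (f k z - E p (f k))) + t\<^sup>2 * (\<Sum>k<n. (f k z - E p (f k))\<^sup>2)"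
        by (simp only: sum.distrib sum_distrib_left)
      moreover have "A + 2 * t * B + t\<^sup>2 * D + (c\<^sup>2 + 2 * c * (t * d) + (t * d)\<^sup>2)
          = A + c\<^sup>2 + 2 * t * (B + c * d) + t\<^sup>2 * (D + d\<^sup>2)" for A B D d :: real
        by algebra
      ultimately show ?thesis unfolding J_def c_def[symmetric] by (simp only:)
    qed
    also have "(\<Sum>k<n. E p (f k) * (f k z - E p (f k))) + c * (l z - E p l) = g z + c * l z - J p"
    proof -
      have "(\<Sum>k<n. E p (f k) * (f k z - E p (f k))) = g z - (\<Sum>k<n. (E p (f k))\<^sup>2)"
        unfolding g_def by (simp only: right_diff_distrib sum_subtractf power2_eq_square)
      moreover have "c * E p l = c\<^sup>2" by (simp add: c_def power2_eq_square max_def)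
      ultimately show ?thesis unfolding J_def c_def[symmetric] by (simp add: right_diff_distrib)
    qed
    also have "(\<Sum>k<n. (f k z - E p (f k))\<^sup>2) + (l z - E p l)\<^sup>2 \<le> Q"
    proof -
      have "(\<Sum>k<n. (f k z - E p (f k))\<^sup>2) \<le> (\<Sum>k<n. (2 * bf k)\<^sup>2)"
        by (intro sum_mono sq bf)
      moreover have "(l z - E p l)\<^sup>2 \<le> (2 * bl)\<^sup>2" by (intro sq bl)
      ultimately show ?thesis unfolding Q_def by linarith
    qed
    finally have "J p' \<le> J p + 2 * t * (g z + c * l z - J p) + t\<^sup>2 * Q"
      by - (simp_all add: mult_left_mono)
    also have "\<dots> \<le> J p + 2 * t * (j / 2 - j) + t * (j / 2)"
    proof -
      have "t\<^sup>2 * Q \<le> t * (j / 2)"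
        using mult_left_mono[OF t(3), of t] t(1) by (simp add: power2_eq_square mult.assoc)
      moreover have "2 * t * (g z + c * l z - J p) \<le> 2 * t * (j / 2 - j)"
        using z(2) jle[OF p(1)] t(1) by (intro mult_left_mono) auto
      ultimately show ?thesis by linarith
    qed
    also have "\<dots> < j" using p(2) by (simp add: algebra_simps)
    finally show False using jle[OF p'] by simp
  qed
  then have "Inf (J ` \<P>) < e\<^sup>2" using \<open>e > 0\<close> by (auto simp: j_def[symmetric] intro: order_le_less_trans)
  then obtain p where p: "p \<in> \<P>" "J p < e\<^sup>2" using cInf_lessD[OF ne] by blast
  have "(E p (f k))\<^sup>2 < e\<^sup>2" if "k < n" for k
  proof -
    have "(E p (f k))\<^sup>2 \<le> (\<Sum>k<n. (E p (f k))\<^sup>2)"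
      using that by (intro member_le_sum) auto
    moreover have "0 \<le> (max 0 (E p l))\<^sup>2" by simp
    ultimately show ?thesis using p(2) unfolding J_def by linarith
  qed
  then have "\<bar>E p (f k)\<bar> < e" if "k < n" for k
    using that \<open>e > 0\<close> abs_le_square_iff[of e "E p (f k)"] by (simp add: not_le[symmetric])
  moreover have "E p l < e"
  proof -
    have "(max 0 (E p l))\<^sup>2 < e\<^sup>2"
      using p(2) sum_nonneg[of "{..<n}" "\<lambda>k. (E p (f k))\<^sup>2"] by (simp add: J_def)
    then have "max 0 (E p l) < e" using power2_less_imp_less[of "max 0 (E p l)" e] \<open>e > 0\<close> by simp
    then show ?thesis by simp
  qed
  ultimately show ?thesis using p(1) by (auto simp: \<P>_def E_def)
qed

text \<open>A theorem of the alternative: \<open>above\<close> says that no member of the linear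
  space \<open>F\<close> lies strictly below \<open>l\<close> on all of \<open>X\<close>, which is
  clearly necessary. Approximate solutions for the first \<open>n\<close> functions of a dense
  sequence, with error \<open>1 / Suc n\<close>, have a weak limit that solves the problem
  exactly.\<close>

theorem moment_problem_solvable:
  fixes X :: "'e::euclidean_space set" and F :: "('e \<Rightarrow> real) set"
  assumes X: "compact X" "X \<noteq> {}"
    and F: "\<And>f. f \<in> F \<Longrightarrow> continuous_on X f" "(\<lambda>_. 0) \<in> F"
      "\<And>f g. f \<in> F \<Longrightarrow> g \<in> F \<Longrightarrow> (\<lambda>z. f z + g z) \<in> F" "\<And>f r. f \<in> F \<Longrightarrow> (\<lambda>z. r * f z) \<in> F"
    and l: "continuous_on X l" and above: "\<And>f. f \<in> F \<Longrightarrow> \<exists>z\<in>X. l z \<le> f z"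
  obtains P where "prob_space P" "sets P = sets (restrict_space borel X)"
    "\<And>f. f \<in> F \<Longrightarrow> (\<integral>z. f z \<partial>P) = 0" "(\<integral>z. l z \<partial>P) \<le> 0"
proof -
  obtain D where D: "countable D" "D \<subseteq> F"
    "\<And>f e. f \<in> F \<Longrightarrow> e > 0 \<Longrightarrow> \<exists>d\<in>D. \<forall>x\<in>X. \<bar>f x - d x\<bar> < e"
    using uniformly_dense_countable_subset[of X F] X(1) F(1) by blast
  have "D \<noteq> {}" using D(3)[OF F(2), of 1] by auto
  define f where "f = from_nat_into D"
  have f: "f k \<in> F" for k using from_nat_into[OF \<open>D \<noteq> {}\<close>] D(2) by (auto simp: f_def)
  have "\<forall>n. \<exists>p. set_pmf p \<subseteq> X \<and> (\<forall>k<n. \<bar>measure_pmf.expectation p (f k)\<bar> < 1 / Suc n) \<and>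
    measure_pmf.expectation p l < 1 / Suc n"
    by (intro allI, rule approximate_moment_pmf[OF X F l above f]) auto
  then obtain p where p: "\<And>n. set_pmf (p n) \<subseteq> X"
    "\<And>n k. k < n \<Longrightarrow> \<bar>measure_pmf.expectation (p n) (f k)\<bar> < 1 / Suc n"
    "\<And>n. measure_pmf.expectation (p n) l < 1 / Suc n" by metis
  obtain P r where P: "prob_space P" "sets P = sets (restrict_space borel X)" "strict_mono r"
    and lim: "\<And>h :: 'e \<Rightarrow> real. continuous_on X h \<Longrightarrow>
       (\<lambda>n. measure_pmf.expectation (p (r n)) h) \<longlonglongrightarrow> (\<integral>z. h z \<partial>P)"
    by (rule pmf_weakly_convergent_subsequence[of X p, OF X(1) p(1)], rule that)
  interpret P: prob_space P by fact
  have space: "space P = X" using sets_eq_imp_space_eq[OF P(2)] by (simp add: space_restrict_space)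
  have r0: "(\<lambda>n. 1 / real (Suc (r n))) \<longlonglongrightarrow> 0"
    using LIMSEQ_subseq_LIMSEQ[OF LIMSEQ_inverse_real_of_nat P(3)]
    by (simp add: o_def inverse_eq_divide)
  have int: "integrable P h" if h: "continuous_on X h" for h :: "'e \<Rightarrow> real"
  proof -
    obtain b where "\<And>x. x \<in> X \<Longrightarrow> \<bar>h x\<bar> \<le> b"
      using compact_imp_bounded[OF compact_continuous_image[OF h X(1)]] unfolding bounded_iff by auto
    then show ?thesis using borel_measurable_continuous_on_restrict[OF h]
      by (intro P.integrable_const_bound[where B=b]) (auto simp: space measurable_cong_sets[OF P(2) refl])
  qed
  have D0: "(\<integral>z. d z \<partial>P) = 0" if "d \<in> D" for d
  proof -
    obtain k where k: "d = f k" using from_nat_into_surj[OF D(1) \<open>d \<in> D\<close>] by (auto simp: f_def)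
    have "(\<lambda>n. measure_pmf.expectation (p (r n)) (f k)) \<longlonglongrightarrow> 0"
    proof (rule tendsto_0_le[OF r0, where K=1])
      show "\<forall>\<^sub>F n in sequentially. norm (measure_pmf.expectation (p (r n)) (f k))
          \<le> norm (1 / real (Suc (r n))) * 1"
        using eventually_gt_at_top[of k]
      proof eventually_elim
        case (elim n)
        then have "k < r n" using seq_suble[OF P(3), of n] by simp
        from p(2)[OF this] show ?case by simp
      qed
    qed
    then show ?thesis using lim[OF F(1)[OF f]] k LIMSEQ_unique by blast
  qed
  show ?thesis
  proof (rule that[OF P(1,2)])
    show "(\<integral>z. l z \<partial>P) \<le> 0"
      by (rule LIMSEQ_le[OF lim[OF l] r0]) (use p(3) less_imp_le in blast)
    fix g assume g: "g \<in> F"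
    have "\<bar>\<integral>z. g z \<partial>P\<bar> \<le> e" if "e > 0" for e
    proof -
      obtain d where d: "d \<in> D" "\<forall>x\<in>X. \<bar>g x - d x\<bar> < e" using D(3)[OF g \<open>e > 0\<close>] by blast
      have gd: "continuous_on X (\<lambda>x. g x - d x)"
        using F(1) g d(1) D(2) by (intro continuous_intros) blast+
      have "(\<integral>z. g z \<partial>P) = (\<integral>z. g z - d z \<partial>P)"
        using int[OF F(1)[OF g]] int[OF F(1)[of d]] d(1) D(2) D0 by (subst Bochner_Integration.integral_diff) auto
      also have "\<bar>\<dots>\<bar> \<le> (\<integral>z. \<bar>g z - d z\<bar> \<partial>P)" by (rule integral_abs_bound)
      also have "\<dots> \<le> e"
        using int[OF gd] d(2) by (intro P.integral_le_const) (auto simp: space intro!: AE_I2 less_imp_le)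
      finally show ?thesis .
    qed
    then have "\<bar>\<integral>z. g z \<partial>P\<bar> \<le> 0" by (rule dense_ge)
    then show "(\<integral>z. g z \<partial>P) = 0" by simp
  qed
qed

section \<open>Manifolds in coordinates\<close>

text \<open>The vector representing the derivative by the inner product. Covectors in a chart
  thereby become points of the model space, where norms, compactness and convexity are at
  hand.\<close>

definition grad :: "('b::euclidean_space \<Rightarrow> real) \<Rightarrow> 'b \<Rightarrow> 'b" where
  "grad f y = (\<Sum>i\<in>Basis. frechet_derivative f (at y) i *\<^sub>R i)"

lemma linear_eq_inner:
  fixes f :: "'b::euclidean_space \<Rightarrow> real"
  assumes "linear f"
  shows "f a = (\<Sum>i\<in>Basis. f i *\<^sub>R i) \<bullet> a"
proof -
  have "f a = f (\<Sum>i\<in>Basis. (a \<bullet> i) *\<^sub>R i)" by (simp add: euclidean_representation)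
  also have "\<dots> = (\<Sum>i\<in>Basis. (a \<bullet> i) * f i)"
    using assms by (simp add: linear_sum linear_scale)
  also have "\<dots> = (\<Sum>i\<in>Basis. f i *\<^sub>R i) \<bullet> a"
    by (simp add: inner_sum_left inner_commute[of a] mult.commute)
  finally show ?thesis .
qed

lemma frechet_derivative_grad:
  assumes "f differentiable (at y)"
  shows "frechet_derivative f (at y) a = grad f y \<bullet> a"
  unfolding grad_def by (rule linear_eq_inner[OF linear_frechet_derivative[OF assms]])

lemma has_derivative_grad:
  "f differentiable (at y) \<Longrightarrow> (f has_derivative (\<lambda>a. grad f y \<bullet> a)) (at y)"
  using frechet_derivative_works[of f "at y"] frechet_derivative_grad[of f y]
  by (metis (no_types) ext)

lemma grad_eqI:
  assumes "(f has_derivative (\<lambda>a. w \<bullet> a)) (at y)"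
  shows "grad f y = w"
proof -
  have "frechet_derivative f (at y) = (\<lambda>a. w \<bullet> a)" using frechet_derivative_at[OF assms] by simp
  then show ?thesis by (simp add: grad_def euclidean_representation)
qed

lemma Ck_on_1_iff:
  fixes f :: "'b::euclidean_space \<Rightarrow> real"
  shows "Ck_on 1 S f \<longleftrightarrow> (\<forall>y\<in>S. f differentiable (at y)) \<and> continuous_on S (grad f)"
proof
  assume "Ck_on 1 S f"
  then have "\<forall>y\<in>S. f differentiable (at y)"
    and "\<And>v. continuous_on S (\<lambda>y. frechet_derivative f (at y) v)" by auto
  then show "(\<forall>y\<in>S. f differentiable (at y)) \<and> continuous_on S (grad f)"
    unfolding grad_def[abs_def] by (auto intro!: continuous_intros)
next
  assume *: "(\<forall>y\<in>S. f differentiable (at y)) \<and> continuous_on S (grad f)"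
  then have "continuous_on S (\<lambda>y. frechet_derivative f (at y) v)" for v
    by (subst continuous_on_cong[OF refl frechet_derivative_grad]) (auto intro!: continuous_intros)
  with * show "Ck_on 1 S f" by simp
qed

lemma Ck_on_1_D:
  fixes f :: "'b::euclidean_space \<Rightarrow> real"
  assumes "Ck_on 1 S f"
  shows "y \<in> S \<Longrightarrow> f differentiable (at y)" "continuous_on S (grad f)"
  using assms unfolding Ck_on_1_iff by blast+

lemma Ck_on_1_I:
  fixes f :: "'b::euclidean_space \<Rightarrow> real"
  assumes "\<And>y. y \<in> S \<Longrightarrow> (f has_derivative (\<lambda>a. w y \<bullet> a)) (at y)" "continuous_on S w"
  shows "Ck_on 1 S f"
  unfolding Ck_on_1_iff
proof
  show "\<forall>y\<in>S. f differentiable (at y)" using assms(1) differentiableI by blast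
  show "continuous_on S (grad f)"
    using assms grad_eqI by (subst continuous_on_cong[of S S "grad f" w]) auto
qed

text \<open>Being \<open>C\<^sup>1\<close> on a set is a local property; this is what allows
  functions to be patched from several charts.\<close>

lemma Ck_on_1_local:
  fixes f :: "'b::euclidean_space \<Rightarrow> real"
  assumes "\<And>y. y \<in> S \<Longrightarrow> \<exists>U h. open U \<and> y \<in> U \<and> Ck_on 1 U h \<and> (\<forall>z\<in>U. h z = f z)"
  shows "Ck_on 1 S f"
proof -
  have "f differentiable (at y) \<and> isCont (grad f) y" if "y \<in> S" for y
  proof -
    obtain U h where U: "open U" "y \<in> U" "Ck_on 1 U h" "\<And>z. z \<in> U \<Longrightarrow> h z = f z"
      using assms[OF \<open>y \<in> S\<close>] by blast
    have der: "(f has_derivative (\<lambda>a. grad h z \<bullet> a)) (at z)" if z: "z \<in> U" for z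
    proof -
      have "(h has_derivative (\<lambda>a. grad h z \<bullet> a)) (at z)"
        using Ck_on_1_D(1)[OF U(3) z] by (rule has_derivative_grad)
      then show ?thesis
        by (rule has_derivative_transform_within_open[OF _ U(1) z]) (rule U(4))
    qed
    have "continuous_on U (grad f)"
      using Ck_on_1_D(2)[OF U(3)] grad_eqI[OF der] by (subst continuous_on_cong[of U U "grad f" "grad h"]) auto
    then show ?thesis
      using U(1,2) der[OF U(2)] differentiableI by (auto simp: continuous_on_eq_continuous_at)
  qed
  then show ?thesis unfolding Ck_on_1_iff by (auto intro: continuous_at_imp_continuous_on)
qed

lemma Ck_on_1_add:
  fixes f h :: "'b::euclidean_space \<Rightarrow> real"
  assumes "Ck_on 1 S f" "Ck_on 1 S h"
  shows "Ck_on 1 S (\<lambda>y. f y + h y)"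
  by (rule Ck_on_1_I[where w="\<lambda>y. grad f y + grad h y"])
    (auto simp: inner_add_left intro!: has_derivative_add has_derivative_grad continuous_intros
      Ck_on_1_D[OF assms(1)] Ck_on_1_D[OF assms(2)])

lemma Ck_on_1_scale:
  fixes f :: "'b::euclidean_space \<Rightarrow> real"
  assumes "Ck_on 1 S f"
  shows "Ck_on 1 S (\<lambda>y. r * f y)"
  by (rule Ck_on_1_I[where w="\<lambda>y. r *\<^sub>R grad f y"])
    (auto intro!: has_derivative_mult_right has_derivative_grad continuous_intros Ck_on_1_D[OF assms])

lemma has_derivative_max_0_square:
  fixes t :: real
  shows "((\<lambda>t. (max 0 t)\<^sup>2) has_real_derivative 2 * max 0 t) (at t)"
proof (cases t "0 :: real" rule: linorder_cases)
  case less
  have "((\<lambda>_. 0) has_real_derivative 0) (at t)" by simp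
  then have "((\<lambda>t. (max 0 t)\<^sup>2) has_real_derivative 0) (at t)"
    by (rule has_field_derivative_transform_within_open[of _ _ _ "{..<0}"]) (use less in auto)
  then show ?thesis using less by simp
next
  case greater
  have "((\<lambda>t. t\<^sup>2) has_real_derivative 2 * t) (at t)" by (auto intro!: derivative_eq_intros)
  then have "((\<lambda>t. (max 0 t)\<^sup>2) has_real_derivative 2 * t) (at t)"
    by (rule has_field_derivative_transform_within_open[of _ _ _ "{0<..}"]) (use greater in auto)
  then show ?thesis using greater by simp
next
  case equal
  have "((\<lambda>h. ((max 0 h)\<^sup>2) / h) \<longlongrightarrow> 0) (at (0 :: real))"
    by (rule tendsto_0_le[where f="\<lambda>h. h" and K=1])
      (auto simp: max_def power2_eq_square intro!: always_eventually tendsto_eq_intros)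
  then show ?thesis unfolding equal DERIV_def by simp
qed

text \<open>The cutoff is \<open>P (1 - P (\<bar>z - y\<bar>\<^sup>2 / r\<^sup>2 - 1))\<close> with the \<open>C\<^sup>1\<close> function \<open>P t = (max 0 t)\<^sup>2\<close>.\<close>

lemma C1_cutoff_square:
  fixes y b :: "'b::euclidean_space"
  assumes "r > 0"
  obtains H :: "'b \<Rightarrow> real" where "Ck_on 1 UNIV H"
    "\<And>z. z \<in> ball y r \<Longrightarrow> H z = \<alpha> * (norm (z - b))\<^sup>2" "\<And>z. z \<notin> cball y (2 * r) \<Longrightarrow> H z = 0"
proof -
  define m where "m z = (norm (z - y))\<^sup>2 / r\<^sup>2 - 1" for z
  define n where "n z = 1 - (max 0 (m z))\<^sup>2" for z
  define H where "H z = (max 0 (n z))\<^sup>2 * (\<alpha> * (norm (z - b))\<^sup>2)" for z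
  define dm where "dm z = (2 / r\<^sup>2) *\<^sub>R (z - y)" for z
  define dn where "dn z = (- (2 * max 0 (m z))) *\<^sub>R dm z" for z
  have sq: "((\<lambda>z. (norm (z - b))\<^sup>2) has_derivative (\<lambda>a. (2 *\<^sub>R (z - b)) \<bullet> a)) (at z)" for b z :: 'b
    unfolding power2_norm_eq_inner
    by (auto intro!: derivative_eq_intros simp: inner_commute algebra_simps)
  have P: "((\<lambda>z. (max 0 (f z))\<^sup>2) has_derivative (\<lambda>a. (2 * max 0 (f z)) * (w \<bullet> a))) (at z)"
    if "(f has_derivative (\<lambda>a. w \<bullet> a)) (at z)" for f :: "'b \<Rightarrow> real" and w z
    using has_derivative_compose[OF that has_derivative_max_0_square[of "f z", unfolded has_field_derivative_def]]
    by (simp add: o_def)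
  have "(m has_derivative (\<lambda>a. dm z \<bullet> a)) (at z)" for z
    using has_derivative_diff[OF has_derivative_mult_right[OF sq[of y z], of "1 / r\<^sup>2"] has_derivative_const[of 1]]
    unfolding m_def[abs_def] dm_def by simp
  then have "(n has_derivative (\<lambda>a. dn z \<bullet> a)) (at z)" for z
    using has_derivative_diff[OF has_derivative_const[of 1] P[of m "dm z" z]]
    unfolding n_def[abs_def] dn_def by simp
  then have "(H has_derivative (\<lambda>a. ((\<alpha> * (norm (z - b))\<^sup>2 * (2 * max 0 (n z))) *\<^sub>R dn z +
      ((max 0 (n z))\<^sup>2 * \<alpha>) *\<^sub>R (2 *\<^sub>R (z - b))) \<bullet> a)) (at z)" for z
    using has_derivative_mult[OF P[of n "dn z" z] has_derivative_mult_right[OF sq[of b z], of \<alpha>]]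
    unfolding H_def[abs_def] by (simp add: algebra_simps)
  moreover have "continuous_on UNIV m" unfolding m_def[abs_def] using assms by (intro continuous_intros) auto
  moreover from this have "continuous_on UNIV n" unfolding n_def[abs_def] by (intro continuous_intros)
  ultimately have "Ck_on 1 UNIV H"
    using assms by (intro Ck_on_1_I) (auto simp: dn_def dm_def intro!: continuous_intros)
  moreover have "H z = \<alpha> * (norm (z - b))\<^sup>2" if "z \<in> ball y r" for z
  proof -
    have "(norm (z - y))\<^sup>2 \<le> r\<^sup>2" using that by (intro power_mono) (auto simp: dist_norm norm_minus_commute)
    then have "m z \<le> 0" using assms by (simp add: m_def)
    then show ?thesis by (simp add: H_def n_def)
  qed
  moreover have "H z = 0" if "z \<notin> cball y (2 * r)" for z
  proof -
    have "(2 * r)\<^sup>2 \<le> (norm (z - y))\<^sup>2" using that assms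
      by (intro power_mono) (auto simp: dist_norm norm_minus_commute)
    then have "4 \<le> (norm (z - y))\<^sup>2 / r\<^sup>2" using assms by (simp add: field_simps)
    then have "1 \<le> m z" by (simp add: m_def)
    then have "1 \<le> (m z)\<^sup>2" by (simp add: one_le_power)
    then show ?thesis using \<open>1 \<le> m z\<close> by (simp add: H_def n_def)
  qed
  ultimately show ?thesis using that by blast
qed

section \<open>Charts, tangent vectors, covectors and \<open>C\<^sup>1\<close> functions\<close>

locale smooth_manifold =
  fixes A :: "('a::{t2_space, second_countable_topology}, 'b::euclidean_space) chart set"
  assumes atlas: "smooth_atlas A"
begin

lemma
  assumes "c \<in> A"
  shows open_domain: "open (fst c)" and open_chart_image: "open (chart_image c)"
    and chart_inv_snd: "x \<in> fst c \<Longrightarrow> chart_inv c (snd c x) = x"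
    and snd_chart_inv: "y \<in> chart_image c \<Longrightarrow> snd c (chart_inv c y) = y"
    and chart_inv_in: "y \<in> chart_image c \<Longrightarrow> chart_inv c y \<in> fst c"
    and continuous_on_snd_chart: "continuous_on (fst c) (snd c)"
    and continuous_on_chart_inv: "continuous_on (chart_image c) (chart_inv c)"
proof -
  have "open (fst c)" "open (chart_image c)"
    and hom: "homeomorphism (fst c) (chart_image c) (snd c) (chart_inv c)"
    using atlas assms unfolding smooth_atlas_def by blast+
  then show "open (fst c)" "open (chart_image c)" by auto
  show "continuous_on (fst c) (snd c)" "continuous_on (chart_image c) (chart_inv c)"
    "x \<in> fst c \<Longrightarrow> chart_inv c (snd c x) = x"
    "y \<in> chart_image c \<Longrightarrow> snd c (chart_inv c y) = y"
    "y \<in> chart_image c \<Longrightarrow> chart_inv c y \<in> fst c"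
    using hom unfolding homeomorphism_def by blast+
qed

lemma charts_atD: "c \<in> charts_at A x \<Longrightarrow> c \<in> A" "c \<in> charts_at A x \<Longrightarrow> x \<in> fst c"
  "c \<in> charts_at A x \<Longrightarrow> snd c x \<in> chart_image c"
  by (auto simp: charts_at_def)

lemma charts_at_chart_inv: "c \<in> A \<Longrightarrow> y \<in> chart_image c \<Longrightarrow> c \<in> charts_at A (chart_inv c y)"
  using chart_inv_in by (auto simp: charts_at_def)

lemma ex_chart: "\<exists>c. c \<in> charts_at A x"
  using atlas unfolding smooth_atlas_def charts_at_def by blast

lemma open_overlap:
  assumes "c \<in> A" "d \<in> A"
  shows "open (snd c ` (fst c \<inter> fst d))"
proof -
  have "snd c ` (fst c \<inter> fst d) = chart_image c \<inter> chart_inv c -` (fst d)"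
    using chart_inv_snd[OF assms(1)] by auto
  then show ?thesis
    using continuous_open_preimage[OF continuous_on_chart_inv open_chart_image open_domain] assms by simp
qed

lemma Ck_on_transition:
  "c \<in> A \<Longrightarrow> d \<in> A \<Longrightarrow> Ck_on 1 (snd c ` (fst c \<inter> fst d)) (transition c d)"
  using atlas unfolding smooth_atlas_def smooth_on_def by blast

lemma transition_has_derivative:
  assumes "c \<in> charts_at A x" "d \<in> charts_at A x"
  shows "(transition c d has_derivative frechet_derivative (transition c d) (at (snd c x))) (at (snd c x))"
proof -
  have "snd c x \<in> snd c ` (fst c \<inter> fst d)" using assms by (auto simp: charts_at_def)
  then show ?thesis
    using Ck_on_transition[of c d] assms by (auto simp: charts_at_def frechet_derivative_works[symmetric])
qed

lemma transition_at: "c \<in> charts_at A x \<Longrightarrow> transition c d (snd c x) = snd d x"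
  by (simp add: transition_def chart_inv_snd charts_atD)

lemma linear_transition_derivative:
  assumes "c \<in> charts_at A x" "d \<in> charts_at A x"
  shows "linear (frechet_derivative (transition c d) (at (snd c x)))"
  using transition_has_derivative[OF assms] has_derivative_linear by blast

text \<open>The chain rule: \<open>transition d e \<circ> transition c d\<close> coincides with
  \<open>transition c e\<close> on the image of the overlap of \<open>c\<close> and
  \<open>d\<close>, an open neighbourhood of \<open>snd c x\<close>.\<close>

lemma transition_derivative_cocycle:
  assumes "c \<in> charts_at A x" "d \<in> charts_at A x" "e \<in> charts_at A x"
  shows "frechet_derivative (transition d e) (at (snd d x)) (frechet_derivative (transition c d) (at (snd c x)) a)
    = frechet_derivative (transition c e) (at (snd c x)) a"
proof -
  have "((transition d e \<circ> transition c d) has_derivative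
      (frechet_derivative (transition d e) (at (snd d x)) \<circ> frechet_derivative (transition c d) (at (snd c x))))
      (at (snd c x))"
    using diff_chain_at[OF transition_has_derivative[OF assms(1,2)]] transition_has_derivative[OF assms(2,3)]
      transition_at[OF assms(1), of d] by simp
  moreover have "open (snd c ` (fst c \<inter> fst d))" "snd c x \<in> snd c ` (fst c \<inter> fst d)"
    using assms open_overlap by (auto simp: charts_at_def)
  ultimately have "(transition c e has_derivative
      (frechet_derivative (transition d e) (at (snd d x)) \<circ> frechet_derivative (transition c d) (at (snd c x))))
      (at (snd c x))"
    by (rule has_derivative_transform_within_open)
      (use assms in \<open>auto simp: transition_def chart_inv_snd charts_at_def\<close>)
  from frechet_derivative_at[OF this, symmetric] show ?thesis by simp
qed

lemma transition_derivative_self: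
  assumes "c \<in> charts_at A x"
  shows "frechet_derivative (transition c c) (at (snd c x)) a = a"
proof -
  have "((\<lambda>y. y) has_derivative (\<lambda>a. a)) (at (snd c x))" by (rule has_derivative_ident)
  then have "(transition c c has_derivative (\<lambda>a. a)) (at (snd c x))"
    by (rule has_derivative_transform_within_open[of _ _ _ _ "chart_image c"])
      (use assms in \<open>auto simp: open_chart_image transition_def chart_inv_snd charts_at_def\<close>)
  from frechet_derivative_at[OF this, symmetric] show ?thesis by simp
qed

lemma tvector_of_component: "c \<in> charts_at A x \<Longrightarrow> tvector_of A c x a c = a"
  by (simp add: tvector_of_def transition_derivative_self)

lemma tvector_of_in: "c \<in> charts_at A x \<Longrightarrow> tvector_of A c x a \<in> tangent_space A x"
  by (auto simp: tvector_of_def tangent_space_def transition_derivative_cocycle)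

text \<open>Together with \<open>tvector_of_component\<close> and \<open>tvector_of_in\<close> this
  makes \<open>tvector_of A c x\<close> a bijection from the model space onto the tangent space,
  with inverse \<open>v \<mapsto> v c\<close>.\<close>

lemma tvector_of_eq:
  assumes "c \<in> charts_at A x" "v \<in> tangent_space A x"
  shows "tvector_of A c x (v c) = v"
proof
  fix d show "tvector_of A c x (v c) d = v d"
  proof (cases "d \<in> charts_at A x")
    case True
    then have "v d = frechet_derivative (transition c d) (at (snd c x)) (v c)"
      using assms unfolding tangent_space_def by blast
    then show ?thesis using True by (simp add: tvector_of_def)
  next
    case False
    then have "v d = 0" using assms unfolding tangent_space_def by blast
    then show ?thesis using False by (simp add: tvector_of_def)
  qed
qed

lemma tvector_of_add: "c \<in> charts_at A x \<Longrightarrow>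
    tvector_of A c x (a + b) = (\<lambda>d. tvector_of A c x a d + tvector_of A c x b d)"
  by (auto simp: tvector_of_def linear_add[OF linear_transition_derivative])

lemma tvector_of_scaleR: "c \<in> charts_at A x \<Longrightarrow>
    tvector_of A c x (r *\<^sub>R a) = (\<lambda>d. r *\<^sub>R tvector_of A c x a d)"
  by (auto simp: tvector_of_def linear_scale[OF linear_transition_derivative])

lemma covector_of_tvector_of:
  "c \<in> charts_at A x \<Longrightarrow> covector_of A c x \<xi> (tvector_of A c x a) = \<xi> \<bullet> a"
  by (simp add: covector_of_def tvector_of_in tvector_of_component)

lemma tangent_space_add:
  assumes "v \<in> tangent_space A x" "w \<in> tangent_space A x"
  shows "(\<lambda>c. v c + w c) \<in> tangent_space A x"
proof -
  obtain c where c: "c \<in> charts_at A x" using ex_chart by blast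
  have "tvector_of A c x (v c + w c) \<in> tangent_space A x" using c by (rule tvector_of_in)
  then show ?thesis using tvector_of_add[OF c] tvector_of_eq[OF c] assms by simp
qed

lemma tangent_space_scaleR:
  assumes "v \<in> tangent_space A x"
  shows "(\<lambda>c. r *\<^sub>R v c) \<in> tangent_space A x"
proof -
  obtain c where c: "c \<in> charts_at A x" using ex_chart by blast
  have "tvector_of A c x (r *\<^sub>R v c) \<in> tangent_space A x" using c by (rule tvector_of_in)
  then show ?thesis using tvector_of_scaleR[OF c] tvector_of_eq[OF c] assms by simp
qed

lemma covector_of_in: "covector_of A c x \<xi> \<in> cotangent_space A x"
  by (auto simp: covector_of_def cotangent_space_def tangent_space_add tangent_space_scaleR inner_add_right)

text \<open>Every linear functional on the tangent space is an inner product in coordinates. So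
  suprema over the cotangent space become suprema over the model space.\<close>

lemma covector_of_surj:
  assumes c: "c \<in> charts_at A x" and p: "p \<in> cotangent_space A x"
  obtains \<xi> where "p = covector_of A c x \<xi>"
proof
  have "linear (\<lambda>a. p (tvector_of A c x a))"
    using p tvector_of_in[OF c] unfolding cotangent_space_def
    by (intro linearI) (auto simp: tvector_of_add[OF c] tvector_of_scaleR[OF c])
  then have *: "p (tvector_of A c x a) = (\<Sum>i\<in>Basis. p (tvector_of A c x i) *\<^sub>R i) \<bullet> a" for a
    by (rule linear_eq_inner)
  show "p = covector_of A c x (\<Sum>i\<in>Basis. p (tvector_of A c x i) *\<^sub>R i)"
  proof
    fix v show "p v = covector_of A c x (\<Sum>i\<in>Basis. p (tvector_of A c x i) *\<^sub>R i) v"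
    proof (cases "v \<in> tangent_space A x")
      case True
      then show ?thesis using *[of "v c"] by (simp add: tvector_of_eq[OF c] covector_of_def)
    next
      case False
      then show ?thesis using p by (simp add: cotangent_space_def covector_of_def)
    qed
  qed
qed

text \<open>Frees \<open>differential\<close> from the chart chosen inside its definition: in every
  chart around \<open>x\<close> its coordinates are the gradient there.\<close>

lemma differential_eq_covector_of:
  assumes f: "f \<in> C1_functions A" and c: "c \<in> charts_at A x"
  shows "differential A f x = covector_of A c x (grad (f \<circ> chart_inv c) (snd c x))"
proof
  fix v
  have "Ck_on 1 (chart_image c) (f \<circ> chart_inv c)"
    using f c unfolding C1_functions_def charts_at_def by blast
  then have "(f \<circ> chart_inv c) differentiable (at (snd c x))"
    using charts_atD(3)[OF c] unfolding Ck_on_1_iff by blast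
  then show "differential A f x v = covector_of A c x (grad (f \<circ> chart_inv c) (snd c x)) v"
    using differential_chart[OF atlas f c, of v] frechet_derivative_grad
    by (cases "v \<in> tangent_space A x") (auto simp: covector_of_def differential_def Let_def)
qed

lemma C1_functions_add: "f \<in> C1_functions A \<Longrightarrow> h \<in> C1_functions A \<Longrightarrow> (\<lambda>x. f x + h x) \<in> C1_functions A"
  using Ck_on_1_add unfolding C1_functions_def o_def by blast

lemma C1_functions_scale: "f \<in> C1_functions A \<Longrightarrow> (\<lambda>x. r * f x) \<in> C1_functions A"
  using Ck_on_1_scale unfolding C1_functions_def o_def by blast

lemma C1_functions_zero: "(\<lambda>_. 0) \<in> C1_functions A"
  unfolding C1_functions_def o_def by (intro CollectI ballI Ck_on_1_I[where w="\<lambda>_. 0"]) auto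

lemma C1_functions_continuous:
  assumes "f \<in> C1_functions A"
  shows "continuous_on UNIV f"
proof -
  have "isCont f x" for x
  proof -
    obtain c where c: "c \<in> charts_at A x" using ex_chart by blast
    note cA = charts_atD[OF c]
    have "Ck_on 1 (chart_image c) (f \<circ> chart_inv c)"
      using assms cA unfolding C1_functions_def by blast
    then have "continuous_on (chart_image c) (f \<circ> chart_inv c)"
      unfolding Ck_on_1_iff by (intro differentiable_imp_continuous_on)
        (auto simp: differentiable_on_def intro: differentiable_at_withinI)
    then have "continuous_on (fst c) ((f \<circ> chart_inv c) \<circ> snd c)"
      using continuous_on_snd_chart[OF cA(1)] by (rule continuous_on_compose[rotated])
    then have "continuous_on (fst c) f"
      using chart_inv_snd[OF cA(1)] by (subst continuous_on_cong[of _ "fst c" f "(f \<circ> chart_inv c) \<circ> snd c"]) auto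
    then show ?thesis using open_domain[OF cA(1)] cA(2) by (simp add: continuous_on_eq_continuous_at)
  qed
  then show ?thesis by (simp add: continuous_at_imp_continuous_on)
qed

lemma C1_functions_from_chart:
  assumes c: "c \<in> A" and H: "Ck_on 1 UNIV H"
    and K: "compact K" "K \<subseteq> chart_image c" "\<And>z. z \<notin> K \<Longrightarrow> H z = 0"
  shows "(\<lambda>x. if x \<in> fst c then H (snd c x) else 0) \<in> C1_functions A"
  unfolding C1_functions_def
proof (intro CollectI ballI Ck_on_1_local)
  fix d y assume d: "d \<in> A" and y: "y \<in> chart_image d"
  let ?f = "(\<lambda>x. if x \<in> fst c then H (snd c x) else 0) \<circ> chart_inv d"
  define x where "x = chart_inv d y"
  have x: "x \<in> fst d" "snd d x = y"
    using chart_inv_in[OF d y] snd_chart_inv[OF d y] by (auto simp: x_def)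
  show "\<exists>U h. open U \<and> y \<in> U \<and> Ck_on 1 U h \<and> (\<forall>z\<in>U. h z = ?f z)"
  proof (cases "x \<in> fst c")
    case True
    define U where "U = snd d ` (fst d \<inter> fst c)"
    have T: "Ck_on 1 U (transition d c)" using Ck_on_transition[OF d c] by (simp add: U_def)
    have der: "((H \<circ> transition d c) has_derivative
       (\<lambda>a. grad H (transition d c z) \<bullet> frechet_derivative (transition d c) (at z) a)) (at z)" if "z \<in> U" for z
    proof -
      have "(transition d c has_derivative frechet_derivative (transition d c) (at z)) (at z)"
        using T that by (auto simp: frechet_derivative_works[symmetric])
      moreover have "(H has_derivative (\<lambda>a. grad H (transition d c z) \<bullet> a)) (at (transition d c z))"
        using Ck_on_1_D(1)[OF H] by (intro has_derivative_grad) simp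
      ultimately show ?thesis using diff_chain_at by (fastforce simp: o_def)
    qed
    have contT: "continuous_on U (transition d c)"
      using T by (intro differentiable_imp_continuous_on)
        (auto simp: differentiable_on_def intro: differentiable_at_withinI)
    have "continuous_on U (\<lambda>z. frechet_derivative (H \<circ> transition d c) (at z) a)" for a
    proof -
      have "continuous_on U (\<lambda>z. grad H (transition d c z) \<bullet> frechet_derivative (transition d c) (at z) a)"
        using T by (intro continuous_intros continuous_on_compose2[OF Ck_on_1_D(2)[OF H] contT]) auto
      then show ?thesis
        using frechet_derivative_at[OF der, symmetric] by (subst continuous_on_cong[OF refl]) auto
    qed
    then have "Ck_on 1 U (H \<circ> transition d c)"
      using der by (auto simp: differentiable_def simp del: o_apply)
    moreover have "open U" "y \<in> U" using open_overlap[OF d c] x True by (auto simp: U_def)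
    moreover have "(H \<circ> transition d c) z = ?f z" if "z \<in> U" for z
      using that by (auto simp: U_def transition_def chart_inv_snd[OF d])
    ultimately show ?thesis by blast
  next
    case False
    define L where "L = chart_inv c ` K"
    have "compact L" unfolding L_def
      using K continuous_on_chart_inv[OF c] by (intro compact_continuous_image) (auto intro: continuous_on_subset)
    then have "closed L" by (rule compact_imp_closed)
    have "L \<subseteq> fst c" unfolding L_def using K(2) chart_inv_in[OF c] by blast
    define U where "U = chart_image d \<inter> chart_inv d -` (- L)"
    have "open U" unfolding U_def using \<open>closed L\<close>
      by (intro continuous_open_preimage continuous_on_chart_inv open_chart_image d) auto
    moreover have "y \<in> U" using y False \<open>L \<subseteq> fst c\<close> by (auto simp: U_def x_def)
    moreover have "Ck_on 1 U (\<lambda>_. 0 :: real)" by (rule Ck_on_1_I[where w="\<lambda>_. 0"]) auto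
    moreover have "0 = ?f z" if "z \<in> U" for z
    proof -
      have "H (snd c (chart_inv d z)) = 0" if "chart_inv d z \<in> fst c"
      proof (rule K(3))
        show "snd c (chart_inv d z) \<notin> K"
          using \<open>z \<in> U\<close> chart_inv_snd[OF c that] imageI[of "snd c (chart_inv d z)" K "chart_inv c"]
          by (auto simp: U_def L_def)
      qed
      then show ?thesis by simp
    qed
    ultimately show ?thesis by blast
  qed
qed

end

lemma grad_add:
  assumes "f differentiable (at y)" "h differentiable (at y)"
  shows "grad (\<lambda>z. f z + h z) y = grad f y + grad h y"
  using has_derivative_add[OF has_derivative_grad[OF assms(1)] has_derivative_grad[OF assms(2)]]
  by (intro grad_eqI) (simp add: inner_add_left)

lemma grad_scale:
  assumes "f differentiable (at y)"
  shows "grad (\<lambda>z. r * f z) y = r *\<^sub>R grad f y"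
  using has_derivative_mult_right[OF has_derivative_grad[OF assms], of r] by (intro grad_eqI) simp

context smooth_manifold
begin

lemma C1_chart_differentiable:
  assumes "f \<in> C1_functions A" "c \<in> A" "y \<in> chart_image c"
  shows "(f \<circ> chart_inv c) differentiable (at y)"
  using assms Ck_on_1_D(1) unfolding C1_functions_def by blast

lemma
  assumes f: "f \<in> C1_functions A"
  shows differential_add: "h \<in> C1_functions A \<Longrightarrow>
      differential A (\<lambda>x. f x + h x) x v = differential A f x v + differential A h x v"
    and differential_scale: "differential A (\<lambda>x. r * f x) x v = r * differential A f x v"
proof -
  obtain c where ch: "c \<in> charts_at A x" using ex_chart by blast
  note df = C1_chart_differentiable[OF _ charts_atD(1,3)[OF ch]]
  show "differential A (\<lambda>x. f x + h x) x v = differential A f x v + differential A h x v"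
    if h: "h \<in> C1_functions A"
    using grad_add[OF df[OF f] df[OF h]]
    by (simp add: differential_eq_covector_of[OF _ ch] f h C1_functions_add covector_of_def o_def inner_add_left)
  show "differential A (\<lambda>x. r * f x) x v = r * differential A f x v"
    using grad_scale[OF df[OF f], of r]
    by (simp add: differential_eq_covector_of[OF _ ch] f C1_functions_scale covector_of_def o_def)
qed

end

text \<open>Growth assumed ray by ray becomes uniform. Otherwise there are unbounded points of the
  sublevels whose base points and directions converge. By convexity the function stays below
  \<open>max B C\<close> on the segments from 0 to them, so in the limit it does so on a whole ray,
  against \<open>ray\<close>.\<close>

lemma convex_coercive_uniformly:
  fixes h :: "'y::euclidean_space \<Rightarrow> 'b::euclidean_space \<Rightarrow> real"
  assumes P: "compact P" and cont: "continuous_on (P \<times> UNIV) (\<lambda>z. h (fst z) (snd z))"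
    and conv: "\<And>y. y \<in> P \<Longrightarrow> convex_on UNIV (h y)"
    and ray: "\<And>y e K. y \<in> P \<Longrightarrow> norm e = 1 \<Longrightarrow> \<exists>r\<ge>0. K < h y (r *\<^sub>R e)"
  shows "\<exists>R. \<forall>y\<in>P. \<forall>\<xi>. h y \<xi> \<le> C \<longrightarrow> norm \<xi> \<le> R"
proof (rule ccontr)
  assume "\<nexists>R. \<forall>y\<in>P. \<forall>\<xi>. h y \<xi> \<le> C \<longrightarrow> norm \<xi> \<le> R"
  then have "\<forall>n. \<exists>y \<xi>. y \<in> P \<and> h y \<xi> \<le> C \<and> real n < norm \<xi>" by (meson not_le)
  then obtain y \<xi> where y: "\<And>n. y n \<in> P" and \<xi>: "\<And>n. h (y n) (\<xi> n) \<le> C" "\<And>n. real n < norm (\<xi> n)"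
    by metis
  define e where "e n = (1 / norm (\<xi> n)) *\<^sub>R \<xi> n" for n
  have \<xi>0: "norm (\<xi> n) > 0" for n using \<xi>(2)[of n] by (metis of_nat_0_le_iff order_le_less_trans)
  then have e: "e n \<in> sphere 0 1" for n by (auto simp: e_def)
  obtain z r where z: "z \<in> P \<times> sphere 0 1" and r: "strict_mono r" "(\<lambda>n. (y (r n), e (r n))) \<longlonglongrightarrow> z"
  proof -
    have "\<forall>n. (y n, e n) \<in> P \<times> sphere 0 1" using y e by blast
    then show thesis
      using seq_compactE[OF compact_imp_seq_compact[OF compact_Times[OF P compact_sphere[of 0 1]]], of "\<lambda>n. (y n, e n)"]
        that unfolding o_def by metis
  qed
  have "continuous_on P (\<lambda>y. h y 0)"
  proof -
    have "continuous_on P (\<lambda>y. (y, 0 :: 'b))" by (intro continuous_intros)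
    then show ?thesis using continuous_on_compose2[OF cont] by fastforce
  qed
  then have "bdd_above ((\<lambda>y. h y 0) ` P)"
    by (intro bounded_imp_bdd_above compact_imp_bounded compact_continuous_image P)
  then obtain B where B: "\<And>y. y \<in> P \<Longrightarrow> h y 0 \<le> B"
    unfolding bdd_above_def by blast
  obtain s where s: "0 \<le> s" "max B C < h (fst z) (s *\<^sub>R snd z)"
    using ray[of "fst z" "snd z" "max B C"] z by auto
  have le: "h (y n) (s *\<^sub>R e n) \<le> max B C" if "s \<le> real n" for n
  proof -
    define t where "t = s / norm (\<xi> n)"
    have t: "0 \<le> t" "t \<le> 1" using that s(1) \<xi>(2)[of n] \<xi>0[of n] by (auto simp: t_def divide_le_eq_1)
    have "h (y n) ((1 - t) *\<^sub>R 0 + t *\<^sub>R \<xi> n) \<le> (1 - t) * h (y n) 0 + t * h (y n) (\<xi> n)"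
      using convex_onD[OF conv[OF y], of t 0 "\<xi> n"] t by simp
    also have "\<dots> \<le> (1 - t) * max B C + t * max B C"
      using B[OF y[of n]] \<xi>(1)[of n] t by (intro add_mono mult_left_mono) auto
    finally show ?thesis by (simp add: t_def e_def algebra_simps)
  qed
  have lim: "(\<lambda>n. (y (r n), s *\<^sub>R e (r n))) \<longlonglongrightarrow> (fst z, s *\<^sub>R snd z)"
    using tendsto_fst[OF r(2)] tendsto_snd[OF r(2)] by (auto intro!: tendsto_intros)
  have "(\<lambda>n. h (y (r n)) (s *\<^sub>R e (r n))) \<longlonglongrightarrow> h (fst z) (s *\<^sub>R snd z)"
    using continuous_on_tendsto_compose[OF cont lim] z y by auto
  moreover have "\<forall>\<^sub>F n in sequentially. h (y (r n)) (s *\<^sub>R e (r n)) \<le> max B C"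
    using eventually_ge_at_top[of "nat \<lceil>s\<rceil>"]
  proof eventually_elim
    case (elim n)
    then have "s \<le> real (r n)" using seq_suble[OF r(1), of n] by linarith
    then show ?case by (rule le)
  qed
  ultimately have "h (fst z) (s *\<^sub>R snd z) \<le> max B C" by (rule tendsto_upperbound) simp
  then show False using s(2) by simp
qed

text \<open>A hyperplane separates \<open>(\<xi>, h \<xi>)\<close> from the strict epigraph. It is
  not vertical because \<open>h\<close> is finite on the whole space, and its slope is the
  subgradient.\<close>

lemma convex_subgradient_exists:
  fixes h :: "'b::euclidean_space \<Rightarrow> real"
  assumes conv: "convex_on UNIV h"
  obtains a where "\<And>\<eta>. h \<xi> + a \<bullet> (\<eta> - \<xi>) \<le> h \<eta>"
proof -
  define S where "S = {(\<eta>, r). h \<eta> < r}"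
  have "convex S"
  proof (rule convexI)
    fix p q :: "'b \<times> real" and u v :: real
    assume pq: "p \<in> S" "q \<in> S" and uv: "0 \<le> u" "0 \<le> v" "u + v = 1"
    obtain \<eta>1 r1 \<eta>2 r2 where [simp]: "p = (\<eta>1, r1)" "q = (\<eta>2, r2)" by (cases p, cases q) auto
    have "h (u *\<^sub>R \<eta>1 + v *\<^sub>R \<eta>2) \<le> u * h \<eta>1 + v * h \<eta>2"
      using conv uv by (auto simp: convex_on_def)
    also have "\<dots> < u * r1 + v * r2"
    proof (cases "u = 0")
      case False
      then show ?thesis using pq uv by (intro add_less_le_mono mult_left_mono mult_strict_left_mono) (auto simp: S_def)
    qed (use pq uv in \<open>auto simp: S_def\<close>)
    finally show "u *\<^sub>R p + v *\<^sub>R q \<in> S" by (simp add: S_def)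
  qed
  moreover have "(0, h 0 + 1) \<in> S" "(\<xi>, h \<xi>) \<notin> S" by (simp_all add: S_def)
  ultimately obtain w b where w: "w \<noteq> 0" "w \<bullet> (\<xi>, h \<xi>) \<le> b" "\<forall>p\<in>S. b \<le> w \<bullet> p"
    using separating_hyperplane_sets[of "{(\<xi>, h \<xi>)}" S] by (metis (no_types, lifting)
        convex_singleton disjoint_iff empty_iff insert_not_empty singletonD singletonI)
  obtain a \<beta> where [simp]: "w = (a, \<beta>)" by (cases w)
  have sep: "a \<bullet> \<xi> + \<beta> * h \<xi> \<le> a \<bullet> \<eta> + \<beta> * r" if "h \<eta> < r" for \<eta> r
    using w(2) bspec[OF w(3), of "(\<eta>, r)"] that by (auto simp: S_def)
  have "\<beta> \<ge> 0"
  proof (rule ccontr)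
    assume "\<not> \<beta> \<ge> 0"
    then show False using sep[of \<xi> "h \<xi> + 1"] by (simp add: algebra_simps)
  qed
  \<comment> \<open>A vertical hyperplane would make \<open>a \<bullet> \<xi>\<close> a lower bound
    of \<open>a \<bullet> \<eta>\<close> over all \<open>\<eta>\<close>; the point
    \<open>\<xi> - a\<close> violates this.\<close>
  moreover have "\<beta> \<noteq> 0"
  proof
    assume "\<beta> = 0"
    then have "a \<bullet> \<xi> \<le> a \<bullet> (\<xi> - a)" using sep[of "\<xi> - a" "h (\<xi> - a) + 1"] by simp
    then have "a = 0" by (simp add: inner_diff_right) (metis inner_eq_zero_iff inner_ge_zero order_antisym)
    then show False using w(1) \<open>\<beta> = 0\<close> by (simp add: zero_prod_def)
  qed
  ultimately have "\<beta> > 0" by simp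
  show ?thesis
  proof
    fix \<eta>
    have "h \<xi> + ((-1/\<beta>) *\<^sub>R a) \<bullet> (\<eta> - \<xi>) \<le> r" if "h \<eta> < r" for r
    proof -
      have "\<beta> * (h \<xi> + ((-1/\<beta>) *\<^sub>R a) \<bullet> (\<eta> - \<xi>)) \<le> \<beta> * r"
        using sep[OF that] \<open>\<beta> > 0\<close> by (simp add: algebra_simps)
      then show ?thesis using \<open>\<beta> > 0\<close> by simp
    qed
    then show "h \<xi> + ((-1/\<beta>) *\<^sub>R a) \<bullet> (\<eta> - \<xi>) \<le> h \<eta>" by (rule dense_ge)
  qed
qed

section \<open>Topology and measurability of the bundles\<close>

context smooth_manifold
begin

lemma topspace_cotangent_topology: "topspace (cotangent_topology A) = cotangent_bundle A"
proof -
  have "{(y, \<xi>). y \<in> chart_image c \<and> (chart_inv c y, covector_of A c (chart_inv c y) \<xi>) \<in> cotangent_bundle A}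
      = chart_image c \<times> UNIV" for c
    using covector_of_in by (auto simp: cotangent_bundle_def)
  then have "openin (cotangent_topology A) (cotangent_bundle A)"
    unfolding openin_cotangent_topology by (auto intro: open_Times open_chart_image)
  then have "cotangent_bundle A \<subseteq> topspace (cotangent_topology A)" by (rule openin_subset)
  moreover have "topspace (cotangent_topology A) \<subseteq> cotangent_bundle A"
    using iffD1[OF openin_cotangent_topology openin_topspace] by (rule conjunct1)
  ultimately show ?thesis by (rule antisym[rotated])
qed

lemma sets_tangent_borel_open: "openin (tangent_topology A) W \<Longrightarrow> W \<in> sets (tangent_borel A)"
  unfolding tangent_borel_def
  by (subst sets_measure_of) (auto simp: openin_tangent_topology)

lemma space_tangent_borel: "space (tangent_borel A) = tangent_bundle A"
  unfolding tangent_borel_def by (subst space_measure_of) (auto simp: openin_tangent_topology)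

lemma tangent_bundleI: "c \<in> A \<Longrightarrow> y \<in> chart_image c \<Longrightarrow>
    (chart_inv c y, tvector_of A c (chart_inv c y) a) \<in> tangent_bundle A"
  by (simp add: tangent_bundle_def tvector_of_in charts_at_chart_inv)

text \<open>Lower semicontinuity in the bundle charts suffices. This form also serves the
  Lagrangian, a supremum of continuous functions.\<close>

lemma borel_measurable_tangentI:
  fixes f :: "'a \<times> ('a, 'b) tvector \<Rightarrow> real"
  assumes "\<And>c t. c \<in> A \<Longrightarrow> open {(y, a). y \<in> chart_image c \<and> t < f (chart_inv c y, tvector_of A c (chart_inv c y) a)}"
  shows "f \<in> borel_measurable (tangent_borel A)"
  unfolding borel_measurable_iff_greater space_tangent_borel
proof (intro allI sets_tangent_borel_open)
  fix t
  have "{(y, a). y \<in> chart_image c \<and> (chart_inv c y, tvector_of A c (chart_inv c y) a) \<in> {w \<in> tangent_bundle A. t < f w}}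
      = {(y, a). y \<in> chart_image c \<and> t < f (chart_inv c y, tvector_of A c (chart_inv c y) a)}" if "c \<in> A" for c
    using tangent_bundleI[OF that] by auto
  then show "openin (tangent_topology A) {w \<in> tangent_bundle A. t < f w}"
    unfolding openin_tangent_topology using assms by auto
qed

lemma borel_measurable_tangent_continuous:
  fixes f :: "'a \<times> ('a, 'b) tvector \<Rightarrow> real"
  assumes "\<And>c. c \<in> A \<Longrightarrow> continuous_on (chart_image c \<times> UNIV)
    (\<lambda>z. f (chart_inv c (fst z), tvector_of A c (chart_inv c (fst z)) (snd z)))"
  shows "f \<in> borel_measurable (tangent_borel A)"
proof (rule borel_measurable_tangentI)
  fix c t assume c: "c \<in> A"
  have "open ((chart_image c \<times> UNIV) \<inter> (\<lambda>z. f (chart_inv c (fst z), tvector_of A c (chart_inv c (fst z)) (snd z))) -` {t<..})"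
    using assms[OF c] open_chart_image[OF c] by (intro continuous_open_preimage open_Times) auto
  also have "\<dots> = {(y, a). y \<in> chart_image c \<and> t < f (chart_inv c y, tvector_of A c (chart_inv c y) a)}"
    by auto
  finally show "open {(y, a). y \<in> chart_image c \<and> t < f (chart_inv c y, tvector_of A c (chart_inv c y) a)}" .
qed

lemma measurable_fst_tangent: "fst \<in> measurable (tangent_borel A) (borel :: 'a measure)"
proof (rule borel_measurableI)
  fix S :: "'a set" assume S: "open S"
  have "open {(y, a :: 'b). y \<in> chart_image c \<and>
      (chart_inv c y, tvector_of A c (chart_inv c y) a) \<in> fst -` S \<inter> tangent_bundle A}" if c: "c \<in> A" for c
  proof -
    have "{(y, a :: 'b). y \<in> chart_image c \<and>
      (chart_inv c y, tvector_of A c (chart_inv c y) a) \<in> fst -` S \<inter> tangent_bundle A}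
      = (chart_image c \<inter> chart_inv c -` S) \<times> UNIV"
      using tangent_bundleI[OF c] by auto
    then show ?thesis
      using continuous_open_preimage[OF continuous_on_chart_inv[OF c] open_chart_image[OF c] S] by (simp add: open_Times)
  qed
  then show "fst -` S \<inter> space (tangent_borel A) \<in> sets (tangent_borel A)"
    unfolding space_tangent_borel
    by (intro sets_tangent_borel_open) (auto simp: openin_tangent_topology)
qed

lemma continuous_on_differential:
  assumes f: "f \<in> C1_functions A" and c: "c \<in> A"
  shows "continuous_on (chart_image c \<times> UNIV)
    (\<lambda>z. differential A f (chart_inv c (fst z)) (tvector_of A c (chart_inv c (fst z)) (snd z)))"
proof -
  have "continuous_on (chart_image c) (grad (f \<circ> chart_inv c))"
    using f c Ck_on_1_D(2) unfolding C1_functions_def by blast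
  then have "continuous_on (chart_image c \<times> UNIV) (\<lambda>z :: 'b \<times> 'b. grad (f \<circ> chart_inv c) (fst z) \<bullet> snd z)"
    by (intro continuous_intros continuous_on_compose2[of _ "grad (f \<circ> chart_inv c)" _ fst]) auto
  moreover have "differential A f (chart_inv c (fst z)) (tvector_of A c (chart_inv c (fst z)) (snd z))
      = grad (f \<circ> chart_inv c) (fst z) \<bullet> snd z" if "z \<in> chart_image c \<times> UNIV" for z
    using that c by (auto simp: differential_eq_covector_of[OF f charts_at_chart_inv]
        covector_of_tvector_of charts_at_chart_inv snd_chart_inv)
  ultimately show ?thesis by (subst continuous_on_cong[OF refl]) auto
qed

end

section \<open>The Riemannian metric in coordinates\<close>

locale riemannian_manifold = smooth_manifold A
  for A :: "('a::{t2_space, second_countable_topology}, 'b::euclidean_space) chart set" +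
  fixes g :: "'a \<Rightarrow> ('a, 'b) tvector \<Rightarrow> ('a, 'b) tvector \<Rightarrow> real"
  assumes metric: "riemannian_metric A g"
begin

definition gform :: "('a, 'b) chart \<Rightarrow> 'b \<Rightarrow> 'b \<Rightarrow> 'b \<Rightarrow> real" where
  "gform c y a b = g (chart_inv c y) (tvector_of A c (chart_inv c y) a) (tvector_of A c (chart_inv c y) b)"

lemma metric_at:
  assumes "u \<in> tangent_space A x" "v \<in> tangent_space A x" "w \<in> tangent_space A x"
  shows "g x v w = g x w v" "g x (\<lambda>c. u c + v c) w = g x u w + g x v w"
    "g x (\<lambda>c. r *\<^sub>R v c) w = r * g x v w" "v \<noteq> (\<lambda>c. 0) \<Longrightarrow> g x v v > 0"
  using metric assms unfolding riemannian_metric_def by blast+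

lemma
  assumes c: "c \<in> A" and y: "y \<in> chart_image c"
  shows gform_expand: "gform c y a b = (\<Sum>i\<in>Basis. \<Sum>j\<in>Basis. (a \<bullet> i) * (b \<bullet> j) * gform c y i j)"
    and gform_pos: "a \<noteq> 0 \<Longrightarrow> gform c y a a > 0"
    and gform_scale: "gform c y (r *\<^sub>R a) (r *\<^sub>R a) = r\<^sup>2 * gform c y a a"
proof -
  note ch = charts_at_chart_inv[OF c y]
  note T = tvector_of_in[OF ch]
  have sym: "gform c y a b = gform c y b a" for a b
    unfolding gform_def using metric_at(1)[OF T T T] .
  have lin: "linear (\<lambda>a. gform c y a b)" for b
    unfolding gform_def using metric_at(2,3)[OF T T T]
    by (intro linearI) (auto simp: tvector_of_add[OF ch] tvector_of_scaleR[OF ch])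
  have e1: "gform c y a b = (\<Sum>i\<in>Basis. (a \<bullet> i) * gform c y i b)" for a b
    using linear_eq_inner[OF lin, of a b] by (simp add: inner_sum_left inner_commute[of a] mult.commute)
  show "gform c y a b = (\<Sum>i\<in>Basis. \<Sum>j\<in>Basis. (a \<bullet> i) * (b \<bullet> j) * gform c y i j)"
    unfolding e1[of a b] sum_distrib_left
    by (subst sym, subst e1) (auto simp: sum_distrib_left sym mult.assoc intro!: sum.cong)
  show "gform c y a a > 0" if "a \<noteq> 0"
  proof -
    have "tvector_of A c (chart_inv c y) a \<noteq> (\<lambda>c. 0)"
      using tvector_of_component[OF ch, of a] that by (metis)
    then show ?thesis unfolding gform_def using metric_at(4)[OF T T T] by blast
  qed
  show "gform c y (r *\<^sub>R a) (r *\<^sub>R a) = r\<^sup>2 * gform c y a a"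
    using linear_scale[OF lin] sym by (simp add: power2_eq_square)
qed

lemma tnorm_tvector_of: "tnorm g (chart_inv c y) (tvector_of A c (chart_inv c y) a) = sqrt (gform c y a a)"
  by (simp add: tnorm_def gform_def)

text \<open>The metric is given as smooth in the point for fixed coordinate vectors; the finite
  expansion in basis vectors upgrades this to joint continuity.\<close>

lemma continuous_on_tnorm:
  assumes c: "c \<in> A"
  shows "continuous_on (chart_image c \<times> UNIV)
    (\<lambda>z. tnorm g (chart_inv c (fst z)) (tvector_of A c (chart_inv c (fst z)) (snd z)))"
proof -
  have "Ck_on 0 (chart_image c) (\<lambda>y. gform c y i j)" for i j
    using metric c unfolding riemannian_metric_def smooth_on_def gform_def by blast
  then have gc: "continuous_on (chart_image c) (\<lambda>y. gform c y i j)" for i j by simp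
  have "continuous_on (chart_image c \<times> UNIV)
      (\<lambda>z. sqrt (\<Sum>i\<in>Basis. \<Sum>j\<in>Basis. (snd z \<bullet> i) * (snd z \<bullet> j) * gform c (fst z) i j))"
    by (intro continuous_intros continuous_on_compose2[OF gc, of _ fst]) auto
  then show ?thesis
    unfolding tnorm_tvector_of
    by (subst continuous_on_cong[OF refl]) (auto simp: gform_expand[OF c, symmetric] intro!: arg_cong[of _ _ sqrt])
qed

text \<open>Testing \<open>r *\<^sub>R e\<close> against the multiple of \<open>e\<close> of unit
  Riemannian length gives linear growth. The supremum in \<open>conorm\<close> dominates this value
  only if it is taken over a bounded set of reals, which follows from the positive minimum
  \<open>\<delta>\<close> of the metric on the Euclidean unit sphere.\<close>

lemma conorm_ge_on_ray:
  assumes c: "c \<in> A" and y: "y \<in> chart_image c" and "e \<noteq> 0"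
  obtains \<kappa> where "\<kappa> > 0"
    "\<And>r. 0 \<le> r \<Longrightarrow> \<kappa> * r \<le> conorm A g (chart_inv c y) (covector_of A c (chart_inv c y) (r *\<^sub>R e))"
proof -
  note ch = charts_at_chart_inv[OF c y]
  define q where "q a = gform c y a a" for a
  have "continuous_on (sphere 0 1) q"
  proof -
    have "q = (\<lambda>a. \<Sum>i\<in>Basis. \<Sum>j\<in>Basis. (a \<bullet> i) * (a \<bullet> j) * gform c y i j)"
      unfolding q_def by (rule ext) (rule gform_expand[OF c y])
    then show ?thesis by (simp only:) (intro continuous_intros)
  qed
  moreover have "sphere (0 :: 'b) 1 \<noteq> {}" by simp
  ultimately obtain a0 where a0: "a0 \<in> sphere 0 1" "\<And>a. a \<in> sphere 0 1 \<Longrightarrow> q a0 \<le> q a"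
    using continuous_attains_inf[OF compact_sphere] by metis
  define \<delta> where "\<delta> = q a0"
  have "a0 \<noteq> 0" using a0(1) by auto
  then have "\<delta> > 0" unfolding \<delta>_def q_def by (rule gform_pos[OF c y])
  have low: "\<delta> * (norm a)\<^sup>2 \<le> q a" for a
  proof (cases "a = 0")
    case True
    then show ?thesis using gform_scale[OF c y, of 0 a] by (simp add: q_def)
  next
    case False
    then have "\<delta> \<le> q ((1 / norm a) *\<^sub>R a)" unfolding \<delta>_def by (intro a0(2)) auto
    also have "\<dots> = (1 / norm a)\<^sup>2 * q a" unfolding q_def by (rule gform_scale[OF c y])
    finally show ?thesis using False by (simp add: field_simps)
  qed
  let ?x = "chart_inv c y"
  let ?B = "{v \<in> tangent_space A ?x. tnorm g ?x v \<le> 1}"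
  have bdd: "bdd_above ((\<lambda>v. \<bar>covector_of A c ?x \<xi> v\<bar>) ` ?B)" for \<xi>
  proof (rule bdd_aboveI2)
    fix v assume v: "v \<in> ?B"
    define a where "a = v c"
    have va: "v = tvector_of A c ?x a" using v tvector_of_eq[OF ch] by (simp add: a_def)
    then have "sqrt (q a) \<le> 1" using v by (simp add: tnorm_tvector_of q_def)
    then have "\<delta> * (norm a)\<^sup>2 \<le> 1" using low[of a] by simp
    then have "(norm a)\<^sup>2 \<le> 1 / \<delta>" using \<open>\<delta> > 0\<close> by (simp add: field_simps)
    then have "norm a \<le> sqrt (1 / \<delta>)" by (rule real_le_rsqrt)
    moreover have "\<bar>covector_of A c ?x \<xi> v\<bar> \<le> norm \<xi> * norm a"
      unfolding va covector_of_tvector_of[OF ch] by (rule Cauchy_Schwarz_ineq2)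
    ultimately show "\<bar>covector_of A c ?x \<xi> v\<bar> \<le> norm \<xi> * sqrt (1 / \<delta>)"
      by (meson mult_left_mono norm_ge_zero order_trans)
  qed
  define s where "s = 1 / sqrt (q e)"
  have "q e > 0" unfolding q_def using gform_pos[OF c y \<open>e \<noteq> 0\<close>] .
  then have s: "s > 0" by (simp add: s_def)
  have "q (s *\<^sub>R e) = 1"
    unfolding q_def gform_scale[OF c y] using \<open>q e > 0\<close> by (simp add: s_def q_def[symmetric] power_divide)
  then have inB: "tvector_of A c ?x (s *\<^sub>R e) \<in> ?B"
    using tvector_of_in[OF ch] by (simp add: tnorm_tvector_of q_def)
  show ?thesis
  proof (rule that[of "s * (norm e)\<^sup>2"])
    show "s * (norm e)\<^sup>2 > 0" using s \<open>e \<noteq> 0\<close> by simp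
    fix r :: real assume "0 \<le> r"
    have "s * (norm e)\<^sup>2 * r = \<bar>covector_of A c ?x (r *\<^sub>R e) (tvector_of A c ?x (s *\<^sub>R e))\<bar>"
      using s \<open>0 \<le> r\<close> by (simp add: covector_of_tvector_of[OF ch] power2_norm_eq_inner abs_mult)
    also have "\<dots> \<le> conorm A g ?x (covector_of A c ?x (r *\<^sub>R e))"
      unfolding conorm_def by (rule cSUP_upper[OF inB bdd])
    finally show "s * (norm e)\<^sup>2 * r \<le> conorm A g ?x (covector_of A c ?x (r *\<^sub>R e))" .
  qed
qed

end

section \<open>The Hamiltonian and the Lagrangian in coordinates\<close>

locale hamiltonian_manifold = riemannian_manifold A g
  for A :: "('a::{t2_space, second_countable_topology}, 'b::euclidean_space) chart set"
    and g :: "'a \<Rightarrow> ('a, 'b) tvector \<Rightarrow> ('a, 'b) tvector \<Rightarrow> real" +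
  fixes G :: "'a \<times> ('a, 'b) covector \<Rightarrow> real"
  assumes compact_UNIV: "compact (UNIV :: 'a set)"
    and continuous_G: "continuous_map (cotangent_topology A) euclideanreal G"
    and convex_G: "convex_in_p A G" and superlinear_G: "superlinear_in_p A g G"
begin

definition Gc :: "('a, 'b) chart \<Rightarrow> 'b \<Rightarrow> 'b \<Rightarrow> real" where
  "Gc c y \<xi> = G (chart_inv c y, covector_of A c (chart_inv c y) \<xi>)"

lemma G_covector_of: "c \<in> charts_at A x \<Longrightarrow> G (x, covector_of A c x \<xi>) = Gc c (snd c x) \<xi>"
  by (simp add: Gc_def chart_inv_snd charts_atD)

lemma G_differential: "f \<in> C1_functions A \<Longrightarrow> c \<in> charts_at A x \<Longrightarrow>
    G (x, differential A f x) = Gc c (snd c x) (grad (f \<circ> chart_inv c) (snd c x))"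
  by (simp add: differential_eq_covector_of G_covector_of)

lemma continuous_on_Gc:
  assumes c: "c \<in> A"
  shows "continuous_on (chart_image c \<times> UNIV) (\<lambda>z. Gc c (fst z) (snd z))"
proof -
  have "open ((chart_image c \<times> UNIV) \<inter> (\<lambda>z. Gc c (fst z) (snd z)) -` V)" if V: "open V" for V
  proof -
    have "openin (cotangent_topology A) {z \<in> cotangent_bundle A. G z \<in> V}"
      using continuous_G V openin_continuous_map_preimage[of "cotangent_topology A" euclideanreal G V]
      by (simp add: topspace_cotangent_topology)
    then have "open {(y, \<xi>). y \<in> chart_image c \<and>
        (chart_inv c y, covector_of A c (chart_inv c y) \<xi>) \<in> {z \<in> cotangent_bundle A. G z \<in> V}}"
      using c unfolding openin_cotangent_topology by blast
    also have "{(y, \<xi>). y \<in> chart_image c \<and>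
        (chart_inv c y, covector_of A c (chart_inv c y) \<xi>) \<in> {z \<in> cotangent_bundle A. G z \<in> V}}
        = (chart_image c \<times> UNIV) \<inter> (\<lambda>z. Gc c (fst z) (snd z)) -` V"
      using covector_of_in by (auto simp: Gc_def cotangent_bundle_def)
    finally show ?thesis .
  qed
  then show ?thesis
    using open_chart_image[OF c] by (subst continuous_on_open_vimage) (auto intro: open_Times simp: Int_commute)
qed

lemma convex_on_Gc: "c \<in> A \<Longrightarrow> convex_on UNIV (Gc c y)"
proof (rule convex_onI)
  fix t :: real and \<xi> \<eta> :: 'b assume "0 < t" "t < 1"
  have "covector_of A c x ((1 - t) *\<^sub>R \<xi> + t *\<^sub>R \<eta>) =
      (\<lambda>v. (1 - t) * covector_of A c x \<xi> v + t * covector_of A c x \<eta> v)" for x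
    by (auto simp: covector_of_def inner_add_left)
  then show "Gc c y ((1 - t) *\<^sub>R \<xi> + t *\<^sub>R \<eta>) \<le> (1 - t) * Gc c y \<xi> + t * Gc c y \<eta>"
    using convex_G covector_of_in \<open>0 < t\<close> \<open>t < 1\<close> unfolding convex_in_p_def Gc_def by auto
qed simp

text \<open>Superlinearity is stated with the Riemannian conorm; the threshold
  \<open>\<bar>K\<bar> / \<kappa>\<close> for the quotient translates it into slope \<open>K\<close>
  along a Euclidean ray, at one radius \<open>r\<close>.\<close>

lemma Gc_superlinear:
  assumes c: "c \<in> A" and y: "y \<in> chart_image c" and "e \<noteq> 0"
  shows "\<exists>r\<ge>1. K * r \<le> Gc c y (r *\<^sub>R e)"
proof -
  let ?x = "chart_inv c y"
  obtain \<kappa> where \<kappa>: "\<kappa> > 0" and low: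
    "\<And>r. 0 \<le> r \<Longrightarrow> \<kappa> * r \<le> conorm A g ?x (covector_of A c ?x (r *\<^sub>R e))"
    using conorm_ge_on_ray[OF assms] by blast
  have "filterlim (\<lambda>p. G (?x, p) / conorm A g ?x p) at_top
      (inf (filtercomap (conorm A g ?x) at_top) (principal (cotangent_space A ?x)))"
    using superlinear_G unfolding superlinear_in_p_def by blast
  then have "\<forall>\<^sub>F p in filtercomap (conorm A g ?x) at_top. p \<in> cotangent_space A ?x \<longrightarrow>
      \<bar>K\<bar> / \<kappa> \<le> G (?x, p) / conorm A g ?x p"
    unfolding filterlim_at_top eventually_inf_principal by blast
  then obtain N where N: "\<And>p. N \<le> conorm A g ?x p \<Longrightarrow> p \<in> cotangent_space A ?x \<Longrightarrow>
      \<bar>K\<bar> / \<kappa> \<le> G (?x, p) / conorm A g ?x p"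
    unfolding eventually_filtercomap eventually_at_top_linorder by blast
  define r where "r = max 1 (N / \<kappa>)"
  have r: "r \<ge> 1" "N \<le> \<kappa> * r" using \<kappa> by (auto simp: r_def max_def field_simps)
  define m where "m = conorm A g ?x (covector_of A c ?x (r *\<^sub>R e))"
  have m: "\<kappa> * r \<le> m" using low[of r] r by (simp add: m_def)
  have "m > 0" using m \<kappa> r(1) by (meson less_le_trans mult_pos_pos zero_less_one)
  have "\<bar>K\<bar> / \<kappa> \<le> Gc c y (r *\<^sub>R e) / m"
    using N[of "covector_of A c ?x (r *\<^sub>R e)"] covector_of_in m r by (simp add: m_def Gc_def)
  then have "\<bar>K\<bar> / \<kappa> * m \<le> Gc c y (r *\<^sub>R e)" using \<open>m > 0\<close> by (simp add: pos_le_divide_eq)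
  moreover have "K * r \<le> \<bar>K\<bar> / \<kappa> * (\<kappa> * r)" using \<kappa> r by (simp add: mult_right_mono)
  moreover have "\<bar>K\<bar> / \<kappa> * (\<kappa> * r) \<le> \<bar>K\<bar> / \<kappa> * m" using m \<kappa> by (intro mult_left_mono) auto
  ultimately show ?thesis using r(1) by (intro exI[of _ r]) auto
qed

text \<open>Superlinearity is assumed separately in each fibre; here it becomes uniform over a
  compact piece of a chart. The linear term serves the finiteness of the Lagrangian, the case
  \<open>a = 0\<close> bounds covectors of subsolutions.\<close>

lemma Gc_sublevels_bounded:
  assumes c: "c \<in> A" and P: "compact P" "P \<subseteq> chart_image c"
  shows "\<exists>R. \<forall>y\<in>P. \<forall>\<xi>. Gc c y \<xi> - \<xi> \<bullet> a \<le> C \<longrightarrow> norm \<xi> \<le> R"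
proof (rule convex_coercive_uniformly[OF P(1)])
  show "continuous_on (P \<times> UNIV) (\<lambda>z. Gc c (fst z) (snd z) - snd z \<bullet> a)"
    using continuous_on_subset[OF continuous_on_Gc[OF c], of "P \<times> UNIV"] P(2) by (auto intro!: continuous_intros)
  show "convex_on UNIV (\<lambda>\<xi>. Gc c y \<xi> - \<xi> \<bullet> a)" for y
  proof (rule convex_onI)
    fix t :: real and \<xi> \<eta> :: 'b assume "0 < t" "t < 1"
    then show "Gc c y ((1 - t) *\<^sub>R \<xi> + t *\<^sub>R \<eta>) - ((1 - t) *\<^sub>R \<xi> + t *\<^sub>R \<eta>) \<bullet> a
        \<le> (1 - t) * (Gc c y \<xi> - \<xi> \<bullet> a) + t * (Gc c y \<eta> - \<eta> \<bullet> a)"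
      using convex_onD[OF convex_on_Gc[OF c, of y], of t \<xi> \<eta>] by (simp add: algebra_simps inner_add_left)
  qed simp
  fix y e K assume y: "y \<in> P" and e: "norm (e :: 'b) = 1"
  \<comment> \<open>The summand \<open>e \<bullet> a\<close> cancels the linear term along the ray,
    and \<open>\<bar>K\<bar> + 1\<close> leaves a value above \<open>K\<close> as
    \<open>r \<ge> 1\<close>.\<close>
  obtain r where r: "r \<ge> 1" "(\<bar>K\<bar> + 1 + e \<bullet> a) * r \<le> Gc c y (r *\<^sub>R e)"
    using Gc_superlinear[OF c, of y e "\<bar>K\<bar> + 1 + e \<bullet> a"] y P(2) e by fastforce
  have "K < (\<bar>K\<bar> + 1) * 1" by simp
  also have "\<dots> \<le> (\<bar>K\<bar> + 1) * r" using r(1) by (intro mult_left_mono) auto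
  also have "\<dots> \<le> Gc c y (r *\<^sub>R e) - (r *\<^sub>R e) \<bullet> a" using r(2) by (simp add: algebra_simps)
  finally show "\<exists>r\<ge>0. K < Gc c y (r *\<^sub>R e) - (r *\<^sub>R e) \<bullet> a" using r(1) by (intro exI[of _ r]) auto
qed

text \<open>Makes the suprema in \<open>critical_value\<close> finite and the sets where
  \<open>G\<close> is at least \<open>k\<close> along a differential closed.\<close>

lemma isCont_G_differential:
  assumes f: "f \<in> C1_functions A"
  shows "isCont (\<lambda>x. G (x, differential A f x)) x"
proof -
  obtain c where c: "c \<in> charts_at A x" using ex_chart by blast
  note cA = charts_atD[OF c]
  have gr: "continuous_on (chart_image c) (grad (f \<circ> chart_inv c))"
    using f cA Ck_on_1_D(2) unfolding C1_functions_def by blast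
  have "continuous_on (chart_image c) (\<lambda>y. Gc c y (grad (f \<circ> chart_inv c) y))"
    using continuous_on_compose2[OF continuous_on_Gc[OF cA(1)] continuous_on_Pair[OF continuous_on_id gr]] by auto
  then have "continuous_on (fst c) (\<lambda>x. Gc c (snd c x) (grad (f \<circ> chart_inv c) (snd c x)))"
    by (rule continuous_on_compose2[OF _ continuous_on_snd_chart[OF cA(1)]]) auto
  then have "continuous_on (fst c) (\<lambda>x. G (x, differential A f x))"
    using G_differential[OF f] cA(1) by (subst continuous_on_cong[OF refl]) (auto simp: charts_at_def)
  then show ?thesis using open_domain[OF cA(1)] cA(2) by (simp add: continuous_on_eq_continuous_at)
qed

text \<open>Outside a large ball the expression under the supremum is negative, inside it is bounded
  by compactness. So the real-valued \<open>SUP\<close> is the true Legendre-Fenchel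
  transform.\<close>

lemma
  assumes c: "c \<in> A" and y: "y \<in> chart_image c"
  shows Lagrangian_chart: "Lagrangian A G (chart_inv c y, tvector_of A c (chart_inv c y) a) = (SUP \<xi>. \<xi> \<bullet> a - Gc c y \<xi>)"
    and bdd_above_Lagrangian: "bdd_above (range (\<lambda>\<xi>. \<xi> \<bullet> a - Gc c y \<xi>))"
proof -
  note ch = charts_at_chart_inv[OF c y]
  let ?x = "chart_inv c y"
  have "cotangent_space A ?x = range (covector_of A c ?x)"
    using covector_of_surj[OF ch] covector_of_in by blast
  then show "Lagrangian A G (?x, tvector_of A c ?x a) = (SUP \<xi>. \<xi> \<bullet> a - Gc c y \<xi>)"
    by (simp add: Lagrangian_def image_image covector_of_tvector_of[OF ch] Gc_def)
  obtain R where R: "\<And>\<xi>. Gc c y \<xi> - \<xi> \<bullet> a \<le> 0 \<Longrightarrow> norm \<xi> \<le> R"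
    using Gc_sublevels_bounded[OF c, of "{y}" a 0] y by auto
  have "continuous_on (cball 0 R) (\<lambda>\<xi>. Gc c y \<xi>)"
  proof -
    have "continuous_on (cball 0 R) (\<lambda>\<xi> :: 'b. (y, \<xi>))" by (intro continuous_intros)
    from continuous_on_compose2[OF continuous_on_Gc[OF c] this] show ?thesis using y by auto
  qed
  then have "continuous_on (cball 0 R) (\<lambda>\<xi>. \<xi> \<bullet> a - Gc c y \<xi>)" by (intro continuous_intros)
  then have "bdd_above ((\<lambda>\<xi>. \<xi> \<bullet> a - Gc c y \<xi>) ` cball 0 R)"
    by (intro bounded_imp_bdd_above compact_imp_bounded compact_continuous_image compact_cball)
  then obtain B where B: "\<And>\<xi>. \<xi> \<in> cball 0 R \<Longrightarrow> \<xi> \<bullet> a - Gc c y \<xi> \<le> B"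
    unfolding bdd_above_def by blast
  have "\<xi> \<bullet> a - Gc c y \<xi> \<le> max B 0" for \<xi>
  proof (cases "Gc c y \<xi> - \<xi> \<bullet> a \<le> 0")
    case True
    then show ?thesis using B[of \<xi>] R[of \<xi>] by auto
  qed auto
  then show "bdd_above (range (\<lambda>\<xi>. \<xi> \<bullet> a - Gc c y \<xi>))" by (intro bdd_aboveI2)
qed

lemma borel_measurable_Lagrangian: "Lagrangian A G \<in> borel_measurable (tangent_borel A)"
proof (rule borel_measurable_tangentI)
  fix c t assume c: "c \<in> A"
  have "open ((chart_image c \<times> UNIV) \<inter> (\<lambda>z. \<xi> \<bullet> snd z - Gc c (fst z) \<xi>) -` {t<..})" for \<xi>
  proof (intro continuous_open_preimage open_Times open_chart_image[OF c])
    show "continuous_on (chart_image c \<times> UNIV) (\<lambda>z. \<xi> \<bullet> snd z - Gc c (fst z) \<xi>)"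
    proof -
      have "continuous_on (chart_image c \<times> (UNIV :: 'b set)) (\<lambda>z. (fst z, \<xi>))" by (intro continuous_intros)
      from continuous_on_compose2[OF continuous_on_Gc[OF c] this]
      have "continuous_on (chart_image c \<times> (UNIV :: 'b set)) (\<lambda>z. Gc c (fst z) \<xi>)" by fastforce
      then show ?thesis by (intro continuous_intros)
    qed
  qed auto
  then have "open (\<Union>\<xi>. (chart_image c \<times> UNIV) \<inter> (\<lambda>z. \<xi> \<bullet> snd z - Gc c (fst z) \<xi>) -` {t<..})" by blast
  also have "(\<Union>\<xi>. (chart_image c \<times> UNIV) \<inter> (\<lambda>z. \<xi> \<bullet> snd z - Gc c (fst z) \<xi>) -` {t<..}) =
      {(y, a). y \<in> chart_image c \<and> t < Lagrangian A G (chart_inv c y, tvector_of A c (chart_inv c y) a)}"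
    using Lagrangian_chart[OF c] less_cSUP_iff[OF _ bdd_above_Lagrangian[OF c]] by auto
  finally show "open {(y, a). y \<in> chart_image c \<and> t < Lagrangian A G (chart_inv c y, tvector_of A c (chart_inv c y) a)}" .
qed

end

section \<open>Viscosity solutions\<close>

context smooth_manifold
begin

text \<open>Viscosity tests require global \<open>C\<^sup>1\<close> functions, whereas a quadratic
  penalty makes sense only in a chart. The cutoff extends it without changing it near
  \<open>y\<close>.\<close>

lemma C1_add_square_in_chart:
  assumes c: "c \<in> A" and y: "y \<in> chart_image c" and f: "f \<in> C1_functions A"
  obtains \<Phi> r where "\<Phi> \<in> C1_functions A" "r > 0" "ball y r \<subseteq> chart_image c"
    "\<And>z. z \<in> ball y r \<Longrightarrow> \<Phi> (chart_inv c z) = f (chart_inv c z) + \<alpha> * (norm (z - b))\<^sup>2"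
    "grad (\<Phi> \<circ> chart_inv c) y = grad (f \<circ> chart_inv c) y + (2 * \<alpha>) *\<^sub>R (y - b)"
proof -
  obtain \<epsilon> where \<epsilon>: "\<epsilon> > 0" "cball y \<epsilon> \<subseteq> chart_image c"
    using open_chart_image[OF c] y open_contains_cball by blast
  define r where "r = \<epsilon> / 2"
  have r: "r > 0" "cball y (2 * r) \<subseteq> chart_image c" using \<epsilon> by (auto simp: r_def)
  obtain H :: "'b \<Rightarrow> real" where H: "Ck_on 1 UNIV H"
    "\<And>z. z \<in> ball y r \<Longrightarrow> H z = \<alpha> * (norm (z - b))\<^sup>2" "\<And>z. z \<notin> cball y (2 * r) \<Longrightarrow> H z = 0"
    using C1_cutoff_square[OF r(1), of y \<alpha> b] by blast
  define \<Phi> where "\<Phi> x = f x + (if x \<in> fst c then H (snd c x) else 0)" for x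
  have 1: "\<Phi> \<in> C1_functions A"
    unfolding \<Phi>_def[abs_def] using C1_functions_from_chart[OF c H(1) compact_cball r(2) H(3)]
    by (intro C1_functions_add f)
  have 2: "ball y r \<subseteq> chart_image c" using r by (auto simp: subset_iff)
  have 3: "\<Phi> (chart_inv c z) = f (chart_inv c z) + \<alpha> * (norm (z - b))\<^sup>2" if "z \<in> ball y r" for z
  proof -
    have "z \<in> chart_image c" using 2 that by blast
    then show ?thesis using H(2)[OF that] chart_inv_in[OF c] snd_chart_inv[OF c] by (simp add: \<Phi>_def)
  qed
  have "((\<lambda>z. (norm (z - b))\<^sup>2) has_derivative (\<lambda>a. (2 *\<^sub>R (y - b)) \<bullet> a)) (at y)"
    unfolding power2_norm_eq_inner
    by (auto intro!: derivative_eq_intros simp: inner_commute algebra_simps)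
  from has_derivative_add[OF has_derivative_grad[OF C1_chart_differentiable[OF f c y]]
      has_derivative_mult_right[OF this, of \<alpha>]]
  have "((\<lambda>z. (f \<circ> chart_inv c) z + \<alpha> * (norm (z - b))\<^sup>2) has_derivative
      (\<lambda>a. (grad (f \<circ> chart_inv c) y + (2 * \<alpha>) *\<^sub>R (y - b)) \<bullet> a)) (at y)"
    by (simp add: inner_add_left mult.assoc mult.left_commute)
  then have "((\<Phi> \<circ> chart_inv c) has_derivative
      (\<lambda>a. (grad (f \<circ> chart_inv c) y + (2 * \<alpha>) *\<^sub>R (y - b)) \<bullet> a)) (at y)"
    by (rule has_derivative_transform_within_open[of _ _ _ _ "ball y r"]) (use r(1) 3 in auto)
  then have "grad (\<Phi> \<circ> chart_inv c) y = grad (f \<circ> chart_inv c) y + (2 * \<alpha>) *\<^sub>R (y - b)"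
    by (rule grad_eqI)
  then show ?thesis using that 1 r(1) 2 3 by blast
qed

lemma eventually_nhds_chart:
  assumes c: "c \<in> A" and y: "y \<in> chart_image c" and "\<epsilon> > 0"
    and Q: "\<And>z. z \<in> ball y \<epsilon> \<Longrightarrow> z \<in> chart_image c \<Longrightarrow> Q (chart_inv c z)"
  shows "eventually Q (nhds (chart_inv c y))"
  unfolding eventually_nhds
proof (intro exI conjI ballI)
  show "open (fst c \<inter> snd c -` ball y \<epsilon>)"
    using continuous_open_preimage[OF continuous_on_snd_chart[OF c] open_domain[OF c] open_ball] .
  show "chart_inv c y \<in> fst c \<inter> snd c -` ball y \<epsilon>"
    using chart_inv_in[OF c y] snd_chart_inv[OF c y] \<open>\<epsilon> > 0\<close> by simp
  fix x assume "x \<in> fst c \<inter> snd c -` ball y \<epsilon>"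
  then show "Q x" using Q[of "snd c x"] chart_inv_snd[OF c, of x] by simp
qed

end

section \<open>Quadratic test functions, doubling of variables and the contact set\<close>

context hamiltonian_manifold
begin

lemma subsolution_square_test:
  assumes u: "viscosity_subsolution A G k u" and c: "c \<in> A" and y: "y \<in> chart_image c" and "\<epsilon> > 0"
    and max: "\<And>z. z \<in> ball y \<epsilon> \<Longrightarrow> z \<in> chart_image c \<Longrightarrow>
      u (chart_inv c z) - \<alpha> * (norm (z - b))\<^sup>2 \<le> u (chart_inv c y) - \<alpha> * (norm (y - b))\<^sup>2"
  shows "Gc c y ((2 * \<alpha>) *\<^sub>R (y - b)) \<le> k"
proof -
  obtain \<Phi> r where \<Phi>: "\<Phi> \<in> C1_functions A" "r > 0" "ball y r \<subseteq> chart_image c"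
    "\<And>z. z \<in> ball y r \<Longrightarrow> \<Phi> (chart_inv c z) = 0 + \<alpha> * (norm (z - b))\<^sup>2"
    "grad (\<Phi> \<circ> chart_inv c) y = grad ((\<lambda>_. 0) \<circ> chart_inv c) y + (2 * \<alpha>) *\<^sub>R (y - b)"
    using C1_add_square_in_chart[OF c y C1_functions_zero, of \<alpha> b] by metis
  have "\<forall>\<^sub>F x in nhds (chart_inv c y). u x - \<Phi> x \<le> u (chart_inv c y) - \<Phi> (chart_inv c y)"
    by (rule eventually_nhds_chart[OF c y, of "min \<epsilon> r"]) (use \<open>\<epsilon> > 0\<close> \<Phi>(2,4) max in auto)
  then have "G (chart_inv c y, differential A \<Phi> (chart_inv c y)) \<le> k"
    using u \<Phi>(1) unfolding viscosity_subsolution_def by blast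
  moreover have "grad ((\<lambda>_. 0) \<circ> chart_inv c) y = 0" by (rule grad_eqI) (simp add: o_def)
  ultimately show ?thesis
    using G_differential[OF \<Phi>(1) charts_at_chart_inv[OF c y]] \<Phi>(5) snd_chart_inv[OF c y] by simp
qed

lemma supersolution_square_test:
  assumes u: "viscosity_supersolution A G k u" and c: "c \<in> A" and y: "y \<in> chart_image c" and "\<epsilon> > 0"
    and f: "f \<in> C1_functions A"
    and min: "\<And>z. z \<in> ball y \<epsilon> \<Longrightarrow> z \<in> chart_image c \<Longrightarrow>
      u (chart_inv c y) - (f (chart_inv c y) + \<alpha> * (norm (y - b))\<^sup>2) \<le>
      u (chart_inv c z) - (f (chart_inv c z) + \<alpha> * (norm (z - b))\<^sup>2)"
  shows "k \<le> Gc c y (grad (f \<circ> chart_inv c) y + (2 * \<alpha>) *\<^sub>R (y - b))"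
proof -
  obtain \<Phi> r where \<Phi>: "\<Phi> \<in> C1_functions A" "r > 0" "ball y r \<subseteq> chart_image c"
    "\<And>z. z \<in> ball y r \<Longrightarrow> \<Phi> (chart_inv c z) = f (chart_inv c z) + \<alpha> * (norm (z - b))\<^sup>2"
    "grad (\<Phi> \<circ> chart_inv c) y = grad (f \<circ> chart_inv c) y + (2 * \<alpha>) *\<^sub>R (y - b)"
    using C1_add_square_in_chart[OF c y f, of \<alpha> b] by metis
  have "\<forall>\<^sub>F x in nhds (chart_inv c y). u (chart_inv c y) - \<Phi> (chart_inv c y) \<le> u x - \<Phi> x"
    by (rule eventually_nhds_chart[OF c y, of "min \<epsilon> r"]) (use \<open>\<epsilon> > 0\<close> \<Phi>(2,4) min in auto)
  then have "k \<le> G (chart_inv c y, differential A \<Phi> (chart_inv c y))"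
    using u \<Phi>(1) unfolding viscosity_supersolution_def by blast
  then show ?thesis
    using G_differential[OF \<Phi>(1) charts_at_chart_inv[OF c y]] \<Phi>(5) snd_chart_inv[OF c y] by simp
qed

text \<open>Doubling of variables in a chart: the penalised maxima of
  \<open>(1 - s) u\<^sub>1 x + s f z - u\<^sub>2 z - n \<bar>x - z\<bar>\<^sup>2\<close> produce a covector \<open>p\<close> with \<open>G p \<le> k\<close> and
  \<open>k \<le> G ((1 - s) p + s df)\<close> at the maximum point, and convexity gives the claim.\<close>

lemma doubling_of_variables:
  assumes u1: "viscosity_subsolution A G k u1" and u2: "viscosity_supersolution A G k u2"
    and \<phi>: "\<phi> \<in> C1_functions A" and s: "0 < s" "s < 1"
    and max: "\<And>x. (1 - s) * u1 x + s * \<phi> x - u2 x \<le> (1 - s) * u1 x0 + s * \<phi> x0 - u2 x0"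
  shows "k \<le> G (x0, differential A \<phi> x0)"
proof -
  obtain c where ch: "c \<in> charts_at A x0" using ex_chart by blast
  note c = charts_atD(1)[OF ch]
  define y0 where "y0 = snd c x0"
  have y0: "y0 \<in> chart_image c" using charts_atD(3)[OF ch] by (simp add: y0_def)
  have x0: "chart_inv c y0 = x0" using chart_inv_snd[OF c charts_atD(2)[OF ch]] by (simp add: y0_def)
  \<comment> \<open>Subtracting the squared distance makes the maximum at \<open>y0\<close> strict
    and changes neither the value nor the gradient of \<open>\<phi>\<close> there.\<close>
  obtain \<psi> r0 where \<psi>: "\<psi> \<in> C1_functions A" "r0 > 0" "ball y0 r0 \<subseteq> chart_image c"
    "\<And>z. z \<in> ball y0 r0 \<Longrightarrow> \<psi> (chart_inv c z) = \<phi> (chart_inv c z) + (-1) * (norm (z - y0))\<^sup>2"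
    "grad (\<psi> \<circ> chart_inv c) y0 = grad (\<phi> \<circ> chart_inv c) y0 + (2 * (-1)) *\<^sub>R (y0 - y0)"
    using C1_add_square_in_chart[OF c y0 \<phi>, of "-1" y0] by metis
  define r where "r = r0 / 2"
  define B where "B = cball y0 r"
  have r: "r > 0" using \<psi>(2) by (simp add: r_def)
  have Bsub: "B \<subseteq> chart_image c" "B \<subseteq> ball y0 r0" using \<psi>(2,3) by (auto simp: B_def r_def)
  have B: "compact B" "y0 \<in> B" using r by (auto simp: B_def)
  define v1 v2 f where "v1 = u1 \<circ> chart_inv c" and "v2 = u2 \<circ> chart_inv c" and "f = \<psi> \<circ> chart_inv c"
  have cont_comp: "continuous_on B (u \<circ> chart_inv c)" if "continuous_on UNIV u" for u :: "'a \<Rightarrow> real"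
    using continuous_on_subset[OF continuous_on_chart_inv[OF c] Bsub(1)] that
    by (intro continuous_on_compose) (auto intro: continuous_on_subset)
  have cont: "continuous_on B v1" "continuous_on B v2" "continuous_on B f"
    unfolding v1_def v2_def f_def
    using u1 u2 C1_functions_continuous[OF \<psi>(1)] cont_comp
    by (auto simp: viscosity_subsolution_def viscosity_supersolution_def)
  define W where "W z = (1 - s) * v1 z + s * f z - v2 z" for z
  have strict: "W z \<le> W y0 - s * (norm (z - y0))\<^sup>2" if "z \<in> B" for z
  proof -
    have "\<psi> x0 = \<phi> x0" using \<psi>(4)[of y0] \<psi>(2) by (simp add: x0)
    moreover have "\<psi> (chart_inv c z) = \<phi> (chart_inv c z) - (norm (z - y0))\<^sup>2"
      using \<psi>(4)[of z] that Bsub(2) by auto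
    ultimately show ?thesis
      using max[of "chart_inv c z"] by (simp add: W_def v1_def v2_def f_def x0 right_diff_distrib)
  qed
  define F where "F n q = (1 - s) * v1 (fst q) + s * f (snd q) - v2 (snd q) - real (Suc n) * (norm (fst q - snd q))\<^sup>2"
    for n and q :: "'b \<times> 'b"
  have cont_F0: "continuous_on (B \<times> B) (\<lambda>q. (1 - s) * v1 (fst q) + s * f (snd q) - v2 (snd q))"
    by (intro continuous_intros continuous_on_compose2[OF cont(1), of _ fst]
        continuous_on_compose2[OF cont(2), of _ snd] continuous_on_compose2[OF cont(3), of _ snd]) auto
  have "\<exists>q\<in>B \<times> B. \<forall>q'\<in>B \<times> B. F n q' \<le> F n q" for n
    by (rule continuous_attains_sup) (use B cont_F0 in \<open>auto simp: F_def intro!: compact_Times continuous_intros\<close>)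
  then obtain q where q: "\<And>n. q n \<in> B \<times> B" "\<And>n q'. q' \<in> B \<times> B \<Longrightarrow> F n q' \<le> F n (q n)" by metis
  have FW: "F n (y0, y0) = W y0" for n by (simp add: F_def W_def)
  obtain l r1 where l: "l \<in> B \<times> B" and r1: "strict_mono r1" and lim: "(\<lambda>n. q (r1 n)) \<longlonglongrightarrow> l"
    using seq_compactE[OF compact_imp_seq_compact[OF compact_Times[OF B(1) B(1)]], of q] q(1)
    unfolding o_def by metis
  have lim1: "(\<lambda>n. fst (q (r1 n))) \<longlonglongrightarrow> fst l" and lim2: "(\<lambda>n. snd (q (r1 n))) \<longlonglongrightarrow> snd l"
    using lim by (auto intro: tendsto_fst tendsto_snd)
  have low: "W y0 + real (Suc n) * (norm (fst (q n) - snd (q n)))\<^sup>2 \<le>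
      (1 - s) * v1 (fst (q n)) + s * f (snd (q n)) - v2 (snd (q n))" for n
    using q(2)[of "(y0, y0)" n] B(2) FW[of n] by (simp add: F_def)
  have "bdd_above ((\<lambda>q. (1 - s) * v1 (fst q) + s * f (snd q) - v2 (snd q)) ` (B \<times> B))"
    by (intro bounded_imp_bdd_above compact_imp_bounded compact_continuous_image cont_F0 compact_Times B(1))
  then obtain C where C: "\<And>q. q \<in> B \<times> B \<Longrightarrow> (1 - s) * v1 (fst q) + s * f (snd q) - v2 (snd q) \<le> C"
    unfolding bdd_above_def by blast
  \<comment> \<open>Comparison with \<open>(y0, y0)\<close> bounds the weighted penalty by
    \<open>C - W y0\<close>, so the distance of the two variables tends to 0.\<close>
  have "fst l = snd l"
  proof -
    have "(\<lambda>n. (norm (fst (q (r1 n)) - snd (q (r1 n))))\<^sup>2) \<longlonglongrightarrow> 0"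
    proof (rule tendsto_sandwich[OF _ _ tendsto_const])
      show "\<forall>\<^sub>F n in sequentially. (norm (fst (q (r1 n)) - snd (q (r1 n))))\<^sup>2 \<le> (C - W y0) * (1 / real (Suc (r1 n)))"
      proof (intro always_eventually allI)
        fix n
        have "real (Suc (r1 n)) * (norm (fst (q (r1 n)) - snd (q (r1 n))))\<^sup>2 \<le> C - W y0"
          using low[of "r1 n"] C[OF q(1)[of "r1 n"]] by linarith
        then show "(norm (fst (q (r1 n)) - snd (q (r1 n))))\<^sup>2 \<le> (C - W y0) * (1 / real (Suc (r1 n)))"
          by (simp add: pos_le_divide_eq mult.commute)
      qed
      have "(\<lambda>n. 1 / real (Suc (r1 n))) \<longlonglongrightarrow> 0"
        using LIMSEQ_subseq_LIMSEQ[OF LIMSEQ_inverse_real_of_nat r1] by (simp add: o_def inverse_eq_divide)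
      from tendsto_mult_left[OF this, of "C - W y0"]
      show "(\<lambda>n. (C - W y0) * (1 / real (Suc (r1 n)))) \<longlonglongrightarrow> 0" by simp
    qed auto
    moreover have "(\<lambda>n. (norm (fst (q (r1 n)) - snd (q (r1 n))))\<^sup>2) \<longlonglongrightarrow> (norm (fst l - snd l))\<^sup>2"
      by (intro tendsto_intros lim1 lim2)
    ultimately have "(norm (fst l - snd l))\<^sup>2 = 0" using LIMSEQ_unique by blast
    then show ?thesis by simp
  qed
  moreover have "snd l = y0"
  proof -
    have "(\<lambda>n. (1 - s) * v1 (fst (q (r1 n))) + s * f (snd (q (r1 n))) - v2 (snd (q (r1 n)))) \<longlonglongrightarrow>
        (1 - s) * v1 (fst l) + s * f (snd l) - v2 (snd l)"
      using continuous_on_tendsto_compose[OF cont_F0 lim l] q(1) by simp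
    moreover have "\<forall>n. W y0 \<le> (1 - s) * v1 (fst (q (r1 n))) + s * f (snd (q (r1 n))) - v2 (snd (q (r1 n)))"
    proof
      fix n
      have "0 \<le> real (Suc (r1 n)) * (norm (fst (q (r1 n)) - snd (q (r1 n))))\<^sup>2" by simp
      then show "W y0 \<le> (1 - s) * v1 (fst (q (r1 n))) + s * f (snd (q (r1 n))) - v2 (snd (q (r1 n)))"
        using low[of "r1 n"] by linarith
    qed
    ultimately have "W y0 \<le> (1 - s) * v1 (fst l) + s * f (snd l) - v2 (snd l)"
      using LIMSEQ_le_const by blast
    then have "W y0 \<le> W (snd l)" using \<open>fst l = snd l\<close> by (simp add: W_def)
    moreover have "W (snd l) \<le> W y0 - s * (norm (snd l - y0))\<^sup>2" using strict l by auto
    ultimately have "s * (norm (snd l - y0))\<^sup>2 \<le> 0" by linarith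
    then have "norm (snd l - y0) = 0" using s(1) by (simp add: mult_le_0_iff)
    then show ?thesis by simp
  qed
  ultimately have l_eq: "fst l = y0" "snd l = y0" by auto
  have "\<forall>\<^sub>F n in sequentially. fst (q (r1 n)) \<in> ball y0 r \<and> snd (q (r1 n)) \<in> ball y0 r"
    using lim1 lim2 r unfolding l_eq by (intro eventually_conj topological_tendstoD) auto
  then obtain N where N: "\<And>n. N \<le> n \<Longrightarrow> fst (q (r1 n)) \<in> ball y0 r \<and> snd (q (r1 n)) \<in> ball y0 r"
    unfolding eventually_sequentially by blast
  \<comment> \<open>Dropping the first \<open>N\<close> terms puts both variables into the open
    ball, where the maximum over \<open>B \<times> B\<close> is a local maximum on the
    manifold.\<close>
  define m where "m n = r1 (n + N)" for n
  define x z where "x n = fst (q (m n))" and "z n = snd (q (m n))" for n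
  have xz: "x n \<in> ball y0 r" "z n \<in> ball y0 r" for n using N[of "n + N"] by (auto simp: x_def z_def m_def)
  have xB: "x n \<in> B" "z n \<in> B" for n using xz[of n] by (auto simp: B_def)
  have x_lim: "x \<longlonglongrightarrow> y0" and z_lim: "z \<longlonglongrightarrow> y0"
    using LIMSEQ_ignore_initial_segment[OF lim1, of N] LIMSEQ_ignore_initial_segment[OF lim2, of N]
    unfolding l_eq x_def z_def m_def by auto
  define w where "w n = real (Suc (m n))" for n
  have opt: "(1 - s) * v1 a + s * f b - v2 b - w n * (norm (a - b))\<^sup>2
      \<le> (1 - s) * v1 (x n) + s * f (z n) - v2 (z n) - w n * (norm (x n - z n))\<^sup>2"
    if "a \<in> B" "b \<in> B" for a b n
    using q(2)[of "(a, b)" "m n"] that by (simp add: F_def x_def z_def w_def)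
  \<comment> \<open>The gradient of the penalty divided by \<open>1 - s\<close>, because the test
    concerns \<open>u1\<close> itself and not \<open>(1 - s) * u1\<close>.\<close>
  define p where "p n = (2 * (w n / (1 - s))) *\<^sub>R (x n - z n)" for n
  have inner_ball: "\<exists>\<epsilon>>0. ball y \<epsilon> \<subseteq> B" if "y \<in> ball y0 r" for y
    using open_contains_ball[of "ball y0 r"] that ball_subset_cball[of y0 r] unfolding B_def by (meson open_ball order_trans)
  have Gp: "Gc c (x n) (p n) \<le> k" for n
  proof -
    obtain \<epsilon> where \<epsilon>: "\<epsilon> > 0" "ball (x n) \<epsilon> \<subseteq> B" using inner_ball[OF xz(1)] by blast
    show ?thesis unfolding p_def
    proof (rule subsolution_square_test[OF u1 c _ \<epsilon>(1)])
      show "x n \<in> chart_image c" using xB Bsub(1) by blast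
      fix a assume "a \<in> ball (x n) \<epsilon>"
      then have "a \<in> B" using \<epsilon>(2) by blast
      from opt[OF this xB(2)[of n], of n] have "(1 - s) * v1 a - w n * (norm (a - z n))\<^sup>2 \<le> (1 - s) * v1 (x n) - w n * (norm (x n - z n))\<^sup>2"
        by simp
      then have "((1 - s) * v1 a - w n * (norm (a - z n))\<^sup>2) / (1 - s) \<le> ((1 - s) * v1 (x n) - w n * (norm (x n - z n))\<^sup>2) / (1 - s)"
        using s by (intro divide_right_mono) auto
      then show "u1 (chart_inv c a) - w n / (1 - s) * (norm (a - z n))\<^sup>2
          \<le> u1 (chart_inv c (x n)) - w n / (1 - s) * (norm (x n - z n))\<^sup>2"
        using s by (simp add: v1_def diff_divide_distrib)
    qed
  qed
  have Gz: "k \<le> Gc c (z n) (s *\<^sub>R grad f (z n) + (1 - s) *\<^sub>R p n)" for n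
  proof -
    obtain \<epsilon> where \<epsilon>: "\<epsilon> > 0" "ball (z n) \<epsilon> \<subseteq> B" using inner_ball[OF xz(2)] by blast
    have zc: "z n \<in> chart_image c" using xB Bsub(1) by blast
    have "k \<le> Gc c (z n) (grad ((\<lambda>x. s * \<psi> x) \<circ> chart_inv c) (z n) + (2 * (- w n)) *\<^sub>R (z n - x n))"
    proof (rule supersolution_square_test[OF u2 c zc \<epsilon>(1) C1_functions_scale[OF \<psi>(1)]])
      fix b assume "b \<in> ball (z n) \<epsilon>"
      then have "b \<in> B" using \<epsilon>(2) by blast
      from opt[OF xB(1)[of n] this, of n]
      show "u2 (chart_inv c (z n)) - (s * \<psi> (chart_inv c (z n)) + - w n * (norm (z n - x n))\<^sup>2)
          \<le> u2 (chart_inv c b) - (s * \<psi> (chart_inv c b) + - w n * (norm (b - x n))\<^sup>2)"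
        by (simp add: v2_def f_def norm_minus_commute)
    qed
    moreover have "grad ((\<lambda>x. s * \<psi> x) \<circ> chart_inv c) (z n) = s *\<^sub>R grad f (z n)"
      using grad_scale[OF C1_chart_differentiable[OF \<psi>(1) c zc], of s] by (simp add: f_def o_def)
    moreover have "(2 * (- w n)) *\<^sub>R (z n - x n) = (1 - s) *\<^sub>R p n"
    proof -
      have "(1 - s) *\<^sub>R p n = (2 * w n) *\<^sub>R (x n - z n)" using s by (simp add: p_def)
      then show ?thesis by (simp add: scaleR_diff_right)
    qed
    ultimately show ?thesis by (simp only:)
  qed
  \<comment> \<open>Coercivity keeps the covectors \<open>p n\<close> bounded although the weights
    \<open>w n\<close> tend to infinity. So they converge along a subsequence, and continuity of
    \<open>G\<close> suffices to compare it at the two nearby points.\<close>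
  obtain R where R: "\<And>y \<xi>. y \<in> B \<Longrightarrow> Gc c y \<xi> \<le> k \<Longrightarrow> norm \<xi> \<le> R"
    using Gc_sublevels_bounded[OF c B(1) Bsub(1), of 0 k] by auto
  then have "\<forall>n. p n \<in> cball 0 R" using Gp xB by auto
  then obtain p0 r2 where r2: "strict_mono r2" and p_lim: "(\<lambda>n. p (r2 n)) \<longlonglongrightarrow> p0"
    using seq_compactE[OF compact_imp_seq_compact[OF compact_cball[of 0 R]], of p]
    unfolding o_def by metis
  have x_lim2: "(\<lambda>n. x (r2 n)) \<longlonglongrightarrow> y0" and z_lim2: "(\<lambda>n. z (r2 n)) \<longlonglongrightarrow> y0"
    using LIMSEQ_subseq_LIMSEQ[OF x_lim r2] LIMSEQ_subseq_LIMSEQ[OF z_lim r2] by (auto simp: o_def)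
  have Gc_lim: "(\<lambda>n. Gc c (a n) (b n)) \<longlonglongrightarrow> Gc c y0 b0"
    if "a \<longlonglongrightarrow> y0" "b \<longlonglongrightarrow> b0" "\<And>n. a n \<in> B" for a b b0
  proof -
    have "\<forall>\<^sub>F n in sequentially. (a n, b n) \<in> chart_image c \<times> UNIV"
      using that(3) Bsub(1) by (intro always_eventually allI) blast
    from continuous_on_tendsto_compose[OF continuous_on_Gc[OF c] tendsto_Pair[OF that(1,2)] _ this]
    show ?thesis using y0 by simp
  qed
  have "Gc c y0 p0 \<le> k"
    using LIMSEQ_le_const2[OF Gc_lim[OF x_lim2 p_lim]] xB Gp by blast
  have "isCont (grad f) y0"
    using Ck_on_1_D(2)[of "chart_image c" f] \<psi>(1) c y0 open_chart_image[OF c]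
    unfolding C1_functions_def f_def by (auto simp: continuous_on_eq_continuous_at simp del: Ck_on.simps One_nat_def)
  then have "(\<lambda>n. s *\<^sub>R grad f (z (r2 n)) + (1 - s) *\<^sub>R p (r2 n)) \<longlonglongrightarrow> s *\<^sub>R grad f y0 + (1 - s) *\<^sub>R p0"
    using isCont_tendsto_compose[OF _ z_lim2, of "grad f"] by (intro tendsto_intros p_lim) auto
  from LIMSEQ_le_const[OF Gc_lim[OF z_lim2 this xB(2)]]
  have "k \<le> Gc c y0 (s *\<^sub>R grad f y0 + (1 - s) *\<^sub>R p0)" using Gz by simp
  also have "\<dots> = Gc c y0 ((1 - s) *\<^sub>R p0 + s *\<^sub>R grad f y0)" by (simp add: add.commute)
  also have "\<dots> \<le> (1 - s) * Gc c y0 p0 + s * Gc c y0 (grad f y0)"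
    using convex_onD[OF convex_on_Gc[OF c], of s] s by simp
  also have "\<dots> \<le> (1 - s) * k + s * Gc c y0 (grad f y0)"
    using \<open>Gc c y0 p0 \<le> k\<close> s by (intro add_mono mult_left_mono) auto
  finally have "s * k \<le> s * Gc c y0 (grad f y0)" by (simp add: algebra_simps)
  then have "k \<le> Gc c y0 (grad f y0)" using s(1) by simp
  also have "\<dots> = G (x0, differential A \<phi> x0)"
    using G_differential[OF \<phi> ch] \<psi>(5) by (simp add: f_def y0_def)
  finally show ?thesis .
qed

text \<open>For small \<open>s\<close> the function \<open>(1 - s) * u1 + s * \<phi> - u2\<close> is
  a small perturbation of \<open>h = u1 - u2\<close> and has a maximiser in the compact set
  \<open>Z\<close>. If \<open>Z\<close> contained no maximiser of \<open>h\<close>, then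
  \<open>h\<close> would be smaller on \<open>Z\<close> by a fixed gap, which a small perturbation
  cannot bridge.\<close>

lemma contact_set_meets_supercritical:
  assumes u1: "viscosity_subsolution A G k u1" and u2: "viscosity_supersolution A G k u2"
    and \<phi>: "\<phi> \<in> C1_functions A"
  shows "\<exists>y. (\<forall>x. u1 x - u2 x \<le> u1 y - u2 y) \<and> k \<le> G (y, differential A \<phi> y)"
proof (rule ccontr)
  assume neg: "\<not> ?thesis"
  have cu: "continuous_on UNIV u1" "continuous_on UNIV u2" "continuous_on UNIV \<phi>"
    using u1 u2 C1_functions_continuous[OF \<phi>] by (auto simp: viscosity_subsolution_def viscosity_supersolution_def)
  define h where "h x = u1 x - u2 x" for x
  define Z where "Z = {y. k \<le> G (y, differential A \<phi> y)}"
  have in_Z: "\<exists>y\<in>Z. \<forall>x. h x + s * (\<phi> x - u1 x) \<le> h y + s * (\<phi> y - u1 y)" if s: "0 < s" "s < 1" for s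
  proof -
    have "continuous_on UNIV (\<lambda>x. (1 - s) * u1 x + s * \<phi> x - u2 x)" by (intro continuous_intros cu)
    then obtain y where y: "\<And>x. (1 - s) * u1 x + s * \<phi> x - u2 x \<le> (1 - s) * u1 y + s * \<phi> y - u2 y"
      using continuous_attains_sup[OF compact_UNIV] by blast
    then have "y \<in> Z" using doubling_of_variables[OF u1 u2 \<phi> s] by (simp add: Z_def)
    moreover have "h x + s * (\<phi> x - u1 x) \<le> h y + s * (\<phi> y - u1 y)" for x
      using y[of x] by (simp add: h_def algebra_simps)
    ultimately show ?thesis by blast
  qed
  have "continuous_on UNIV (\<lambda>x. G (x, differential A \<phi> x))"
    using isCont_G_differential[OF \<phi>] by (simp add: continuous_at_imp_continuous_on)
  then have "closed Z" unfolding Z_def by (intro closed_Collect_le continuous_intros)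
  then have "compact Z" using compact_UNIV closed_Int_compact[of Z UNIV] by simp
  moreover have "Z \<noteq> {}" using in_Z[of "1/2"] by auto
  moreover have "continuous_on Z h"
    unfolding h_def[abs_def] using cu by (intro continuous_intros) (auto intro: continuous_on_subset)
  ultimately obtain y1 where y1: "y1 \<in> Z" "\<And>y. y \<in> Z \<Longrightarrow> h y \<le> h y1"
    using continuous_attains_sup by metis
  then obtain x1 where x1: "h y1 < h x1" using neg unfolding Z_def h_def by (metis (no_types, lifting) mem_Collect_eq not_le)
  have "continuous_on UNIV (\<lambda>x. \<phi> x - u1 x)" by (intro continuous_intros cu)
  then have "bounded (range (\<lambda>x. \<phi> x - u1 x))"
    by (intro compact_imp_bounded compact_continuous_image compact_UNIV)
  then obtain b where b: "b > 0" "\<And>x. \<bar>\<phi> x - u1 x\<bar> \<le> b"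
    unfolding bounded_pos by auto
  \<comment> \<open>The perturbation \<open>s * (\<phi> - u1)\<close> differs at two points by at
    most \<open>2 * s * b\<close>; the factor 4 makes this strictly less than the gap.\<close>
  define s where "s = min (1/2) ((h x1 - h y1) / (4 * b))"
  have s: "0 < s" "s < 1" "s * (4 * b) \<le> h x1 - h y1"
    using x1 b(1) by (auto simp: s_def min_def field_simps)
  obtain y where y: "y \<in> Z" "h x1 + s * (\<phi> x1 - u1 x1) \<le> h y + s * (\<phi> y - u1 y)"
    using in_Z[OF s(1,2)] by blast
  have "s * (\<phi> y - u1 y) \<le> s * b" "s * (- b) \<le> s * (\<phi> x1 - u1 x1)"
    using b(2)[of y] b(2)[of x1] s(1) by (intro mult_left_mono; linarith)+
  then have "h x1 - h y1 \<le> s * (2 * b)" using y y1(2)[OF y(1)] by (simp add: algebra_simps)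
  moreover have "s * (2 * b) < s * (4 * b)" using s(1) b(1) by simp
  ultimately show False using s(3) by linarith
qed

end

section \<open>Existence of Mather measures over a prescribed set\<close>

context hamiltonian_manifold
begin

lemma finite_compact_chart_cover:
  obtains N :: nat and cs :: "nat \<Rightarrow> ('a, 'b) chart" and Bs :: "nat \<Rightarrow> 'b set"
  where "\<And>i. i < N \<Longrightarrow> cs i \<in> A" "\<And>i. i < N \<Longrightarrow> compact (Bs i)"
    "\<And>i. i < N \<Longrightarrow> Bs i \<subseteq> chart_image (cs i)"
    "\<And>x. \<exists>i<N. \<exists>y\<in>Bs i. chart_inv (cs i) y = x"
proof -
  have "\<exists>c r. c \<in> charts_at A x \<and> 0 < r \<and> cball (snd c x) r \<subseteq> chart_image c" for x
    using ex_chart charts_atD(1,3) open_chart_image open_contains_cball by metis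
  then obtain c r where c: "\<And>x. c x \<in> charts_at A x" and r: "\<And>x. 0 < r x"
    "\<And>x. cball (snd (c x) x) (r x) \<subseteq> chart_image (c x)" by metis
  define U where "U x = fst (c x) \<inter> snd (c x) -` ball (snd (c x) x) (r x)" for x
  have "open (U x)" for x unfolding U_def
    using continuous_open_preimage[OF continuous_on_snd_chart open_domain open_ball] charts_atD(1)[OF c] by blast
  moreover have "x \<in> U x" for x using charts_atD(2)[OF c] r(1) by (simp add: U_def)
  ultimately obtain I where I: "finite I" "UNIV \<subseteq> (\<Union>x\<in>I. U x)"
    by - (rule compactE_image[OF compact_UNIV, of UNIV U], auto)
  obtain xs where xs: "set xs = I" using finite_list[OF I(1)] by blast
  show ?thesis
  proof (rule that[of "length xs" "\<lambda>i. c (xs ! i)" "\<lambda>i. cball (snd (c (xs ! i)) (xs ! i)) (r (xs ! i))"])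
    fix x
    have "\<exists>t\<in>set xs. x \<in> U t" using I(2) xs by blast
    then obtain i where i: "i < length xs" "x \<in> U (xs ! i)" by (metis in_set_conv_nth)
    then have "chart_inv (c (xs ! i)) (snd (c (xs ! i)) x) = x"
      using chart_inv_snd[OF charts_atD(1)[OF c]] by (simp add: U_def)
    then show "\<exists>i<length xs. \<exists>y\<in>cball (snd (c (xs ! i)) (xs ! i)) (r (xs ! i)). chart_inv (c (xs ! i)) y = x"
      using i by (force simp: U_def)
  qed (use charts_atD(1)[OF c] r(2) in auto)
qed

text \<open>Triples of base point, velocity and covector, the graph of the subdifferential of
  \<open>Gc\<close>. The covector is kept as a coordinate so that the Lagrangian becomes a
  continuous function of the triple.\<close>

definition subgradients :: "('a, 'b) chart \<Rightarrow> 'b set \<Rightarrow> real \<Rightarrow> ('b \<times> 'b \<times> 'b) set" where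
  "subgradients c P R = {(y, a, \<xi>). y \<in> P \<and> norm \<xi> \<le> R \<and> (\<forall>\<eta>. Gc c y \<xi> + a \<bullet> (\<eta> - \<xi>) \<le> Gc c y \<eta>)}"

lemma continuous_on_Gc_compose:
  assumes c: "c \<in> A" and "continuous_on S f" "continuous_on S h" "\<And>x. x \<in> S \<Longrightarrow> f x \<in> chart_image c"
  shows "continuous_on S (\<lambda>x. Gc c (f x) (h x))"
  using continuous_on_compose2[OF continuous_on_Gc[OF c] continuous_on_Pair[OF assms(2,3)]] assms(4) by auto

text \<open>A unit step from \<open>\<xi>\<close> in the direction of \<open>a\<close> raises
  \<open>Gc\<close> by at least \<open>norm a\<close>, and the step stays in the ball of radius
  \<open>R + 1\<close>, where \<open>Gc\<close> is bounded. Closedness holds because each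
  inequality, for fixed \<open>\<eta>\<close>, is closed.\<close>

lemma compact_subgradients:
  assumes c: "c \<in> A" and P: "compact P" "P \<subseteq> chart_image c"
  shows "compact (subgradients c P R)"
proof -
  have "continuous_on (P \<times> cball 0 (R + 1)) (\<lambda>z. Gc c (fst z) (snd z))"
    using continuous_on_subset[OF continuous_on_Gc[OF c]] P(2) by (metis Sigma_mono subset_UNIV)
  then have "bounded ((\<lambda>z. Gc c (fst z) (snd z)) ` (P \<times> cball 0 (R + 1)))"
    by (intro compact_imp_bounded compact_continuous_image compact_Times P(1) compact_cball)
  then obtain b where b: "\<And>y \<xi>. y \<in> P \<Longrightarrow> norm \<xi> \<le> R + 1 \<Longrightarrow> \<bar>Gc c y \<xi>\<bar> \<le> b"
    unfolding bounded_iff by force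
  have na: "norm a \<le> 2 * b" if mem: "(y, a, \<xi>) \<in> subgradients c P R" for y a \<xi>
  proof (cases "a = 0")
    case True
    have "\<bar>Gc c y \<xi>\<bar> \<le> b" using mem by (intro b) (auto simp: subgradients_def)
    then show ?thesis using True by simp
  next
    case False
    define e where "e = (1 / norm a) *\<^sub>R a"
    have e: "norm e = 1" "a \<bullet> e = norm a"
      using False by (auto simp: e_def power2_norm_eq_inner[symmetric] power2_eq_square)
    have "Gc c y \<xi> + a \<bullet> ((\<xi> + e) - \<xi>) \<le> Gc c y (\<xi> + e)" using mem unfolding subgradients_def by blast
    then have "norm a \<le> Gc c y (\<xi> + e) - Gc c y \<xi>" using e by simp
    moreover have "\<bar>Gc c y (\<xi> + e)\<bar> \<le> b"
      using mem norm_triangle_ineq[of \<xi> e] e(1) by (intro b) (auto simp: subgradients_def)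
    moreover have "\<bar>Gc c y \<xi>\<bar> \<le> b" using mem by (intro b) (auto simp: subgradients_def)
    ultimately show ?thesis by linarith
  qed
  define D where "D = P \<times> cball (0 :: 'b) (2 * b) \<times> cball (0 :: 'b) R"
  have D: "compact D" unfolding D_def by (intro compact_Times P(1) compact_cball)
  define C where "C \<eta> = D \<inter> (\<lambda>z. Gc c (fst z) (snd (snd z)) + fst (snd z) \<bullet> (\<eta> - snd (snd z)) - Gc c (fst z) \<eta>) -` {..0}" for \<eta>
  have "closed (C \<eta>)" for \<eta> unfolding C_def
    by (intro continuous_closed_preimage compact_imp_closed[OF D] closed_atMost continuous_intros
        continuous_on_Gc_compose[OF c]) (use P(2) in \<open>auto simp: D_def\<close>)
  then have "closed (\<Inter>\<eta>. C \<eta>)" by blast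
  moreover have "(\<Inter>\<eta>. C \<eta>) \<subseteq> D" by (auto simp: C_def)
  moreover have "subgradients c P R = (\<Inter>\<eta>. C \<eta>)"
    using na by (auto simp: C_def D_def subgradients_def algebra_simps)
  ultimately show ?thesis using closed_Int_compact[OF _ D] by (metis inf.absorb1)
qed

text \<open>The equality case of the Fenchel-Young inequality: the supremum is attained at
  \<open>\<xi>\<close>.\<close>

lemma Lagrangian_subgradient:
  assumes c: "c \<in> A" and y: "y \<in> chart_image c" and sub: "\<And>\<eta>. Gc c y \<xi> + a \<bullet> (\<eta> - \<xi>) \<le> Gc c y \<eta>"
  shows "Lagrangian A G (chart_inv c y, tvector_of A c (chart_inv c y) a) = \<xi> \<bullet> a - Gc c y \<xi>"
proof -
  have "(SUP \<eta>. \<eta> \<bullet> a - Gc c y \<eta>) = \<xi> \<bullet> a - Gc c y \<xi>"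
  proof (rule antisym)
    show "(SUP \<eta>. \<eta> \<bullet> a - Gc c y \<eta>) \<le> \<xi> \<bullet> a - Gc c y \<xi>"
    proof (rule cSUP_least)
      fix \<eta> show "\<eta> \<bullet> a - Gc c y \<eta> \<le> \<xi> \<bullet> a - Gc c y \<xi>"
        using sub[of \<eta>] by (simp add: inner_diff_right inner_commute)
    qed simp
    show "\<xi> \<bullet> a - Gc c y \<xi> \<le> (SUP \<eta>. \<eta> \<bullet> a - Gc c y \<eta>)"
      by (rule cSUP_upper[OF _ bdd_above_Lagrangian[OF c y]]) simp
  qed
  then show ?thesis by (simp add: Lagrangian_chart[OF c y])
qed

lemma Lagrangian_ge_differential:
  assumes f: "f \<in> C1_functions A" and v: "v \<in> tangent_space A x"
  shows "differential A f x v - G (x, differential A f x) \<le> Lagrangian A G (x, v)"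
proof -
  obtain c where ch: "c \<in> charts_at A x" using ex_chart by blast
  note cA = charts_atD[OF ch]
  have x: "chart_inv c (snd c x) = x" using chart_inv_snd cA by blast
  let ?\<xi> = "grad (f \<circ> chart_inv c) (snd c x)"
  have "?\<xi> \<bullet> v c - Gc c (snd c x) ?\<xi> \<le> (SUP \<eta>. \<eta> \<bullet> v c - Gc c (snd c x) \<eta>)"
    by (rule cSUP_upper[OF _ bdd_above_Lagrangian[OF cA(1,3)]]) simp
  also have "\<dots> = Lagrangian A G (x, v)"
    using Lagrangian_chart[OF cA(1,3), of "v c"] tvector_of_eq[OF ch v] by (simp add: x)
  finally show ?thesis
    using G_differential[OF f ch] v by (simp add: differential_eq_covector_of[OF f ch] covector_of_def)
qed

lemma G_differential_le_Sup:
  assumes f: "f \<in> C1_functions A"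
  shows "G (x, differential A f x) \<le> (SUP x. G (x, differential A f x))"
proof (rule cSUP_upper)
  have "continuous_on UNIV (\<lambda>x. G (x, differential A f x))"
    using isCont_G_differential[OF f] by (simp add: continuous_at_imp_continuous_on)
  then show "bdd_above (range (\<lambda>x. G (x, differential A f x)))"
    by (intro bounded_imp_bdd_above compact_imp_bounded compact_continuous_image compact_UNIV)
qed simp

text \<open>A subgradient at a covector of bounded size witnesses \<open>k \<le> G (y, p)\<close>: if \<open>p\<close> is large, use a
  subgradient at the point where the segment from \<open>q\<close> to \<open>p\<close> leaves the ball.\<close>

lemma bounded_subgradient_witness:
  assumes c: "c \<in> A" and R: "\<And>\<xi>. Gc c y \<xi> \<le> k + 1 \<Longrightarrow> norm \<xi> \<le> R"
    and p: "k \<le> Gc c y p" and q: "Gc c y q \<le> k + 1"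
  obtains a \<xi> where "norm \<xi> \<le> R + 1" "\<And>\<eta>. Gc c y \<xi> + a \<bullet> (\<eta> - \<xi>) \<le> Gc c y \<eta>"
    "\<xi> \<bullet> a - Gc c y \<xi> + k \<le> p \<bullet> a"
proof (cases "norm p \<le> R + 1")
  case True
  obtain a where a: "\<And>\<eta>. Gc c y p + a \<bullet> (\<eta> - p) \<le> Gc c y \<eta>"
    using convex_subgradient_exists[OF convex_on_Gc[OF c]] by blast
  show ?thesis by (rule that[OF True a]) (use p in simp)
next
  case False
  have "continuous_on {0..1} (\<lambda>t. norm (q + t *\<^sub>R (p - q)))" by (intro continuous_intros)
  moreover have "norm (q + 0 *\<^sub>R (p - q)) \<le> R + 1" "R + 1 \<le> norm (q + 1 *\<^sub>R (p - q))"
    using R[OF q] False by auto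
  ultimately obtain t where t: "0 \<le> t" "t \<le> 1" "norm (q + t *\<^sub>R (p - q)) = R + 1"
    using IVT'[of "\<lambda>t. norm (q + t *\<^sub>R (p - q))" 0 "R + 1" 1] by auto
  define \<xi> where "\<xi> = q + t *\<^sub>R (p - q)"
  \<comment> \<open>Radius \<open>R + 1\<close> lies beyond every covector of the sublevel
    \<open>k + 1\<close>, which contains \<open>q\<close>. So \<open>Gc\<close> is larger at
    \<open>\<xi>\<close> than at \<open>q\<close>, which forces the slope along the segment to be
    positive.\<close>
  have big: "k + 1 < Gc c y \<xi>" using R[of \<xi>] t(3) by (force simp: \<xi>_def)
  obtain a where a: "\<And>\<eta>. Gc c y \<xi> + a \<bullet> (\<eta> - \<xi>) \<le> Gc c y \<eta>"
    using convex_subgradient_exists[OF convex_on_Gc[OF c]] by blast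
  have "Gc c y \<xi> + a \<bullet> (q - \<xi>) \<le> k + 1" using a[of q] q by linarith
  then have "0 < t * (a \<bullet> (p - q))" using big by (simp add: \<xi>_def)
  then have "0 < a \<bullet> (p - q)" using t(1) by (simp add: zero_less_mult_iff)
  then have "0 \<le> (1 - t) * (a \<bullet> (p - q))" using t(2) by simp
  also have "\<dots> = a \<bullet> (p - \<xi>)" by (simp add: \<xi>_def algebra_simps inner_diff_right inner_add_right)
  finally have "\<xi> \<bullet> a \<le> p \<bullet> a" by (simp add: inner_diff_right inner_commute)
  then show ?thesis using that[of \<xi> a] a t(3) big by (simp add: \<xi>_def[symmetric])
qed

text \<open>The moment problem is solved on a compact set of subgradient triples over
  \<open>K\<close>, with the differentials as linear space and \<open>L + k\<close> as
  \<open>l\<close>. Vanishing moments mean that the image measure is closed, and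
  \<open>\<integral> l \<le> 0\<close> is the upper bound of the action.\<close>

theorem Mather_measure_over:
  assumes K: "closed K"
    and above: "\<And>\<phi>. \<phi> \<in> C1_functions A \<Longrightarrow> \<exists>y\<in>K. critical_value A G \<le> G (y, differential A \<phi> y)"
  obtains \<nu> where "Mather_measure A g G \<nu>" "AE z in \<nu>. fst z \<in> K"
proof -
  define k where "k = critical_value A G"
  have C1ne: "C1_functions A \<noteq> {}" using C1_functions_zero by blast
  \<comment> \<open>Its differential serves as the base covector \<open>q\<close> of the segments in
    \<open>bounded_subgradient_witness\<close>. The slack 1 is there because the infimum
    \<open>k\<close> need not be attained by a \<open>C\<^sup>1\<close> function.\<close>
  obtain f0 where f0: "f0 \<in> C1_functions A" "\<And>x. G (x, differential A f0 x) \<le> k + 1"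
  proof -
    have "critical_value A G < k + 1" by (simp add: k_def)
    then obtain f where f: "f \<in> C1_functions A" "(SUP x. G (x, differential A f x)) < k + 1"
      unfolding critical_value_def using cInf_lessD[of "(\<lambda>f. SUP x. G (x, differential A f x)) ` C1_functions A"] C1ne
      by blast
    have "G (x, differential A f x) \<le> k + 1" for x
      using G_differential_le_Sup[OF f(1), of x] f(2) by linarith
    then show thesis using that f(1) by blast
  qed
  obtain N :: nat and cs :: "nat \<Rightarrow> ('a, 'b) chart" and Bs :: "nat \<Rightarrow> 'b set"
    where cs: "\<And>i. i < N \<Longrightarrow> cs i \<in> A" and Bs: "\<And>i. i < N \<Longrightarrow> compact (Bs i)"
    "\<And>i. i < N \<Longrightarrow> Bs i \<subseteq> chart_image (cs i)"
    and cover: "\<And>x. \<exists>i<N. \<exists>y\<in>Bs i. chart_inv (cs i) y = x"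
    by (rule finite_compact_chart_cover) (rule that)
  have "\<exists>R. \<forall>y\<in>Bs i. \<forall>\<xi>. Gc (cs i) y \<xi> \<le> k + 1 \<longrightarrow> norm \<xi> \<le> R" if "i < N" for i
    using Gc_sublevels_bounded[OF cs[OF that] Bs(1,2)[OF that], of 0 "k + 1"] by simp
  then obtain R where R: "\<And>i y \<xi>. i < N \<Longrightarrow> y \<in> Bs i \<Longrightarrow> Gc (cs i) y \<xi> \<le> k + 1 \<Longrightarrow> norm \<xi> \<le> R i"
    by metis
  define Ps where "Ps i = Bs i \<inter> chart_inv (cs i) -` K" for i
  have Ps: "compact (Ps i)" "Ps i \<subseteq> chart_image (cs i)" if "i < N" for i
  proof -
    have "closed (Ps i)" unfolding Ps_def
      using continuous_on_subset[OF continuous_on_chart_inv[OF cs] Bs(2)] that Bs(1) K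
      by (intro continuous_closed_preimage) (auto intro: compact_imp_closed)
    then show "compact (Ps i)" using closed_Int_compact[OF _ Bs(1)[OF that], of "Ps i"]
      by (simp add: Ps_def inf_commute inf_left_commute)
    show "Ps i \<subseteq> chart_image (cs i)" using Bs(2)[OF that] by (auto simp: Ps_def)
  qed
  define Z where "Z i = subgradients (cs i) (Ps i) (R i + 1)" for i
  have Z: "compact (Z i)" if "i < N" for i
    unfolding Z_def using compact_subgradients[OF cs[OF that] Ps[OF that]] .
  \<comment> \<open>The real coordinate is the index of the chart.\<close>
  define X where "X = (\<Union>i<N. {real i} \<times> Z i)"
  have X: "compact X" unfolding X_def by (intro compact_UN compact_Times Z) auto
  define idx where "idx z = nat \<lfloor>fst z\<rfloor>" for z :: "real \<times> 'b \<times> 'b \<times> 'b"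
  have X_iff: "z \<in> X \<longleftrightarrow> idx z < N \<and> fst z = real (idx z) \<and> snd z \<in> Z (idx z)" for z
    by (auto simp: X_def idx_def mem_Times_iff)
  have ZD: "fst w \<in> Ps i" "fst w \<in> chart_image (cs i)" "chart_inv (cs i) (fst w) \<in> K"
    "\<And>\<eta>. Gc (cs i) (fst w) (snd (snd w)) + fst (snd w) \<bullet> (\<eta> - snd (snd w)) \<le> Gc (cs i) (fst w) \<eta>"
    if "i < N" "w \<in> Z i" for i w
    using that Ps(2)[OF that(1)] by (auto simp: Z_def subgradients_def Ps_def)
  have cont_X: "continuous_on X (\<lambda>z. h (idx z) (snd z))"
    if h: "\<And>i. i < N \<Longrightarrow> continuous_on (Z i) (h i)" for h :: "nat \<Rightarrow> 'b \<times> 'b \<times> 'b \<Rightarrow> real"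
    unfolding X_def
  proof (rule continuous_on_closed_Union)
    fix i assume i: "i \<in> {..<N}"
    then show "closed ({real i} \<times> Z i)" by (intro closed_Times closed_singleton compact_imp_closed[OF Z]) simp
    have "continuous_on ({real i} \<times> Z i) (\<lambda>z. h i (snd z))"
      using i by (intro continuous_on_compose2[OF h, of i _ snd] continuous_on_snd continuous_on_id) auto
    then show "continuous_on ({real i} \<times> Z i) (\<lambda>z. h (idx z) (snd z))"
      by (subst continuous_on_cong[of _ "{real i} \<times> Z i" _ "\<lambda>z. h i (snd z)"]) (auto simp: idx_def)
  qed simp
  \<comment> \<open>Decodes a coded triple into a tangent vector of the manifold and forgets the
    covector.\<close>
  define \<Psi> where "\<Psi> z = (chart_inv (cs (idx z)) (fst (snd z)),
    tvector_of A (cs (idx z)) (chart_inv (cs (idx z)) (fst (snd z))) (fst (snd (snd z))))" for z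
  have \<Psi>_in: "\<Psi> z \<in> tangent_bundle A" "fst (\<Psi> z) \<in> K" if "z \<in> X" for z
    using that ZD[of "idx z" "snd z"] tangent_bundleI[OF cs] unfolding X_iff \<Psi>_def by auto
  have cont_\<Psi>: "continuous_on X (\<lambda>z. h (\<Psi> z))"
    if h: "\<And>c. c \<in> A \<Longrightarrow> continuous_on (chart_image c \<times> UNIV)
      (\<lambda>z. h (chart_inv c (fst z), tvector_of A c (chart_inv c (fst z)) (snd z)))" for h :: "_ \<Rightarrow> real"
    unfolding \<Psi>_def
  proof (rule cont_X)
    fix i assume i: "i < N"
    have "continuous_on (Z i) (\<lambda>w. (fst w, fst (snd w)))" by (intro continuous_intros)
    from continuous_on_compose2[OF h[OF cs[OF i]] this]
    show "continuous_on (Z i) (\<lambda>w. h (chart_inv (cs i) (fst w), tvector_of A (cs i) (chart_inv (cs i) (fst w)) (fst (snd w))))"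
      using ZD(2)[OF i] by fastforce
  qed
  define l where "l z = snd (snd (snd z)) \<bullet> fst (snd (snd z)) - Gc (cs (idx z)) (fst (snd z)) (snd (snd (snd z))) + k" for z
  have l_cont: "continuous_on X l" unfolding l_def[abs_def]
    by (rule cont_X) (use ZD(2) cs in \<open>auto intro!: continuous_intros continuous_on_Gc_compose\<close>)
  have l_eq: "Lagrangian A G (\<Psi> z) = l z - k" if "z \<in> X" for z
    using that Lagrangian_subgradient[OF cs ZD(2,4)] unfolding X_iff \<Psi>_def l_def by simp
  define D where "D \<phi> z = differential A \<phi> (fst (\<Psi> z)) (snd (\<Psi> z))" for \<phi> z
  have D_cont: "continuous_on X (D \<phi>)" if "\<phi> \<in> C1_functions A" for \<phi>
    unfolding D_def[abs_def] using cont_\<Psi>[of "\<lambda>z. differential A \<phi> (fst z) (snd z)"] continuous_on_differential[OF that]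
    by simp
  \<comment> \<open>The hypothesis \<open>above\<close> of the moment problem: a supercritical point
    over \<open>K\<close> is turned into a coded triple by a subgradient of bounded size.\<close>
  have D_above: "\<exists>z\<in>X. l z \<le> D \<phi> z" if \<phi>: "\<phi> \<in> C1_functions A" for \<phi>
  proof -
    obtain x where x: "x \<in> K" "k \<le> G (x, differential A \<phi> x)" using above[OF \<phi>] by (auto simp: k_def)
    obtain i y where i: "i < N" and y: "y \<in> Bs i" "chart_inv (cs i) y = x" using cover by metis
    have yc: "y \<in> chart_image (cs i)" using y Bs(2)[OF i] by blast
    have ch: "cs i \<in> charts_at A x" using charts_at_chart_inv[OF cs[OF i] yc] y(2) by simp
    have sy: "snd (cs i) x = y" using snd_chart_inv[OF cs[OF i] yc] y(2) by simp
    let ?p = "grad (\<phi> \<circ> chart_inv (cs i)) y"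
    have "k \<le> Gc (cs i) y ?p" using x(2) G_differential[OF \<phi> ch] sy by simp
    moreover have "Gc (cs i) y (grad (f0 \<circ> chart_inv (cs i)) y) \<le> k + 1"
      using f0(2)[of x] G_differential[OF f0(1) ch] sy by simp
    ultimately obtain a \<xi> where a: "norm \<xi> \<le> R i + 1" "\<And>\<eta>. Gc (cs i) y \<xi> + a \<bullet> (\<eta> - \<xi>) \<le> Gc (cs i) y \<eta>"
      "\<xi> \<bullet> a - Gc (cs i) y \<xi> + k \<le> ?p \<bullet> a"
      using bounded_subgradient_witness[OF cs[OF i], of y k "R i"] R[OF i y(1)] by metis
    define z where "z = (real i, y, a, \<xi>)"
    have z: "z \<in> X" "idx z = i" using i a y x(1)
      by (auto simp: X_iff idx_def z_def Z_def subgradients_def Ps_def)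
    moreover have "D \<phi> z = ?p \<bullet> a"
      using z(2) y(2) sy by (simp add: D_def \<Psi>_def z_def differential_eq_covector_of[OF \<phi> ch] covector_of_tvector_of[OF ch])
    ultimately show ?thesis using a(3) by (intro bexI[of _ z]) (auto simp: l_def z_def)
  qed
  have D0: "D (\<lambda>_. 0) = (\<lambda>_. 0)"
    using differential_scale[OF C1_functions_zero, of 0] by (auto simp: D_def)
  obtain P where P: "prob_space P" and P_sets: "sets P = sets (restrict_space borel X)"
    and PD: "\<And>f. f \<in> D ` C1_functions A \<Longrightarrow> (\<integral>z. f z \<partial>P) = 0" and Pl: "(\<integral>z. l z \<partial>P) \<le> 0"
  proof (rule moment_problem_solvable[of X "D ` C1_functions A" l])
    show "compact X" "continuous_on X l" by fact+
    show "X \<noteq> {}" using D_above[OF C1_functions_zero] by blast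
    show "(\<lambda>_. 0) \<in> D ` C1_functions A" using D0 C1_functions_zero by (metis imageI)
    show "(\<lambda>z. f z + h z) \<in> D ` C1_functions A" if fh: "f \<in> D ` C1_functions A" "h \<in> D ` C1_functions A" for f h
    proof -
      obtain \<phi> \<psi> where [simp]: "f = D \<phi>" "h = D \<psi>" and *: "\<phi> \<in> C1_functions A" "\<psi> \<in> C1_functions A" using fh by blast
      have "(\<lambda>z. f z + h z) = D (\<lambda>x. \<phi> x + \<psi> x)" using differential_add[OF *] by (auto simp: D_def)
      then show ?thesis using C1_functions_add[OF *] by blast
    qed
    show "(\<lambda>z. r * f z) \<in> D ` C1_functions A" if f: "f \<in> D ` C1_functions A" for f r
    proof -
      obtain \<phi> where [simp]: "f = D \<phi>" and *: "\<phi> \<in> C1_functions A" using f by blast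
      have "(\<lambda>z. r * f z) = D (\<lambda>x. r * \<phi> x)" using differential_scale[OF *] by (auto simp: D_def)
      then show ?thesis using C1_functions_scale[OF *] by blast
    qed
  qed (use D_cont D_above in auto)
  interpret P: prob_space P by fact
  have space_P: "space P = X" using sets_eq_imp_space_eq[OF P_sets] by (simp add: space_restrict_space)
  have int: "integrable P h" if h: "continuous_on X h" for h :: "_ \<Rightarrow> real"
  proof -
    obtain b where "\<And>x. x \<in> X \<Longrightarrow> \<bar>h x\<bar> \<le> b"
      using compact_imp_bounded[OF compact_continuous_image[OF h X]] unfolding bounded_iff by auto
    then show ?thesis using borel_measurable_continuous_on_restrict[OF h]
      by (intro P.integrable_const_bound[where B=b]) (auto simp: space_P measurable_cong_sets[OF P_sets refl])
  qed
  \<comment> \<open>On each slice of constant chart index the preimage of an open set is cut out by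
    an open condition on \<open>(y, a)\<close>. As there are finitely many closed slices, it is
    Borel.\<close>
  have \<Psi>_meas: "\<Psi> \<in> measurable P (tangent_borel A)"
    unfolding tangent_borel_def
  proof (rule measurable_measure_of)
    show "{W. openin (tangent_topology A) W} \<subseteq> Pow (tangent_bundle A)" by (auto simp: openin_tangent_topology)
    show "\<Psi> \<in> space P \<rightarrow> tangent_bundle A" using \<Psi>_in by (auto simp: space_P)
    fix W assume "W \<in> {W. openin (tangent_topology A) W}"
    define O' where "O' i = {(y, a). y \<in> chart_image (cs i) \<and>
        (chart_inv (cs i) y, tvector_of A (cs i) (chart_inv (cs i) y) a) \<in> W}" for i
    have O': "open (O' i)" if "i < N" for i
      using \<open>W \<in> _\<close> cs[OF that] by (auto simp: openin_tangent_topology O'_def)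
    define T where "T i = {real i} \<times> ((\<lambda>w :: 'b \<times> 'b \<times> 'b. (fst w, fst (snd w))) -` O' i)" for i
    have "T i \<in> sets borel" if "i < N" for i
    proof -
      have "open ((\<lambda>w :: 'b \<times> 'b \<times> 'b. (fst w, fst (snd w))) -` O' i)"
        by (intro open_vimage O' that continuous_intros)
      then have "open (UNIV \<times> ((\<lambda>w :: 'b \<times> 'b \<times> 'b. (fst w, fst (snd w))) -` O' i) :: (real \<times> 'b \<times> 'b \<times> 'b) set)"
        by (intro open_Times) auto
      moreover have "closed ({real i} \<times> UNIV :: (real \<times> 'b \<times> 'b \<times> 'b) set)" by (intro closed_Times) auto
      moreover have "T i = ({real i} \<times> UNIV) \<inter> (UNIV \<times> ((\<lambda>w :: 'b \<times> 'b \<times> 'b. (fst w, fst (snd w))) -` O' i))"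
        by (auto simp: T_def)
      ultimately show ?thesis by (simp add: borel_closed borel_open sets.Int)
    qed
    then have "(\<Union>i<N. T i) \<in> sets borel" by (intro sets.finite_UN) auto
    moreover have "\<Psi> -` W \<inter> X = (\<Union>i<N. T i) \<inter> X"
    proof (intro set_eqI iffI IntI; elim IntE)
      fix z assume z: "z \<in> \<Psi> -` W" "z \<in> X"
      then have "z \<in> T (idx z)" "idx z < N"
        using ZD(2)[of "idx z" "snd z"] by (auto simp: X_iff \<Psi>_def T_def O'_def mem_Times_iff)
      then show "z \<in> (\<Union>i<N. T i)" by blast
    next
      fix z assume "z \<in> (\<Union>i<N. T i)" "z \<in> X"
      then obtain i where "z \<in> T i" by blast
      moreover from this have "idx z = i" by (auto simp: T_def idx_def)
      ultimately show "z \<in> \<Psi> -` W" by (auto simp: \<Psi>_def T_def O'_def)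
    qed
    ultimately show "\<Psi> -` W \<inter> space P \<in> sets P"
      unfolding space_P P_sets sets_restrict_space by auto
  qed
  define \<nu> where "\<nu> = distr P (tangent_borel A) \<Psi>"
  have sets_\<nu>: "sets \<nu> = sets (tangent_borel A)" by (simp add: \<nu>_def)
  have prob_\<nu>: "prob_space \<nu>" unfolding \<nu>_def using \<Psi>_meas by (rule P.prob_space_distr)
  have tn_meas: "(\<lambda>z. tnorm g (fst z) (snd z)) \<in> borel_measurable (tangent_borel A)"
    using continuous_on_tnorm by (intro borel_measurable_tangent_continuous) auto
  have df_meas: "(\<lambda>z. differential A \<phi> (fst z) (snd z)) \<in> borel_measurable (tangent_borel A)"
    if "\<phi> \<in> C1_functions A" for \<phi>
    using continuous_on_differential[OF that] by (intro borel_measurable_tangent_continuous) auto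
  have "integrable \<nu> (\<lambda>z. tnorm g (fst z) (snd z))"
    unfolding \<nu>_def integrable_distr_eq[OF \<Psi>_meas tn_meas]
    using cont_\<Psi>[of "\<lambda>z. tnorm g (fst z) (snd z)"] continuous_on_tnorm by (intro int) auto
  moreover have "(\<integral>z. differential A \<phi> (fst z) (snd z) \<partial>\<nu>) = 0" if "\<phi> \<in> C1_functions A" for \<phi>
    unfolding \<nu>_def integral_distr[OF \<Psi>_meas df_meas[OF that]]
    using PD[of "D \<phi>"] that by (simp add: D_def[abs_def])
  ultimately have closed_\<nu>: "closed_measure A g \<nu>"
    unfolding closed_measure_def case_prod_unfold using prob_\<nu> sets_\<nu> by auto
  have int_l: "integrable P (\<lambda>z. l z - k)" using int[OF l_cont] by simp
  have L_int: "integrable P (\<lambda>z. Lagrangian A G (\<Psi> z))"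
    using int_l by (rule Bochner_Integration.integrable_cong[THEN iffD1, rotated 2]) (auto simp: space_P l_eq)
  then have "integrable \<nu> (Lagrangian A G)"
    unfolding \<nu>_def integrable_distr_eq[OF \<Psi>_meas borel_measurable_Lagrangian] .
  moreover have "(\<integral>z. Lagrangian A G z \<partial>\<nu>) = - k"
  proof (rule antisym)
    have eq: "(\<integral>z. Lagrangian A G z \<partial>\<nu>) = (\<integral>z. Lagrangian A G (\<Psi> z) \<partial>P)"
      unfolding \<nu>_def by (rule integral_distr[OF \<Psi>_meas borel_measurable_Lagrangian])
    also have "\<dots> = (\<integral>z. l z - k \<partial>P)"
      by (rule Bochner_Integration.integral_cong) (auto simp: space_P l_eq)
    also have "\<dots> = (\<integral>z. l z \<partial>P) - k" using int[OF l_cont] by (simp add: P.prob_space)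
    finally show "(\<integral>z. Lagrangian A G z \<partial>\<nu>) \<le> - k" using Pl by simp
    \<comment> \<open>Fenchel-Young integrated: the term \<open>D f\<close> has integral 0, so the
      action is at least minus the supremum of \<open>G\<close> along \<open>f\<close>. The infimum
      over \<open>f\<close> gives the bound with \<open>k\<close>.\<close>
    have "- (\<integral>z. Lagrangian A G (\<Psi> z) \<partial>P) \<le> (SUP x. G (x, differential A f x))" if f: "f \<in> C1_functions A" for f
    proof -
      let ?S = "SUP x. G (x, differential A f x)"
      have "(\<integral>z. D f z - ?S \<partial>P) \<le> (\<integral>z. Lagrangian A G (\<Psi> z) \<partial>P)"
      proof (rule integral_mono)
        show "integrable P (\<lambda>z. D f z - ?S)" using int[OF D_cont[OF f]] by simp
        fix z assume "z \<in> space P"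
        then have "snd (\<Psi> z) \<in> tangent_space A (fst (\<Psi> z))"
          using \<Psi>_in(1)[of z] unfolding space_P tangent_bundle_def by (metis (mono_tags) SigmaE fst_conv snd_conv)
        from Lagrangian_ge_differential[OF f this] G_differential_le_Sup[OF f, of "fst (\<Psi> z)"]
        show "D f z - ?S \<le> Lagrangian A G (\<Psi> z)" by (simp add: D_def)
      qed (fact L_int)
      moreover have "(\<integral>z. D f z - ?S \<partial>P) = - ?S"
        using int[OF D_cont[OF f]] PD[of "D f"] f by (simp add: P.prob_space)
      ultimately show ?thesis by simp
    qed
    then have "- (\<integral>z. Lagrangian A G (\<Psi> z) \<partial>P) \<le> k"
      unfolding k_def critical_value_def by (intro cINF_greatest C1ne)
    then show "- k \<le> (\<integral>z. Lagrangian A G z \<partial>\<nu>)" unfolding eq by simp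
  qed
  ultimately have "Mather_measure A g G \<nu>"
    unfolding Mather_measure_def using closed_\<nu> by (simp add: k_def)
  moreover have "AE z in \<nu>. fst z \<in> K"
  proof -
    have "fst -` K \<inter> space (tangent_borel A) \<in> sets (tangent_borel A)"
      using measurable_fst_tangent borel_closed[OF K] by (rule measurable_sets)
    then have "{z \<in> space (tangent_borel A). fst z \<in> K} \<in> sets (tangent_borel A)"
      by (simp add: vimage_def Int_def conj_commute)
    from AE_distr_iff[OF \<Psi>_meas this] show ?thesis
      unfolding \<nu>_def using \<Psi>_in(2) by (auto simp: space_P intro!: AE_I2)
  qed
  ultimately show ?thesis by (rule that)
qed

end

section \<open>Conclusion: comparison of the two solutions\<close>

theorem theorem5:
  fixes A :: "('a::{t2_space, second_countable_topology}, 'b::euclidean_space) chart set"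
    and g :: "'a \<Rightarrow> ('a, 'b) tvector \<Rightarrow> ('a, 'b) tvector \<Rightarrow> real"
    and G :: "'a \<times> ('a, 'b) covector \<Rightarrow> real"
    and \<sigma> u\<^sub>1 u\<^sub>2 :: "'a \<Rightarrow> real"
  assumes "closed_connected_riemannian_manifold A g"
    and "continuous_map (cotangent_topology A) euclideanreal G"
    and "convex_in_p A G"
    and "superlinear_in_p A g G"
    and "continuous_on UNIV \<sigma>"
    and "\<And>x. \<sigma> x > 0"
    and "viscosity_solution A G (critical_value A G) u\<^sub>1"
    and "viscosity_solution A G (critical_value A G) u\<^sub>2"
    and "\<And>\<mu>. projected_Mather_measure A g G \<mu> \<Longrightarrow>
           (\<integral>y. \<sigma> y * u\<^sub>1 y \<partial>\<mu>) \<le> (\<integral>y. \<sigma> y * u\<^sub>2 y \<partial>\<mu>)"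
  shows "\<forall>x. u\<^sub>1 x \<le> u\<^sub>2 x"
proof (rule ccontr)
  assume "\<not> (\<forall>x. u\<^sub>1 x \<le> u\<^sub>2 x)"
  then obtain x0 where x0: "u\<^sub>2 x0 < u\<^sub>1 x0" by (auto simp: not_le)
  interpret hamiltonian_manifold A g G
    using assms(1-4) unfolding closed_connected_riemannian_manifold_def by unfold_locales auto
  have u: "viscosity_subsolution A G (critical_value A G) u\<^sub>1"
    "viscosity_supersolution A G (critical_value A G) u\<^sub>2"
    and cu: "continuous_on UNIV u\<^sub>1" "continuous_on UNIV u\<^sub>2"
    using assms(7,8) unfolding viscosity_solution_def viscosity_subsolution_def by auto
  define h where "h x = u\<^sub>1 x - u\<^sub>2 x" for x
  have ch: "continuous_on UNIV h" unfolding h_def[abs_def] by (intro continuous_intros cu)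
  obtain y0 where y0: "\<And>x. h x \<le> h y0"
    using continuous_attains_sup[OF compact_UNIV _ ch] by auto
  have "0 < h y0" using y0[of x0] x0 by (simp add: h_def)
  define K where "K = {y. h y0 \<le> h y}"
  have "closed K" unfolding K_def by (intro closed_Collect_le continuous_intros ch)
  have "\<exists>y\<in>K. critical_value A G \<le> G (y, differential A \<phi> y)" if "\<phi> \<in> C1_functions A" for \<phi>
    using contact_set_meets_supercritical[OF u that] by (auto simp: K_def h_def)
  then obtain \<nu> where \<nu>: "Mather_measure A g G \<nu>" "AE z in \<nu>. fst z \<in> K"
    using Mather_measure_over[OF \<open>closed K\<close>] by blast
  then have prob: "prob_space \<nu>" and sets_\<nu>: "sets \<nu> = sets (tangent_borel A)"
    by (auto simp: Mather_measure_def closed_measure_def)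
  interpret \<nu>: prob_space \<nu> by (rule prob)
  have fst_meas: "fst \<in> measurable \<nu> borel"
    using measurable_fst_tangent by (simp add: measurable_cong_sets[OF sets_\<nu> refl])
  have int: "integrable \<nu> (\<lambda>z. f (fst z))" if f: "continuous_on UNIV f" for f :: "'a \<Rightarrow> real"
  proof -
    have "bounded (range f)" by (intro compact_imp_bounded compact_continuous_image compact_UNIV f)
    then obtain b where "\<And>x. \<bar>f x\<bar> \<le> b" unfolding bounded_iff by auto
    then show ?thesis
      using measurable_compose[OF fst_meas borel_measurable_continuous_onI[OF f]]
      by (intro \<nu>.integrable_const_bound[where B=b]) auto
  qed
  have \<sigma>u: "continuous_on UNIV (\<lambda>y. \<sigma> y * u\<^sub>1 y)" "continuous_on UNIV (\<lambda>y. \<sigma> y * u\<^sub>2 y)"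
    by (intro continuous_intros assms(5) cu)+
  have "(\<integral>y. \<sigma> y * u\<^sub>1 y \<partial>distr \<nu> borel fst) \<le> (\<integral>y. \<sigma> y * u\<^sub>2 y \<partial>distr \<nu> borel fst)"
    using \<nu>(1) by (intro assms(9)) (auto simp: projected_Mather_measure_def)
  then have "(\<integral>z. \<sigma> (fst z) * u\<^sub>1 (fst z) \<partial>\<nu>) \<le> (\<integral>z. \<sigma> (fst z) * u\<^sub>2 (fst z) \<partial>\<nu>)"
    by (simp add: integral_distr[OF fst_meas] borel_measurable_continuous_onI \<sigma>u)
  then have "(\<integral>z. \<sigma> (fst z) * h (fst z) \<partial>\<nu>) \<le> 0"
    using int[OF \<sigma>u(1)] int[OF \<sigma>u(2)] by (simp add: h_def right_diff_distrib)
  \<comment> \<open>By compactness \<open>\<sigma>\<close> has a positive minimum. Almost everywhere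
    \<open>h (fst z)\<close> is at least the positive maximum \<open>h y0\<close>, so the integral
    is at least \<open>\<sigma> y1 * h y0 > 0\<close>.\<close>
  moreover obtain y1 where y1: "\<And>y. \<sigma> y1 \<le> \<sigma> y"
    using continuous_attains_inf[OF compact_UNIV _ assms(5)] by auto
  have "\<sigma> y1 * h y0 \<le> (\<integral>z. \<sigma> (fst z) * h (fst z) \<partial>\<nu>)"
  proof (rule \<nu>.integral_ge_const)
    show "integrable \<nu> (\<lambda>z. \<sigma> (fst z) * h (fst z))" by (intro int continuous_intros assms(5) ch)
    show "AE z in \<nu>. \<sigma> y1 * h y0 \<le> \<sigma> (fst z) * h (fst z)"
      using \<nu>(2)
    proof eventually_elim
      case (elim z)
      then show ?case
        using y1[of "fst z"] \<open>0 < h y0\<close> less_imp_le[OF assms(6)[of "fst z"]]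
        by (intro mult_mono) (auto simp: K_def)
    qed
  qed
  ultimately show False using mult_pos_pos[OF assms(6)[of y1] \<open>0 < h y0\<close>] by linarith
qed

end
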